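(* Let $F_2$ be a nonempty finite set of positive integers, $\mathcal F=(\emptyset,F_2)$, and let $\alpha,\beta$ be real numbers satisfying (A1) and (A2) such that $\alpha,\beta,\mathcal F$ are Jacobi admissible. Then $\alpha+k_2+1>0$, $\beta-k_2+1>0$ and $\Omega^{\alpha,\beta}_{\mathcal F}(x)\neq0$ for all $x\in[-1,1]$.
   Context: $(a)_0=1$, $(a)_j=a(a+1)\cdots(a+j-1)$. Jacobi polynomials: $P^{a,b}_n(x)=2^{-n}\sum_{j=0}^n\binom{n+a}{j}\binom{n+b}{n-j}(x-1)^{n-j}(x+1)^j$. $F_2=\{f^{(2)}_1<\dots<f^{(2)}_{k_2}\}$, $k=k_2$ here. (A1): $\alpha,\beta,\alpha+\beta\notin\{-1,-2,\dots\}$. (A2): $\alpha-\beta\notin\{-1,-2,\dots\}$ and $\beta-f^{(2)}_{k_2}-1\notin\{-1,-2,\dots\}$. For $\mathcal F=(\emptyset,F_2)$: $\Omega^{\alpha,\beta}_{\mathcal F}(x)=\det W(x)/(1+x)^{k_2(k_2-1)}$, with $W(x)$ the $k_2\times k_2$ matrix with columns $j=1,\dots,k_2$ and rows, for $f\in F_2$ increasing, $\big((\beta-f)_{j-1}(1+x)^{k_2-j}P^{\alpha+j-1,-\beta-j+1}_f(x)\big)_j$. Jacobi admissibility: with $\mathcal H^{\alpha,\beta}_{\mathcal F}(x)=\prod_{f\in F_2}(x+\beta-f)(x+f+\alpha+1)\cdot\frac{\Gamma(x+\alpha+1)\Gamma(x+\beta+1)}{(2x+\alpha+\beta+1)\Gamma(x+\alpha+\beta+1)}$,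 $\alpha,\beta,\mathcal F$ are Jacobi admissible if $\mathcal H^{\alpha,\beta}_{\mathcal F}(x)\ge0$ for all $x\in\mathbb N=\{0,1,2,\dots\}$. *)

theory Defs
  imports "HOL-Analysis.Analysis" "HOL-Computational_Algebra.Polynomial"
    "Jordan_Normal_Form.Determinant"
begin

definition jacobiP :: "real \<Rightarrow> real \<Rightarrow> nat \<Rightarrow> real poly" where
  "jacobiP a b n = Polynomial.smult (1 / 2 ^ n)
     (\<Sum>j = 0..n. Polynomial.smult (((real n + a) gchoose j) * ((real n + b) gchoose (n - j)))
         ([:-1, 1:] ^ (n - j) * [:1, 1:] ^ j))"

(* the k x k matrix W(x) (entries polynomials in x), rows indexed by the elements of F2
   in increasing order, columns j = 1..k (here 0-indexed j' = j - 1) *)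
definition Wmat :: "real \<Rightarrow> real \<Rightarrow> nat set \<Rightarrow> real poly mat" where
  "Wmat \<alpha> \<beta> F2 = (let k = card F2; fs = sorted_list_of_set F2 in
     mat k k (\<lambda>(i, j). let f = fs ! i in
        Polynomial.smult (pochhammer (\<beta> - real f) j)
          ([:1, 1:] ^ (k - 1 - j) * jacobiP (\<alpha> + real j) (- \<beta> - real j) f)))"

definition OmegaPoly :: "real \<Rightarrow> real \<Rightarrow> nat set \<Rightarrow> real poly" where
  "OmegaPoly \<alpha> \<beta> F2 = det (Wmat \<alpha> \<beta> F2) div [:1, 1:] ^ (card F2 * (card F2 - 1))"

definition Omega :: "real \<Rightarrow> real \<Rightarrow> nat set \<Rightarrow> real \<Rightarrow> real" where
  "Omega \<alpha> \<beta> F2 x = poly (OmegaPoly \<alpha> \<beta> F2) x"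

definition negint :: "real \<Rightarrow> bool" where
  "negint r \<longleftrightarrow> (\<exists>n::nat. n \<ge> 1 \<and> r = - real n)"

definition A1 :: "real \<Rightarrow> real \<Rightarrow> bool" where
  "A1 \<alpha> \<beta> \<longleftrightarrow> \<not> negint \<alpha> \<and> \<not> negint \<beta> \<and> \<not> negint (\<alpha> + \<beta>)"

definition A2 :: "real \<Rightarrow> real \<Rightarrow> nat set \<Rightarrow> bool" where
  "A2 \<alpha> \<beta> F2 \<longleftrightarrow> \<not> negint (\<alpha> - \<beta>) \<and> \<not> negint (\<beta> - real (Max F2) - 1)"

definition Hfun :: "real \<Rightarrow> real \<Rightarrow> nat set \<Rightarrow> real \<Rightarrow> real" where
  "Hfun \<alpha> \<beta> F2 x = (\<Prod>f\<in>F2. (x + \<beta> - real f) * (x + real f + \<alpha> + 1)) *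
     (Gamma (x + \<alpha> + 1) * Gamma (x + \<beta> + 1) /
      ((2 * x + \<alpha> + \<beta> + 1) * Gamma (x + \<alpha> + \<beta> + 1)))"

definition jacobi_admissible :: "real \<Rightarrow> real \<Rightarrow> nat set \<Rightarrow> bool" where
  "jacobi_admissible \<alpha> \<beta> F2 \<longleftrightarrow> (\<forall>x::nat. Hfun \<alpha> \<beta> F2 (real x) \<ge> 0)"

end

theory Submission
  imports Defs
begin

text \<open>
  Write \<open>w = (1 - x) powr \<alpha> * (1 + x) powr \<beta>\<close>, let \<open>L\<close> be the Jacobi operator for \<open>w\<close>, let \<open>k = card F2\<close> and
  \<open>\<phi>\<^sub>f = (1 + x) powr (- \<beta>) * jacobiP \<alpha> (- \<beta>) f\<close>. Then \<open>L \<phi>\<^sub>f = \<lambda>\<^sub>f \<phi>\<^sub>f\<close>, and up to sign \<open>Omega\<close> is the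
  Wronskian of the polynomials \<open>jacobiP \<alpha> (- \<beta>) f\<close>. If it vanishes at \<open>x0\<close>, some nontrivial combination \<open>u\<close> of
  the \<open>\<phi>\<^sub>f\<close> vanishes to order \<open>k\<close> at \<open>x0\<close>. At \<open>x0 = 1\<close> and \<open>x0 = -1\<close> this is impossible because \<open>L\<close> lowers the order
  of vanishing there only by one.

  In the interior let \<open>v\<close> be \<open>u\<close> to the right of \<open>x0\<close> and \<open>0\<close> to the left. Admissibility says that the form
  \<open>Q p r = \<integral> p (\<Prod>\<^sub>f (L - \<lambda>\<^sub>f)) r w\<close> is positive semidefinite on polynomials, since \<open>Hfun\<close> gives the sign of
  \<open>Q p\<^sub>n p\<^sub>n\<close> for the \<open>n\<close>-th Jacobi polynomial. As \<open>v\<close> has \<open>k\<close> bounded derivatives, it lies in the form domain, and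
  integration by parts gives \<open>Q v v = 0\<close>. Hence \<open>Q v r = 0\<close> for all polynomials \<open>r\<close>, which forces \<open>u = 0\<close>.

  As \<open>\<alpha>\<close> may be below \<open>-1\<close>, integrals are regularized at \<open>1\<close>; \<open>\<alpha> + k > -1\<close> makes the \<open>k\<close>-fold regularization enough.
  That bound and the one for \<open>\<beta>\<close> come from counting the sign changes of the factors of \<open>Hfun\<close>.
\<close>

text \<open>The cut function v has only a bounded, jumping k-th derivative, while \<open>Q\<close>
  is given on polynomials through an operator of order 2k, so \<open>Q v v\<close> has to be reached
  by limits. Two facts make this possible. With one polynomial argument fixed, \<open>Q\<close>
  passes to the limit in the other. With both arguments tending to zero boundedly along with k
  derivatives, \<open>Q\<close> tends to zero, because each factor of the operator can be split by
  parts into one derivative on each side. Differences of two approximants link the two facts.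

  The order k of the zero is just enough: moving 2k derivatives across the cut leaves boundary terms
  at x0, killed partly by the k zeros of u and partly by the k zeros of the approximants.

  The product in \<open>Hfun\<close> comes from n(n + \<alpha> + \<beta> + 1) - (f - \<beta>)(f +
  \<alpha> + 1) = (n + \<beta> - f)(n + f + \<alpha> + 1), the eigenvalue of the n-th Jacobi
  polynomial minus that of the seed for f; the Gamma quotient has the sign of the square norm of
  that polynomial. Only the endpoint 1 needs regularization, since \<beta> > k - 1 >= 0.\<close>

section \<open>Sign changes of the admissibility function\<close>

text \<open>For \<open>A\<close>, \<open>B\<close>, \<open>S\<close> the floors of \<open>-\<alpha>\<close>, \<open>-\<beta>\<close>, \<open>-(\<alpha> + \<beta>)\<close>, this counts the factors of \<open>Hfun\<close> that change
  sign between \<open>n\<close> and \<open>n + 1\<close>; admissibility makes it even.\<close>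

definition parity_sum :: "nat set \<Rightarrow> int \<Rightarrow> int \<Rightarrow> int \<Rightarrow> int \<Rightarrow> nat" where
  "parity_sum F A B S n = of_bool (n < A) + of_bool (n < B) + of_bool (n < S)
     + of_bool (S = 2 * n + 1 \<or> S = 2 * n + 2)
     + of_bool (n - B \<in> int ` F) + of_bool (A - 1 - n \<in> int ` F)"

text \<open>The reflection \<open>n \<mapsto> A + B - 1 - n\<close> exchanges all the contributions but the one of \<open>2n + \<alpha> + \<beta> + 1\<close>.\<close>

lemma parity_sum_nonpos:
  assumes S: "S = A + B \<or> S = A + B + 1"
    and E: "\<And>n. n \<ge> 0 \<Longrightarrow> even (parity_sum F A B S n)"
  shows "A + B \<le> 0"
proof (rule ccontr)
  assume "\<not> A + B \<le> 0"
  hence AB: "A + B \<ge> 1" by simp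
  define h where "h = (S - 1) div 2"
  have h: "S = 2 * h + 1 \<or> S = 2 * h + 2" unfolding h_def by presburger
  have h0: "0 \<le> h" "h \<le> A + B - 1" using h S AB by auto
  define h' where "h' = A + B - 1 - h"
  have h'0: "0 \<le> h'" "h' \<le> A + B - 1" using h0 unfolding h'_def by auto
  have e1: "even (parity_sum F A B S h)" and e2: "even (parity_sum F A B S h')"
    using E h0 h'0 by auto
  have m: "h' - B = A - 1 - h" "A - 1 - h' = h - B" "(h' < A) = (\<not> h < B)" "(h' < B) = (\<not> h < A)"
    unfolding h'_def by auto
  have S': "h < S" "h' < S" using h0 h'0 S by auto
  \<comment> \<open>The sums at \<open>h\<close> and \<open>h'\<close> add up to an odd number: of
    the four tests against \<open>A\<close> and \<open>B\<close> exactly two hold,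
    \<open>n < S\<close> holds at both points, the memberships in \<open>F\<close> are exchanged,
    and the test \<open>S = 2 * n + 1 \<or> S = 2 * n + 2\<close> holds at \<open>h\<close> alone.
    At a fixed point \<open>h = h'\<close> the single sum is already odd.\<close>
  show False
  proof (cases "h = h'")
    case True
    hence "h - B = A - 1 - h" "(h < A) = (\<not> h < B)" using m by auto
    moreover have "S = 2 * h + 1 \<or> S = 2 * h + 2" by (rule h)
    ultimately show False using e1 S' unfolding parity_sum_def
      by (cases "h < B"; cases "A - 1 - h \<in> int ` F") (simp_all only: of_bool_def if_True if_False, simp_all)
  next
    case False
    hence "\<not> (S = 2 * h' + 1 \<or> S = 2 * h' + 2)" using h by presburger
    thus False using e1 e2 h S' m unfolding parity_sum_def by (auto simp: of_bool_def split: if_splits)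
  qed
qed

text \<open>Once A + B <= 0, evenness dictates where \<open>F\<close> may lie. For A <= 0 no n >= 0
  can have n - B in \<open>F\<close>, so \<open>F\<close> lies below -B. For A >= 1 each n in
  [0, A - 1] puts exactly one of n - B and A - 1 - n into \<open>F\<close>; this accounts for
  exactly A elements in two disjoint windows, nothing lies beyond them, and the rest sits in the gap
  [A, -B - 1]. Counting gives A <= \<open>card F\<close> <= -B.\<close>

lemma parity_sum_bounds:
  assumes F: "finite F" "F \<noteq> {}" "\<forall>f\<in>F. f > 0"
    and S: "S = A + B \<or> S = A + B + 1"
    and E: "\<And>n. n \<ge> 0 \<Longrightarrow> even (parity_sum F A B S n)"
  shows "A \<le> int (card F)" "B \<le> - int (card F)"
proof -
  have AB: "A + B \<le> 0" using parity_sum_nonpos[OF S E] .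
  \<comment> \<open>Here S <= 1, so the two contributions that involve \<open>S\<close> can hold
    only for S = 1 and n = 0, and then both do: they cancel modulo 2.\<close>
  have red: "even (of_bool (n < A) + of_bool (n < B)
     + of_bool (n - B \<in> int ` F) + of_bool (A - 1 - n \<in> int ` F) :: nat)" if "n \<ge> 0" for n
    using E[OF that] S AB that unfolding parity_sum_def by (auto simp: of_bool_def split: if_splits)
  have pos: "x > 0" if "x \<in> int ` F" for x using F(3) that by auto
  have B0: "B \<le> 0"
  proof (rule ccontr)
    assume "\<not> B \<le> 0"
    hence B: "B \<ge> 1" "A \<le> -1" using AB by auto
    obtain f where f: "f \<in> F" using F(2) by auto
    \<comment> \<open>At n = f + B the membership of n - B = f is the only contribution that
      holds.\<close>
    have n: "int f + B \<ge> 0" using B by auto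
    have "A - 1 - (int f + B) \<notin> int ` F" using pos B by force
    thus False using red[OF n] B f by auto
  qed
  have "A \<le> int (card F) \<and> B \<le> - int (card F)"
  proof (cases "A \<le> 0")
    case True
    have "int ` F \<subseteq> {1..-B-1}"
    proof
      fix x assume x: "x \<in> int ` F"
      have "x < -B"
      proof (rule ccontr)
        assume "\<not> x < -B"
        hence n: "x + B \<ge> 0" by simp
        have "A - 1 - (x+B) \<notin> int ` F" using pos n True by force
        thus False using red[OF n] n True B0 x by auto
      qed
      thus "x \<in> {1..-B-1}" using pos[OF x] by auto
    qed
    hence "card (int ` F) \<le> card {1..-B-1}" by (intro card_mono) auto
    moreover have "card (int ` F) = card F" by (simp add: card_image)
    moreover have "card F > 0" using F by (simp add: card_gt_0_iff)
    ultimately have "int (card F) \<le> - B - 1" by auto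
    thus ?thesis using True by auto
  next
    case False
    hence A: "A \<ge> 1" by simp
    define G where "G = int ` F"
    have finG: "finite G" and cG: "card G = card F" unfolding G_def using F by (auto simp: card_image)
    have r: "(n - B \<in> G) = (\<not> A - 1 - n \<in> G)" if "0 \<le> n" "n < A" for n
      using red[OF that(1)] that B0 unfolding G_def by (auto simp: of_bool_def split: if_splits)
    have r2: "n - B \<notin> G" if "n \<ge> A" for n
    proof -
      have "A - 1 - n \<notin> G" using pos that unfolding G_def by force
      thus ?thesis using red[of n] that A B0 unfolding G_def by (auto simp: of_bool_def split: if_splits)
    qed
    define G1 where "G1 = G \<inter> {-B..A-B-1}"
    define G2 where "G2 = G \<inter> {0..A-1}"
    define N where "N = {n\<in>{0..A-1}. n - B \<in> G}"
    have subN: "N \<subseteq> {0..A-1}" unfolding N_def by auto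
    have c1: "card G1 = card N"
    proof -
      have "G1 = (\<lambda>n. n - B) ` N" unfolding G1_def N_def 
      proof safe
        fix x assume x: "x \<in> G" "x \<in> {-B..A-B-1}"
        have "x = (x + B) - B" by simp
        moreover have "x + B \<in> {n \<in> {0..A-1}. n - B \<in> G}" using x by auto
        ultimately show "x \<in> (\<lambda>n. n - B) ` {n \<in> {0..A-1}. n - B \<in> G}" by blast
      qed auto
      thus ?thesis by (simp add: card_image inj_on_def)
    qed
    have c2: "card G2 = card ({0..A-1} - N)"
    proof -
      have "G2 = (\<lambda>n. A - 1 - n) ` ({0..A-1} - N)"
      proof
        show "G2 \<subseteq> (\<lambda>n. A - 1 - n) ` ({0..A-1} - N)"
        proof
          fix x assume x: "x \<in> G2"
          have "A - 1 - x \<in> {0..A-1} - N" using x r[of "A-1-x"] unfolding G2_def N_def by auto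
          moreover have "x = A - 1 - (A - 1 - x)" by simp
          ultimately show "x \<in> (\<lambda>n. A - 1 - n) ` ({0..A-1} - N)" by blast
        qed
        show "(\<lambda>n. A - 1 - n) ` ({0..A-1} - N) \<subseteq> G2" using r unfolding G2_def N_def by auto
      qed
      thus ?thesis by (simp add: card_image inj_on_def)
    qed
    have c: "card N + card ({0..A-1} - N) = card {0..A-1}"
      using card_Diff_subset[of N "{0..A-1}"] card_mono[of "{0..A-1}" N] subN finite_subset[OF subN] by simp
    have disj: "G1 \<inter> G2 = {}" unfolding G1_def G2_def using AB by auto
    have k1: "int (card (G1 \<union> G2)) = A" using c c1 c2 A disj finG unfolding G1_def G2_def
      by (subst card_Un_disjoint) auto
    have k2: "card (G1 \<union> G2) \<le> card G" unfolding G1_def G2_def using finG by (intro card_mono) auto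
    have "G \<subseteq> (G1 \<union> G2) \<union> {A..-B-1}"
    proof
      fix x assume x: "x \<in> G"
      have "x \<ge> 0" using pos x unfolding G_def by force
      moreover have "x < A - B" using r2[of "x + B"] x by (rule_tac ccontr) auto
      ultimately show "x \<in> (G1 \<union> G2) \<union> {A..-B-1}" using x unfolding G1_def G2_def by auto
    qed
    note sub = this
    have "card G \<le> card ((G1 \<union> G2) \<union> {A..-B-1})" using finG sub unfolding G1_def G2_def by (intro card_mono) auto
    also have "\<dots> \<le> card (G1 \<union> G2) + card {A..-B-1}" by (rule card_Un_le)
    finally show ?thesis using k1 k2 cG AB by auto
  qed
  thus "A \<le> int (card F)" "B \<le> - int (card F)" by auto
qed

section \<open>Signs of products as parities\<close>

definition sgn_pow :: "real \<Rightarrow> nat \<Rightarrow> bool" where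
  "sgn_pow r n \<longleftrightarrow> sgn r = (-1) ^ n"

lemma sgn_parity: "r \<noteq> 0 \<Longrightarrow> sgn_pow r (of_bool (r < 0))"
  by (auto simp: sgn_pow_def sgn_if)

lemma sgn_pow_mult: "sgn_pow r m \<Longrightarrow> sgn_pow t n \<Longrightarrow> sgn_pow (r * t) (m + n)"
  by (auto simp: sgn_pow_def sgn_mult power_add)

lemma sgn_pow_divide: "sgn_pow r m \<Longrightarrow> sgn_pow t n \<Longrightarrow> sgn_pow (r / t) (m + n)"
  by (auto simp: sgn_pow_def divide_inverse sgn_mult power_add) (metis inverse_1 inverse_minus_eq minus_one_power_iff)

lemma sgn_pow_prod:
  assumes "finite F" "\<And>f. f \<in> F \<Longrightarrow> sgn_pow (g f) (of_bool (int f = t))"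
  shows "sgn_pow (\<Prod>f\<in>F. g f) (of_bool (t \<in> int ` F))"
  using assms
proof (induction F rule: finite_induct)
  case empty thus ?case by (simp add: sgn_pow_def)
next
  case (insert f F)
  have "sgn_pow (g f * prod g F) (of_bool (int f = t) + of_bool (t \<in> int ` F))"
    using insert by (intro sgn_pow_mult) auto
  moreover have "of_bool (int f = t) + of_bool (t \<in> int ` F) = (of_bool (t \<in> int ` insert f F) :: nat)"
    using insert by auto
  ultimately show ?case using insert by simp
qed

lemma A2_nonzero:
  assumes "finite F2" "A2 \<alpha> \<beta> F2" "f \<in> F2"
  shows "real n + \<beta> - real f \<noteq> 0"
proof
  assume e: "real n + \<beta> - real f = 0"
  have "f \<le> Max F2" using assms by simp
  hence "\<beta> - real (Max F2) - 1 = - real (Max F2 - f + n + 1)" using e by (simp add: of_nat_diff)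
  thus False using assms(2) unfolding A2_def negint_def by (metis le_add2)
qed

text \<open>By (A1) and (A2) \<open>Hfun\<close> has no zero at a natural number, so admissibility
  makes its values positive. In the product of two consecutive values the functional equation of
  Gamma leaves a rational function \<open>X\<close> times the square of \<open>P\<close>; the sign
  of \<open>X\<close>, read off factor by factor, is the parity condition.\<close>

lemma admissible_bounds:
  fixes \<alpha> \<beta> :: real and F2 :: "nat set"
  assumes F: "finite F2" "F2 \<noteq> {}" "\<forall>f\<in>F2. f > 0"
    and A1: "A1 \<alpha> \<beta>" and A2: "A2 \<alpha> \<beta> F2"
    and adm: "jacobi_admissible \<alpha> \<beta> F2"
  shows "\<alpha> + real (card F2) + 1 > 0" "\<beta> - real (card F2) + 1 > 0"
proof -
  have na: "real n + \<alpha> + 1 \<noteq> 0" and nb: "real n + \<beta> + 1 \<noteq> 0" and ns: "real n + \<alpha> + \<beta> + 1 \<noteq> 0" for n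
    using A1 unfolding A1_def negint_def by (smt (verit) of_nat_Suc le_add1 plus_1_eq_Suc)+
  have nF: "real n + \<beta> - real f \<noteq> 0" if "f \<in> F2" for n f
    by (rule A2_nonzero[OF F(1) A2 that])
  define H where "H = (\<lambda>n::nat. Hfun \<alpha> \<beta> F2 (real n))"
  define A where "A = \<lfloor>-\<alpha>\<rfloor>"
  define B where "B = \<lfloor>-\<beta>\<rfloor>"
  define S where "S = \<lfloor>-(\<alpha>+\<beta>)\<rfloor>"
  have gam: "Gamma (real n + c + 1) \<noteq> 0" if "\<And>m. real m + c + 1 \<noteq> 0" for n and c :: real
  proof
    assume "Gamma (real n + c + 1) = 0"
    then obtain j where "real n + c + 1 = - real j"
      by (auto simp: Gamma_eq_zero_iff elim!: nonpos_Ints_cases')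
    thus False using that[of "n + j"] by simp
  qed
  have gam3: "Gamma (real n + \<alpha> + 1) \<noteq> 0" "Gamma (real n + \<beta> + 1) \<noteq> 0" "Gamma (real n + \<alpha> + \<beta> + 1) \<noteq> 0" for n
    using gam[of \<alpha> n] gam[of \<beta> n] gam[of "\<alpha>+\<beta>" n] na nb ns by (auto simp: add.assoc)
  have n2: "2 * real n + \<alpha> + \<beta> + 1 \<noteq> 0" for n using ns[of "2 * n"] by simp
  have Hpos: "H n > 0" for n
  proof -
    have "real n + real f + \<alpha> + 1 \<noteq> 0" for f using na[of "n + f"] by simp
    hence "H n \<noteq> 0" unfolding H_def Hfun_def using F(1) nF gam3 n2 by simp
    thus ?thesis using adm unfolding jacobi_admissible_def H_def by (simp add: order_less_le)
  qed
  have E: "even (parity_sum F2 A B S n)" if "n \<ge> 0" for n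
  proof -
    define m where "m = nat n"
    have nm: "n = int m" using that m_def by simp
    define g1 where "g1 = (\<lambda>f. (real m + \<beta> - real f) * (real m + \<beta> - real f + 1))"
    define g2 where "g2 = (\<lambda>f. (real m + real f + \<alpha> + 1) * (real m + real f + \<alpha> + 2))"
    define P where "P = Gamma (real m + \<alpha> + 1) * Gamma (real m + \<beta> + 1) / Gamma (real m + \<alpha> + \<beta> + 1)"
    define X where "X = prod g1 F2 * prod g2 F2 * ((real m + \<alpha> + 1) * (real m + \<beta> + 1)
       / ((2 * real m + \<alpha> + \<beta> + 1) * (2 * real m + \<alpha> + \<beta> + 3) * (real m + \<alpha> + \<beta> + 1)))"
    have G1: "Gamma (z + 1) = z * Gamma z" if "z \<noteq> 0" "Gamma z \<noteq> 0" for z :: real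
      using that Gamma_plus1 Gamma_eq_zero_iff by blast
    have Hm: "H m = (\<Prod>f\<in>F2. (real m + \<beta> - real f) * (real m + real f + \<alpha> + 1)) * (P / (2 * real m + \<alpha> + \<beta> + 1))"
      unfolding H_def Hfun_def P_def by (simp add: field_simps)
    have "Gamma (real (Suc m) + \<alpha> + 1) = (real m + \<alpha> + 1) * Gamma (real m + \<alpha> + 1)"
      using G1[OF na gam3(1), of m] by (simp add: algebra_simps)
    moreover have "Gamma (real (Suc m) + \<beta> + 1) = (real m + \<beta> + 1) * Gamma (real m + \<beta> + 1)"
      using G1[OF nb gam3(2), of m] by (simp add: algebra_simps)
    moreover have "Gamma (real (Suc m) + \<alpha> + \<beta> + 1) = (real m + \<alpha> + \<beta> + 1) * Gamma (real m + \<alpha> + \<beta> + 1)"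
      using G1[OF ns gam3(3), of m] by (simp add: algebra_simps)
    moreover have "2 * real (Suc m) + \<alpha> + \<beta> + 1 = 2 * real m + \<alpha> + \<beta> + 3" by simp
    moreover have "(\<Prod>f\<in>F2. (real (Suc m) + \<beta> - real f) * (real (Suc m) + real f + \<alpha> + 1)) =
        (\<Prod>f\<in>F2. (real m + \<beta> - real f + 1) * (real m + real f + \<alpha> + 2))"
      by (rule prod.cong[OF refl], rule arg_cong2[where f="(*)"]) simp_all
    ultimately have Hsm: "H (Suc m) = (\<Prod>f\<in>F2. (real m + \<beta> - real f + 1) * (real m + real f + \<alpha> + 2)) *
        (P * ((real m + \<alpha> + 1) * (real m + \<beta> + 1)) / ((2 * real m + \<alpha> + \<beta> + 3) * (real m + \<alpha> + \<beta> + 1)))"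
      unfolding H_def Hfun_def P_def by (simp only:) (simp add: mult_ac)
    have "H m * H (Suc m) = X * P\<^sup>2"
      unfolding Hm Hsm X_def g1_def g2_def prod.distrib by (simp add: power2_eq_square mult_ac)
    moreover have "H m * H (Suc m) > 0" using Hpos by simp
    ultimately have "X > 0" by (simp add: zero_less_mult_iff)
    have n3: "2 * real m + \<alpha> + \<beta> + 3 \<noteq> 0" using n2[of "Suc m"] by simp
    have s1: "sgn_pow (prod g1 F2) (of_bool (n - B \<in> int ` F2))"
    proof (rule sgn_pow_prod[OF F(1)])
      fix f assume f: "f \<in> F2"
      have nz: "real m + \<beta> - real f \<noteq> 0" "real m + \<beta> - real f + 1 \<noteq> 0" using nF[OF f, of m] nF[OF f, of "Suc m"] by auto
      have "(int f = n - B) \<longleftrightarrow> B = n - int f" by auto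
      also have "\<dots> \<longleftrightarrow> real_of_int (n - int f) \<le> -\<beta> \<and> -\<beta> < real_of_int (n - int f) + 1"
        unfolding B_def by (rule floor_eq_iff)
      also have "\<dots> \<longleftrightarrow> real m + \<beta> - real f < 0 \<and> real m + \<beta> - real f + 1 > 0" using nz nm by auto
      also have "\<dots> \<longleftrightarrow> g1 f < 0" unfolding g1_def mult_less_0_iff by auto
      finally show "sgn_pow (g1 f) (of_bool (int f = n - B))"
        using sgn_parity[of "g1 f"] nz unfolding g1_def by simp
    qed
    have s2: "sgn_pow (prod g2 F2) (of_bool (A - 1 - n \<in> int ` F2))"
    proof (rule sgn_pow_prod[OF F(1)])
      fix f assume f: "f \<in> F2"
      have nz: "real m + real f + \<alpha> + 1 \<noteq> 0" "real m + real f + \<alpha> + 2 \<noteq> 0" using na[of "m + f"] na[of "Suc m + f"] by auto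
      have "(int f = A - 1 - n) \<longleftrightarrow> A = n + int f + 1" by auto
      also have "\<dots> \<longleftrightarrow> real_of_int (n + int f + 1) \<le> -\<alpha> \<and> -\<alpha> < real_of_int (n + int f + 1) + 1"
        unfolding A_def by (rule floor_eq_iff)
      also have "\<dots> \<longleftrightarrow> real m + real f + \<alpha> + 1 < 0 \<and> real m + real f + \<alpha> + 2 > 0" using nz nm by auto
      also have "\<dots> \<longleftrightarrow> g2 f < 0" unfolding g2_def mult_less_0_iff by auto
      finally show "sgn_pow (g2 f) (of_bool (int f = A - 1 - n))"
        using sgn_parity[of "g2 f"] nz unfolding g2_def by simp
    qed
    have lt: "(real m + c + 1 < 0) \<longleftrightarrow> n < \<lfloor>-c\<rfloor>" if "real m + c + 1 \<noteq> 0" for c :: real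
      using that nm by (simp add: less_floor_iff) linarith
    have lt2: "(2 * real m + \<alpha> + \<beta> + 1 < 0) \<longleftrightarrow> 2 * n < S" "(2 * real m + \<alpha> + \<beta> + 3 < 0) \<longleftrightarrow> 2 * n + 2 < S"
      using n2[of m] n3 nm unfolding S_def by (simp_all add: less_floor_iff) linarith+
    have "sgn_pow X (of_bool (n - B \<in> int ` F2) + of_bool (A - 1 - n \<in> int ` F2)
        + ((of_bool (n < A) + of_bool (n < B)) + (of_bool (2 * n < S) + of_bool (2 * n + 2 < S) + of_bool (n < S))))"
      unfolding X_def
      apply (intro sgn_pow_mult sgn_pow_divide s1 s2)
      using sgn_parity[OF na[of m]] sgn_parity[OF nb[of m]] sgn_parity[OF ns[of m]] sgn_parity[OF n2[of m]] sgn_parity[OF n3]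
        lt[OF na[of m]] lt[OF nb[of m]] lt[of "\<alpha> + \<beta>"] ns[of m] lt2
      unfolding A_def B_def S_def by (simp_all add: add.assoc[symmetric])
    moreover have "sgn X = 1" using \<open>X > 0\<close> by simp
    ultimately have "even (of_bool (n - B \<in> int ` F2) + of_bool (A - 1 - n \<in> int ` F2)
        + ((of_bool (n < A) + of_bool (n < B)) + (of_bool (2 * n < S) + of_bool (2 * n + 2 < S) + of_bool (n < S))) :: nat)"
      unfolding sgn_pow_def by (metis minus_one_power_iff one_neq_neg_one)
    \<comment> \<open>The tests 2n < S and 2n + 2 < S differ exactly at the two values of S that
      \<open>parity_sum\<close> records.\<close>
    moreover have "even (of_bool (2 * n < S) + of_bool (2 * n + 2 < S) + of_bool (S = 2 * n + 1 \<or> S = 2 * n + 2) :: nat)"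
      by (auto simp: of_bool_def)
    ultimately show ?thesis unfolding parity_sum_def by presburger
  qed
  have S: "S = A + B \<or> S = A + B + 1" unfolding S_def A_def B_def by linarith
  have "A \<le> int (card F2)" "B \<le> - int (card F2)" using parity_sum_bounds[OF F S E] by auto
  thus "\<alpha> + real (card F2) + 1 > 0" "\<beta> - real (card F2) + 1 > 0"
    unfolding A_def B_def by linarith+
qed

section \<open>Jacobi polynomials\<close>

abbreviation psm :: "real \<Rightarrow> real poly \<Rightarrow> real poly" where "psm \<equiv> Polynomial.smult"
lemma poly_extI: "(\<And>x. poly p x = poly q x) \<Longrightarrow> p = (q :: real poly)"
  using poly_eq_poly_eq_iff by blast
lemmas pderiv_expand = pderiv_add pderiv_diff pderiv_minus pderiv_mult pderiv_smult pderiv_pCons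

lemma pderiv_sum: "pderiv (sum f A) = (\<Sum>x\<in>A. pderiv (f x))" for f :: "'a \<Rightarrow> real poly"
  by (induction A rule: infinite_finite_induct) (auto simp: pderiv_add)

text \<open>Separating \<open>u = x - 1\<close> from \<open>v = x + 1\<close> exhibits the symmetry that exchanges \<open>(a, u)\<close> and \<open>(b, v)\<close>.\<close>

definition jac :: "real \<Rightarrow> real \<Rightarrow> nat \<Rightarrow> real \<Rightarrow> real \<Rightarrow> real" where
  "jac a b n u v = (\<Sum>j\<le>n. ((real n + a) gchoose j) * ((real n + b) gchoose (n - j)) * u ^ (n - j) * v ^ j)"

text \<open>The derivative of \<open>jac\<close> when \<open>u\<close> and \<open>v\<close> move
  together, that is, in x for u = x - 1 and v = x + 1. Where an exponent is truncated at 0, its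
  factor \<open>j\<close> or \<open>n - j\<close> is 0 as well.\<close>

definition jacD :: "real \<Rightarrow> real \<Rightarrow> nat \<Rightarrow> real \<Rightarrow> real \<Rightarrow> real" where
  "jacD a b n u v = (\<Sum>j\<le>n. ((real n + a) gchoose j) * ((real n + b) gchoose (n - j)) *
      (real (n - j) * u ^ (n - j - 1) * v ^ j + real j * u ^ (n - j) * v ^ (j - 1)))"

lemma jac_swap: "jac b a n v u = jac a b n u v"
  unfolding jac_def
  by (rule sum.reindex_bij_witness[of _ "\<lambda>j. n - j" "\<lambda>j. n - j"]) (auto simp: mult_ac)

lemma jacD_swap: "jacD b a n v u = jacD a b n u v"
  unfolding jacD_def
  by (rule sum.reindex_bij_witness[of _ "\<lambda>j. n - j" "\<lambda>j. n - j"]) (auto simp: algebra_simps)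

lemma poly_jacobiP: "poly (jacobiP a b n) x = jac a b n (x - 1) (x + 1) / 2 ^ n"
  unfolding jacobiP_def jac_def
  by (simp add: poly_sum atLeast0AtMost sum_divide_distrib algebra_simps)

lemma poly_pderiv_jacobiP: "poly (pderiv (jacobiP a b n)) x = jacD a b n (x - 1) (x + 1) / 2 ^ n"
  unfolding jacobiP_def jacD_def
  by (simp add: pderiv_expand pderiv_sum pderiv_power poly_sum atLeast0AtMost sum_divide_distrib algebra_simps)

text \<open>Shifting the terms that differentiate \<open>u\<close> from j to j + 1 aligns the
  monomials. The recursion of the second binomial then gives every term the common factor (b + j)
  \<open>B (n - j)\<close>, the first binomials add up by Pascal's rule, and absorption extracts n +
  b.\<close>

lemma jacD_raise: "v * jacD a b n u v + b * jac a b n u v = (real n + b) * jac (a + 1) (b - 1) n u v"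
proof -
  define A where "A = (\<lambda>j. (real n + a) gchoose j)"
  define B where "B = (\<lambda>j. (real n + b) gchoose j)"
  have Brec: "real (Suc k) * B (Suc k) = (real n + b - real k) * B k" for k
    using gbinomial_mult_1[of "real n + b" k] unfolding B_def by (simp add: algebra_simps)
  have Arec: "A j + (if j = 0 then 0 else A (j - 1)) = (real n + (a + 1)) gchoose j" for j
    unfolding A_def using gbinomial_Suc_Suc[of "real n + a" "j - 1"] by (cases j) (auto simp: algebra_simps)
  have Babs: "(b + real j) * B (n - j) = (real n + b) * ((real n + (b - 1)) gchoose (n - j))" if "j \<le> n" for j
    using gbinomial_absorb_comp[of "real n + b" "n - j"] that unfolding B_def by (simp add: of_nat_diff algebra_simps)
  have "v * jacD a b n u v = (\<Sum>j\<le>n. A j * (real (n - j) * B (n - j)) * u ^ (n - j - 1) * v ^ Suc j)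
      + (\<Sum>j\<le>n. A j * B (n - j) * real j * u ^ (n - j) * v ^ j)"
  proof -
    have e: "v * (real j * u ^ (n - j) * v ^ (j - 1)) = real j * u ^ (n - j) * v ^ j" for j by (cases j) auto
    show ?thesis unfolding jacD_def A_def[symmetric] B_def[symmetric] sum_distrib_left sum.distrib[symmetric]
    proof (rule sum.cong[OF refl])
      fix j show "v * (A j * B (n - j) *
          (real (n - j) * u ^ (n - j - 1) * v ^ j + real j * u ^ (n - j) * v ^ (j - 1))) =
        A j * (real (n - j) * B (n - j)) * u ^ (n - j - 1) * v ^ Suc j + A j * B (n - j) * real j * u ^ (n - j) * v ^ j"
        using e[of j] by (auto simp: algebra_simps)
    qed
  qed
  also have "(\<Sum>j\<le>n. A j * (real (n - j) * B (n - j)) * u ^ (n - j - 1) * v ^ Suc j)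
     = (\<Sum>j<n. A j * (real (n - j) * B (n - j)) * u ^ (n - j - 1) * v ^ Suc j)"
    by (simp add: lessThan_Suc_atMost[symmetric])
  also have "\<dots> = (\<Sum>j<n. A j * ((b + real (Suc j)) * B (n - Suc j)) * u ^ (n - Suc j) * v ^ Suc j)"
  proof (rule sum.cong[OF refl])
    fix j assume "j \<in> {..<n}"
    hence "n - j = Suc (n - Suc j)" "real (n - Suc j) = real n - real (Suc j)" by (auto simp: of_nat_diff)
    thus "A j * (real (n - j) * B (n - j)) * u ^ (n - j - 1) * v ^ Suc j =
        A j * ((b + real (Suc j)) * B (n - Suc j)) * u ^ (n - Suc j) * v ^ Suc j"
      using Brec[of "n - Suc j"] by (simp add: algebra_simps)
  qed
  also have "\<dots> = (\<Sum>j\<le>n. (if j = 0 then 0 else A (j - 1)) * ((b + real j) * B (n - j)) * u ^ (n - j) * v ^ j)"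
    by (simp add: sum.atMost_shift)
  finally have "v * jacD a b n u v + b * jac a b n u v =
     (\<Sum>j\<le>n. (A j + (if j = 0 then 0 else A (j - 1))) * ((b + real j) * B (n - j)) * u ^ (n - j) * v ^ j)"
    unfolding jac_def A_def[symmetric] B_def[symmetric] sum_distrib_left sum.distrib[symmetric]
    by (simp add: algebra_simps A_def B_def sum.distrib)
  also have "\<dots> = (real n + b) * jac (a + 1) (b - 1) n u v"
    unfolding jac_def sum_distrib_left
    by (rule sum.cong) (auto simp: Arec Babs)
  finally show ?thesis .
qed

lemma jacobiP_raise:
  "[:1,1:] * pderiv (jacobiP a b n) + psm b (jacobiP a b n) = psm (real n + b) (jacobiP (a+1) (b-1) n)"
proof (rule poly_extI)
  fix x
  show "poly ([:1,1:] * pderiv (jacobiP a b n) + psm b (jacobiP a b n)) x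
      = poly (psm (real n + b) (jacobiP (a+1) (b-1) n)) x"
    using jacD_raise[of "x + 1" a b n "x - 1"] by (simp add: poly_pderiv_jacobiP poly_jacobiP field_simps)
qed

text \<open>The raising identity with the endpoints exchanged, through \<open>jac_swap\<close> and
  \<open>jacD_swap\<close>.\<close>

lemma jacobiP_lower:
  "[:-1,1:] * pderiv (jacobiP a b n) + psm a (jacobiP a b n) = psm (real n + a) (jacobiP (a-1) (b+1) n)"
proof (rule poly_extI)
  fix x
  show "poly ([:-1,1:] * pderiv (jacobiP a b n) + psm a (jacobiP a b n)) x
      = poly (psm (real n + a) (jacobiP (a-1) (b+1) n)) x"
    using jacD_raise[of "x - 1" b a n "x + 1"]
    by (simp add: poly_pderiv_jacobiP poly_jacobiP jac_swap jacD_swap field_simps)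
qed

lemma jacobiP_at_1: "poly (jacobiP a b n) 1 = ((real n + a) gchoose n)"
proof -
  have "jac a b n 0 2 = (\<Sum>j\<le>n. if j = n then ((real n + a) gchoose n) * 2 ^ n else 0)"
    unfolding jac_def by (rule sum.cong) auto
  thus ?thesis by (simp add: poly_jacobiP)
qed

lemma jacobiP_at_minus1: "poly (jacobiP a b n) (-1) = (-1) ^ n * ((real n + b) gchoose n)"
proof -
  have "jac a b n (-2) 0 = (\<Sum>j\<le>n. if j = 0 then ((real n + b) gchoose n) * (-2) ^ n else 0)"
    unfolding jac_def by (rule sum.cong) auto
  moreover have "(-2::real) ^ n = (-1) ^ n * 2 ^ n" by (metis mult_minus1 power_mult_distrib)
  ultimately show ?thesis by (simp add: poly_jacobiP)
qed

text \<open>With \<open>w = (1 - x) powr a * (1 + x) powr b\<close>: \<open>Nop\<close> is \<open>h \<mapsto> ((1 - x\<^sup>2) w h)' / w\<close>, and \<open>Eop\<close> is chosen so that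
  \<open>f w - (1 - x) (Eop f) w\<close> is the derivative of a multiple of \<open>(1 - x\<^sup>2) w f\<close>.\<close>

definition Nop :: "real \<Rightarrow> real \<Rightarrow> real poly \<Rightarrow> real poly" where
  "Nop a b h = [:1,-1:] * [:1,1:] * pderiv h + [:b - a, - (a + b + 2):] * h"

definition Eop :: "real \<Rightarrow> real \<Rightarrow> real poly \<Rightarrow> real poly" where
  "Eop a b f = psm (1 / (2 * (a + 1))) (psm (a + b + 2) f + [:1,1:] * pderiv f)"

definition Lop :: "real \<Rightarrow> real \<Rightarrow> real poly \<Rightarrow> real poly" where
  "Lop a b f = - Nop a b (pderiv f)"

text \<open>This identity, \<open>Eop_one_minus\<close> and \<open>Eop_one_plus\<close> carry three
  rules from ordinary integrals over to their continuation: total derivatives integrate to zero, and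
  multiplication by 1 - x or 1 + x raises the matching exponent.\<close>

lemma Eop_Nop: "Eop a b (Nop a b h) = Nop (a + 1) b (Eop a b h)" 
proof (rule poly_extI)
  fix x
  define c where "c = 1 / (2 * (a + 1))"
  show "poly (Eop a b (Nop a b h)) x = poly (Nop (a + 1) b (Eop a b h)) x"
    unfolding Eop_def Nop_def c_def[symmetric]
    by (simp add: pderiv_expand) (simp add: algebra_simps)
qed

lemma Eop_one_minus:
  assumes "a \<noteq> -1"
  shows "Eop a b ([:1,-1:] * f) = f + psm (1 / (2 * (a + 1))) (Nop (a + 1) b f)" 
proof (rule poly_extI)
  fix x
  define c where "c = 1 / (2 * (a + 1))"
  have "2 * c * (a + 1) = 1" using assms by (simp add: c_def)
  moreover have "poly (Eop a b ([:1,-1:] * f)) x - poly (f + psm (1 / (2 * (a + 1))) (Nop (a + 1) b f)) x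
      = (2 * c * (a + 1) - 1) * poly f x"
    unfolding Eop_def Nop_def c_def[symmetric]
    by (simp add: pderiv_expand) (simp add: algebra_simps)
  ultimately show "poly (Eop a b ([:1,-1:] * f)) x = poly (f + psm (1 / (2 * (a + 1))) (Nop (a + 1) b f)) x"
    by simp
qed

lemma Eop_one_plus: "Eop a b ([:1,1:] * f) = [:1,1:] * Eop a (b + 1) f" 
  apply (rule poly_extI)
  apply (simp add: Eop_def Nop_def pderiv_expand)
  apply (simp add: algebra_simps)
  done

text \<open>The product rule for ((1 - x)(1 + x) w f') g, divided by the weight w: the pointwise
  form of integration by parts.\<close>

lemma Lop_mult: "Lop a b f * g = [:1,-1:] * ([:1,1:] * (pderiv f * pderiv g)) - Nop a b (pderiv f * g)" 
  apply (rule poly_extI)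
  apply (simp add: Lop_def Nop_def pderiv_expand)
  apply (simp add: algebra_simps)
  done

lemma pderiv_Lop: "pderiv (Lop a b f) = Lop (a + 1) (b + 1) (pderiv f) + psm (a + b + 2) (pderiv f)"
  apply (rule poly_extI)
  apply (simp add: Lop_def Nop_def pderiv_expand)
  apply (simp add: algebra_simps)
  done

lemma Eop_add: "Eop a b (f + g) = Eop a b f + Eop a b g"
  by (simp add: Eop_def pderiv_expand algebra_simps smult_add_right)

lemma Eop_smult: "Eop a b (psm c f) = psm c (Eop a b f)"
  by (rule poly_extI) (simp add: Eop_def pderiv_expand algebra_simps)

section \<open>The Wronskian\<close>

lemma psm_sum: "psm c (sum g A) = (\<Sum>x\<in>A. psm c (g x))"
  by (induction A rule: infinite_finite_induct) (auto simp: smult_add_right)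

text \<open>\<open>twist_deriv b j p\<close> is \<open>(1 + x) powr (b + j)\<close> times the \<open>j\<close>-th derivative of \<open>(1 + x) powr (- b) * p\<close>.\<close>

fun twist_deriv :: "real \<Rightarrow> nat \<Rightarrow> real poly \<Rightarrow> real poly" where
  "twist_deriv b 0 p = p"
| "twist_deriv b (Suc j) p = [:1,1:] * pderiv (twist_deriv b j p) - psm (b + real j) (twist_deriv b j p)"

text \<open>Coefficients of (1 + x)^i times the i-th derivative of p in
  \<open>twist_deriv b j p\<close>. The operator (1 + x) d/dx sends such a term to i times itself
  plus the next one. The array is unitriangular, which is all that the determinant needs.\<close>

fun twist_coeff :: "real \<Rightarrow> nat \<Rightarrow> nat \<Rightarrow> real" where
  "twist_coeff b 0 i = (if i = 0 then 1 else 0)"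
| "twist_coeff b (Suc j) i = (if i = 0 then 0 else twist_coeff b j (i - 1)) + (real i - b - real j) * twist_coeff b j i"

lemma twist_coeff_eq_0: "i > j \<Longrightarrow> twist_coeff b j i = 0"
  by (induction j arbitrary: i) auto

lemma twist_coeff_diag: "twist_coeff b j j = 1"
  by (induction j) (auto simp: twist_coeff_eq_0)

lemma twist_deriv_expand:
  "j < n \<Longrightarrow> twist_deriv b j p = (\<Sum>i<n. psm (twist_coeff b j i) ([:1,1:] ^ i * (pderiv ^^ i) p))"
proof (induction j)
  case 0
  hence "(\<Sum>i<n. psm (twist_coeff b 0 i) ([:1,1:] ^ i * (pderiv ^^ i) p)) = (\<Sum>i<n. if i = 0 then p else 0)"
    by (intro sum.cong) auto
  thus ?case using 0 by simp
next
  case (Suc j)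
  define T where "T = (\<lambda>i. [:1,1:] ^ i * (pderiv ^^ i) p)"
  have T: "[:1,1:] * pderiv (T i) = psm (real i) (T i) + T (Suc i)" for i
  proof (cases i)
    case (Suc l)
    show ?thesis unfolding Suc T_def pderiv_mult pderiv_power_Suc
      by (rule poly_extI) (simp add: pderiv_pCons algebra_simps)
  qed (simp add: T_def)
  obtain m where n: "n = Suc m" using Suc.prems by (cases n) auto
  have z: "twist_coeff b j m = 0" using Suc.prems n by (intro twist_coeff_eq_0) auto
  have IH: "twist_deriv b j p = (\<Sum>i<n. psm (twist_coeff b j i) (T i))" using Suc unfolding T_def by simp
  have "twist_deriv b (Suc j) p = (\<Sum>i<n. psm (twist_coeff b j i) (psm (real i) (T i) + T (Suc i)))
      - (\<Sum>i<n. psm ((b + real j) * twist_coeff b j i) (T i))"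
    unfolding twist_deriv.simps IH pderiv_sum sum_distrib_left pderiv_smult mult_smult_right T
    by (simp add: psm_sum)
  also have "\<dots> = (\<Sum>i<n. psm ((real i - b - real j) * twist_coeff b j i) (T i)) + (\<Sum>i<n. psm (twist_coeff b j i) (T (Suc i)))"
    by (rule poly_extI) (simp add: poly_sum sum.distrib sum_subtractf algebra_simps)
  also have "(\<Sum>i<n. psm (twist_coeff b j i) (T (Suc i))) = (\<Sum>i<m. psm (twist_coeff b j i) (T (Suc i)))"
    unfolding n using z by simp
  also have "\<dots> = (\<Sum>i<n. psm (if i = 0 then 0 else twist_coeff b j (i - 1)) (T i))"
    unfolding n by (simp add: sum.lessThan_Suc_shift del: sum.lessThan_Suc)
  finally have e: "twist_deriv b (Suc j) p = (\<Sum>i<n. psm ((real i - b - real j) * twist_coeff b j i) (T i))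
      + (\<Sum>i<n. psm (if i = 0 then 0 else twist_coeff b j (i - 1)) (T i))" .
  show ?case unfolding e T_def sum.distrib[symmetric]
    by (rule sum.cong) (simp_all add: smult_add_left)
qed

lemma twist_deriv_jacobiP:
  "twist_deriv b j (jacobiP a (-b) n) =
     psm ((-1) ^ j * pochhammer (b - real n) j) (jacobiP (a + real j) (- b - real j) n)"
proof (induction j)
  case (Suc j)
  have "[:1,1:] * pderiv (jacobiP (a + real j) (- b - real j) n) + psm (- b - real j) (jacobiP (a + real j) (- b - real j) n)
     = psm (real n + (- b - real j)) (jacobiP (a + real j + 1) (- b - real j - 1) n)"
    by (rule jacobiP_raise)
  moreover have e: "a + real j + 1 = a + real (Suc j)" "- b - real j - 1 = - b - real (Suc j)"
    "real n + (- b - real j) = real n - b - real j" "- b - real j = - (b + real j)" for j by simp_all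
  ultimately have r: "[:1,1:] * pderiv (jacobiP (a + real j) (- b - real j) n) - psm (b + real j) (jacobiP (a + real j) (- b - real j) n)
     = psm (real n - b - real j) (jacobiP (a + real (Suc j)) (- b - real (Suc j)) n)"
    using smult_minus_left[of "b + real j" "jacobiP (a + real j) (- b - real j) n"]
    by (simp only: e(1-3))
  have "twist_deriv b (Suc j) (jacobiP a (-b) n) = psm ((-1) ^ j * pochhammer (b - real n) j)
     ([:1,1:] * pderiv (jacobiP (a + real j) (- b - real j) n) - psm (b + real j) (jacobiP (a + real j) (- b - real j) n))"
    by (rule poly_extI) (simp add: Suc pderiv_expand algebra_simps)
  also have "\<dots> = psm ((-1) ^ Suc j * pochhammer (b - real n) (Suc j)) (jacobiP (a + real (Suc j)) (- b - real (Suc j)) n)"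
    unfolding r by (simp add: pochhammer_Suc algebra_simps)
  finally show ?case .
qed simp

definition wronski_mat :: "real poly list \<Rightarrow> real poly mat" where
  "wronski_mat ps = mat (length ps) (length ps) (\<lambda>(i, j). (pderiv ^^ j) (ps ! i))"

text \<open>By the iterated raising identity the entries of \<open>Wmat\<close> are, up to sign and
  a power of 1 + x, values of \<open>twist_deriv\<close>. Hence \<open>Wmat\<close> is the Wronskian
  matrix times a triangular matrix with diagonal entries +-(1 + x)^(k - 1), whose product is up to
  sign the divisor (1 + x)^(k (k - 1)) in \<open>OmegaPoly\<close>.\<close>

lemma OmegaPoly_eq_wronski:
  fixes \<alpha> \<beta> :: real and F2 :: "nat set"
  assumes F: "finite F2"
  shows "\<exists>s. s \<noteq> 0 \<and> OmegaPoly \<alpha> \<beta> F2 =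
     psm s (det (wronski_mat (map (jacobiP \<alpha> (-\<beta>)) (sorted_list_of_set F2))))"
proof -
  define k where "k = card F2"
  define fs where "fs = sorted_list_of_set F2"
  define ps where "ps = map (jacobiP \<alpha> (-\<beta>)) fs"
  have len: "length fs = k" "length ps = k" unfolding fs_def ps_def k_def using F by auto
  define Tri where "Tri = mat k k (\<lambda>(i, j). psm ((-1) ^ j * twist_coeff \<beta> j i) ([:1,1:] ^ (k - 1 + i - j)))"
  have "Wmat \<alpha> \<beta> F2 = wronski_mat ps * Tri"
  proof (rule eq_matI)
    fix i j assume "i < dim_row (wronski_mat ps * Tri)" "j < dim_col (wronski_mat ps * Tri)"
    hence ij: "i < k" "j < k" unfolding wronski_mat_def Tri_def using len by auto
    have "Wmat \<alpha> \<beta> F2 $$ (i, j) = psm (pochhammer (\<beta> - real (fs ! i)) j)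
          ([:1, 1:] ^ (k - 1 - j) * jacobiP (\<alpha> + real j) (- \<beta> - real j) (fs ! i))"
      using ij unfolding Wmat_def Let_def k_def fs_def by simp
    also have "\<dots> = psm ((-1) ^ j) ([:1, 1:] ^ (k - 1 - j) * twist_deriv \<beta> j (jacobiP \<alpha> (-\<beta>) (fs ! i)))"
      unfolding twist_deriv_jacobiP by (simp add: power_mult_distrib[symmetric] mult.assoc[symmetric])
    also have "\<dots> = (\<Sum>l<k. (pderiv ^^ l) (ps ! i) * psm ((-1) ^ j * twist_coeff \<beta> j l) ([:1,1:] ^ (k - 1 + l - j)))"
    proof -
      have "[:1, 1:] ^ (k - 1 - j) * [:1,1:] ^ l = ([:1,1:] :: real poly) ^ (k - 1 + l - j)" for l
        using ij by (simp add: power_add[symmetric])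
      hence "psm ((-1) ^ j) ([:1, 1:] ^ (k - 1 - j) * psm (twist_coeff \<beta> j l) ([:1,1:] ^ l * (pderiv ^^ l) (ps ! i)))
        = (pderiv ^^ l) (ps ! i) * psm ((-1) ^ j * twist_coeff \<beta> j l) ([:1,1:] ^ (k - 1 + l - j))" for l
        by (simp add: mult_ac)
      thus ?thesis using ij len by (simp add: twist_deriv_expand[OF ij(2)] ps_def sum_distrib_left psm_sum)
    qed
    also have "\<dots> = (wronski_mat ps * Tri) $$ (i, j)"
      using ij len by (simp add: wronski_mat_def Tri_def scalar_prod_def atLeast0LessThan)
    finally show "Wmat \<alpha> \<beta> F2 $$ (i, j) = (wronski_mat ps * Tri) $$ (i, j)" .
  qed (auto simp: wronski_mat_def Tri_def Wmat_def Let_def len k_def)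
  hence "det (Wmat \<alpha> \<beta> F2) = det (wronski_mat ps) * det Tri"
    by (simp add: det_mult[of _ k] wronski_mat_def Tri_def len)
  also have "det Tri = prod_list (diag_mat Tri)"
    by (rule det_upper_triangular[of _ k]) (auto simp: upper_triangular_def Tri_def twist_coeff_eq_0)
  also have "diag_mat Tri = map (\<lambda>j. psm ((-1) ^ j) ([:1,1:] ^ (k - 1))) [0..<k]"
    unfolding diag_mat_def Tri_def by (auto simp: twist_coeff_diag)
  also have "prod_list \<dots> = (\<Prod>j<k. psm ((-1) ^ j) ([:1,1:] ^ (k - 1)))"
    using prod.distinct_set_conv_list[of "[0..<k]" "\<lambda>j. psm ((-1) ^ j) ([:1,1:] ^ (k - 1))"]
    by (simp add: atLeast0LessThan)
  also have "\<dots> = psm (\<Prod>j<k. (-1) ^ j) ([:1,1:] ^ (k * (k - 1)))"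
    unfolding prod_smult by (simp add: power_mult[symmetric] mult.commute)
  finally have "det (Wmat \<alpha> \<beta> F2) = psm (\<Prod>j<k. (-1) ^ j) (det (wronski_mat ps)) * [:1,1:] ^ (k * (k - 1))"
    by simp
  note e = this
  have "OmegaPoly \<alpha> \<beta> F2 = psm (\<Prod>j<k. (-1) ^ j) (det (wronski_mat ps))"
    unfolding OmegaPoly_def k_def[symmetric] e by (rule nonzero_mult_div_cancel_right) simp
  moreover have "(\<Prod>j<k. (-1) ^ j :: real) \<noteq> 0" by simp
  ultimately show ?thesis unfolding ps_def fs_def by blast
qed

lemma higher_pderiv_zero_imp_power_dvd:
  assumes "\<And>i. i < n \<Longrightarrow> poly ((pderiv ^^ i) p) x0 = 0"
  shows "[:-x0,1:] ^ n dvd (p :: real poly)"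
  using assms
proof (induction n arbitrary: p)
  case (Suc n)
  show ?case
  proof (cases "p = 0 \<or> pderiv p = 0")
    case True
    have "poly p x0 = 0" using Suc.prems[of 0] by simp
    hence "p = 0" using True by (auto simp: pderiv_eq_0_iff elim!: degree_eq_zeroE)
    thus ?thesis by simp
  next
    case False
    have "[:-x0,1:] ^ n dvd pderiv p"
    proof (rule Suc.IH)
      fix i assume "i < n"
      thus "poly ((pderiv ^^ i) (pderiv p)) x0 = 0" using Suc.prems[of "Suc i"] by (simp add: funpow_swap1)
    qed
    hence "n \<le> order x0 (pderiv p)" using False by (simp add: order_divides)
    moreover have "poly p x0 = 0" using Suc.prems[of 0] by simp
    ultimately have "Suc n \<le> order x0 p" using order_pderiv[of p x0] False by auto
    thus ?thesis using order_divides by blast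
  qed
qed simp

lemma Omega_zero_imp_high_order:
  fixes \<alpha> \<beta> :: real and F2 :: "nat set"
  assumes F: "finite F2" and Z: "Omega \<alpha> \<beta> F2 x0 = 0"
  obtains c where "\<exists>f\<in>F2. c f \<noteq> 0"
    "[:-x0,1:] ^ card F2 dvd (\<Sum>f\<in>F2. psm (c f) (jacobiP \<alpha> (-\<beta>) f))"
proof -
  define k where "k = card F2"
  define fs where "fs = sorted_list_of_set F2"
  define ps where "ps = map (jacobiP \<alpha> (-\<beta>)) fs"
  have len: "length fs = k" "length ps = k" and dist: "distinct fs" and set: "set fs = F2"
    unfolding fs_def ps_def k_def using F by auto
  obtain s where s: "s \<noteq> 0" "OmegaPoly \<alpha> \<beta> F2 = psm s (det (wronski_mat ps))"
    using OmegaPoly_eq_wronski[OF F] unfolding ps_def fs_def by blast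
  interpret ev: comm_ring_hom "\<lambda>p. poly p x0" by unfold_locales auto
  define M where "M = map_mat (\<lambda>p. poly p x0) (wronski_mat ps)"
  have M: "M \<in> carrier_mat k k" unfolding M_def wronski_mat_def using len by auto
  have "det M = 0" using Z s unfolding M_def Omega_def ev.hom_det by simp
  \<comment> \<open>Rows belong to the seeds, so a linear relation between seeds is a kernel vector
    of the transpose.\<close>
  hence "det (transpose_mat M) = 0" using det_transpose[OF M] by simp
  then obtain v where v: "v \<in> carrier_vec k" "v \<noteq> 0\<^sub>v k" "transpose_mat M *\<^sub>v v = 0\<^sub>v k"
    using det_0_iff_vec_prod_zero_field[of "transpose_mat M" k] M by auto
  define c where "c = (\<lambda>f. v $ (THE i. i < k \<and> fs ! i = f))"
  have c: "c (fs ! i) = v $ i" if "i < k" for i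
  proof -
    have "(THE j. j < k \<and> fs ! j = fs ! i) = i" using that dist len by (auto simp: nth_eq_iff_index_eq)
    thus ?thesis unfolding c_def by simp
  qed
  have sumF: "(\<Sum>f\<in>F2. g f) = (\<Sum>i<k. g (fs ! i))" for g :: "nat \<Rightarrow> real poly"
    unfolding set[symmetric] using sum.distinct_set_conv_list[OF dist, of g]
    by (simp add: sum_list_sum_nth atLeast0LessThan len)
  obtain i where "i < k" "v $ i \<noteq> 0" using v(1,2) by (metis eq_vecI carrier_vecD index_zero_vec)
  hence "\<exists>f\<in>F2. c f \<noteq> 0" using c set len by (metis nth_mem)
  moreover have "[:-x0,1:] ^ k dvd (\<Sum>f\<in>F2. psm (c f) (jacobiP \<alpha> (-\<beta>) f))"
  proof (rule higher_pderiv_zero_imp_power_dvd)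
    fix j assume j: "j < k"
    have "poly ((pderiv ^^ j) (\<Sum>f\<in>F2. psm (c f) (jacobiP \<alpha> (-\<beta>) f))) x0
       = (\<Sum>i<k. v $ i * poly ((pderiv ^^ j) (ps ! i)) x0)"
      unfolding sumF by (simp add: higher_pderiv_sum higher_pderiv_smult poly_sum c ps_def len)
    also have "\<dots> = (transpose_mat M *\<^sub>v v) $ j"
      using j v(1) len by (auto simp: M_def wronski_mat_def scalar_prod_def atLeast0LessThan mult.commute intro!: sum.cong)
    finally show "poly ((pderiv ^^ j) (\<Sum>f\<in>F2. psm (c f) (jacobiP \<alpha> (-\<beta>) f))) x0 = 0" using v(3) j by simp
  qed
  ultimately show ?thesis using that unfolding k_def by blast
qed

section \<open>Products of shifted operators and zeros at the endpoints\<close>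

definition poly_linear :: "(real poly \<Rightarrow> real poly) \<Rightarrow> bool" where
  "poly_linear T \<longleftrightarrow> (\<forall>p q. T (p + q) = T p + T q) \<and> (\<forall>c p. T (psm c p) = psm c (T p))"

fun shift_prod :: "(real poly \<Rightarrow> real poly) \<Rightarrow> real list \<Rightarrow> real poly \<Rightarrow> real poly" where
  "shift_prod T [] p = p"
| "shift_prod T (m # ms) p = T (shift_prod T ms p) - psm m (shift_prod T ms p)"

lemma shift_prod_linear:
  assumes "poly_linear T"
  shows "poly_linear (shift_prod T ms)"
  using assms unfolding poly_linear_def
  by (induction ms) (auto simp: algebra_simps smult_add_right smult_diff_right)

lemma poly_linear_sum:
  assumes "poly_linear T"
  shows "T (\<Sum>x\<in>A. psm (c x) (g x)) = (\<Sum>x\<in>A. psm (c x) (T (g x)))"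
proof -
  have "T 0 = 0" using assms unfolding poly_linear_def by (metis smult_0_left)
  thus ?thesis using assms unfolding poly_linear_def
    by (induction A rule: infinite_finite_induct) auto
qed

lemma shift_prod_eigen:
  assumes "poly_linear T" "T p = psm l p"
  shows "shift_prod T ms p = psm (\<Prod>m\<leftarrow>ms. l - m) p"
  using assms unfolding poly_linear_def
  by (induction ms) (auto simp: smult_diff_left algebra_simps)

lemma shift_prod_append: "shift_prod T (ms @ ns) p = shift_prod T ms (shift_prod T ns p)"
  by (induction ms) auto

text \<open>The conjugate of \<open>Lop a b\<close> by multiplication with \<open>(1 + x) powr (- b)\<close>.\<close>

definition conjLop :: "real \<Rightarrow> real \<Rightarrow> real poly \<Rightarrow> real poly" where
  "conjLop a b p = (let y = [:1,1:] * pderiv p - psm b p in psm (a + 1) y - [:1,-1:] * pderiv y)"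

lemma conjLop_linear: "poly_linear (conjLop a b)"
  unfolding poly_linear_def conjLop_def Let_def
  by (safe; rule poly_extI) (simp_all add: pderiv_expand algebra_simps)

text \<open>\<open>conjLop\<close> is the raising operator followed by the lowering one, so the
  eigenvalue is the product of the two ladder factors.\<close>

lemma conjLop_jacobiP:
  "conjLop a b (jacobiP a (-b) n) = psm ((real n - b) * (real n + a + 1)) (jacobiP a (-b) n)"
proof -
  define J where "J = jacobiP (a + 1) (- b - 1) n"
  have y: "[:1,1:] * pderiv (jacobiP a (-b) n) - psm b (jacobiP a (-b) n) = psm (real n - b) J"
    using jacobiP_raise[of a "-b" n] unfolding J_def by simp
  have l: "poly ([:-1,1:] * pderiv J + psm (a + 1) J) x = poly (psm (real n + a + 1) (jacobiP a (-b) n)) x" for x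
    using jacobiP_lower[of "a + 1" "- b - 1" n] unfolding J_def by (simp add: add.assoc)
  show ?thesis
  proof (rule poly_extI)
    fix x
    have "poly (conjLop a b (jacobiP a (-b) n)) x = (real n - b) * poly ([:-1,1:] * pderiv J + psm (a + 1) J) x"
      unfolding conjLop_def Let_def y pderiv_smult by (simp add: algebra_simps)
    thus "poly (conjLop a b (jacobiP a (-b) n)) x = poly (psm ((real n - b) * (real n + a + 1)) (jacobiP a (-b) n)) x"
      unfolding l by simp
  qed
qed

lemma power_dvd_pderiv:
  assumes "[:-x0,1:] ^ Suc n dvd (p :: real poly)"
  shows "[:-x0,1:] ^ n dvd pderiv p"
proof -
  define z :: "real poly" where "z = [:-x0,1:]"
  have dz: "pderiv z = 1" unfolding z_def by (simp add: pderiv_pCons)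
  obtain q where q: "p = z ^ Suc n * q" using assms unfolding z_def by (elim dvdE)
  have "pderiv p = z ^ n * (z * pderiv q + psm (real (Suc n)) q)"
    unfolding q pderiv_mult pderiv_power_Suc dz by (simp add: algebra_simps del: of_nat_Suc)
  thus ?thesis unfolding z_def by (metis dvd_triv_left)
qed

lemma power_dvd_times_pderiv:
  assumes "[:-x0,1:] ^ n dvd (p :: real poly)"
  shows "[:-x0,1:] ^ n dvd [:-x0,1:] * pderiv p"
proof (cases n)
  case (Suc m)
  thus ?thesis using power_dvd_pderiv[of x0 m p] assms by (simp add: mult_dvd_mono del: mult_pCons_left)
qed simp

text \<open>Of the two first-order factors only one costs an order: at -1 the inner (1 + x) d/dx
  costs nothing, at 1 the outer (1 - x) d/dx.\<close>

lemma conjLop_order: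
  assumes "[:-x0,1:] ^ Suc n dvd p"
  shows "x0 = 1 \<or> x0 = -1 \<Longrightarrow> [:-x0,1:] ^ n dvd conjLop a b p"
proof -
  have p: "[:-x0,1:] ^ n dvd p" using assms by (metis dvd_mult_right power_Suc)
  have dp: "[:-x0,1:] ^ n dvd pderiv p" using power_dvd_pderiv[OF assms] .
  define y where "y = [:1,1:] * pderiv p - psm b p"
  have y: "[:-x0,1:] ^ n dvd y" unfolding y_def
    by (intro dvd_diff dvd_smult p dvd_mult dp)
  have c: "conjLop a b p = psm (a + 1) y - [:1,-1:] * pderiv y" unfolding conjLop_def Let_def y_def ..
  assume "x0 = 1 \<or> x0 = -1"
  thus ?thesis
  proof
    assume x0: "x0 = 1"
    have "[:1,-1:] * pderiv y = - ([:-x0,1:] * pderiv y)" unfolding x0 by simp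
    thus ?thesis unfolding c using y power_dvd_times_pderiv[OF y]
      by (simp only: dvd_diff dvd_smult dvd_minus_iff)
  next
    assume x0: "x0 = -1"
    have "[:-x0,1:] ^ Suc n dvd [:-x0,1:] * pderiv p" by (rule power_dvd_times_pderiv[OF assms])
    hence "[:-x0,1:] ^ Suc n dvd y" unfolding y_def using x0 assms by (intro dvd_diff dvd_smult) simp_all
    hence "[:-x0,1:] ^ n dvd pderiv y" by (rule power_dvd_pderiv)
    thus ?thesis unfolding c using y by (intro dvd_diff dvd_smult dvd_mult)
  qed
qed

lemma shift_prod_conjLop_order:
  assumes "x0 = 1 \<or> x0 = -1"
  shows "[:-x0,1:] ^ (length ms + n) dvd p \<Longrightarrow> [:-x0,1:] ^ n dvd shift_prod (conjLop a b) ms p"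
proof (induction ms arbitrary: n)
  case (Cons m ms)
  have *: "[:-x0,1:] ^ Suc n dvd shift_prod (conjLop a b) ms p" using Cons.IH[of "Suc n"] Cons.prems by (simp del: power_Suc)
  hence "[:-x0,1:] ^ n dvd shift_prod (conjLop a b) ms p" by (metis dvd_mult_right power_Suc)
  thus ?case using conjLop_order[OF * assms] by (simp add: dvd_diff dvd_smult)
qed simp

lemma gbinomial_nonzero:
  assumes "\<And>i. 1 \<le> i \<Longrightarrow> i \<le> n \<Longrightarrow> a \<noteq> - real i"
  shows "(real n + a) gchoose n \<noteq> 0"
proof
  assume "(real n + a) gchoose n = 0"
  hence "pochhammer (a + 1) n = 0" by (simp add: gbinomial_pochhammer' algebra_simps)
  then obtain i where "i < n" "a + 1 = - real i" by (auto simp: pochhammer_eq_0_iff)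
  thus False using assms[of "Suc i"] by simp
qed

context
  fixes \<alpha> \<beta> :: real and F2 :: "nat set" and lam :: "nat \<Rightarrow> real" and c :: "nat \<Rightarrow> real" and y :: "real poly"
  assumes F: "finite F2"
    and A1: "A1 \<alpha> \<beta>" and A2: "A2 \<alpha> \<beta> F2"
  defines "lam \<equiv> \<lambda>f. (real f - \<beta>) * (real f + \<alpha> + 1)"
  defines "y \<equiv> \<Sum>f\<in>F2. psm (c f) (jacobiP \<alpha> (-\<beta>) f)"
begin

lemma lam_inj: "f \<noteq> g \<Longrightarrow> lam f \<noteq> lam g"
proof
  assume "f \<noteq> g" "lam f = lam g"
  moreover have "lam f - lam g = (real f - real g) * (real f + real g + \<alpha> - \<beta> + 1)"
    unfolding lam_def by (simp add: algebra_simps)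
  ultimately have "\<alpha> - \<beta> = - real (f + g + 1)" by simp
  thus False using A2 unfolding A2_def negint_def by (metis le_add2)
qed

lemma jacobiP_ends:
  assumes "f \<in> F2"
  shows "poly (jacobiP \<alpha> (-\<beta>) f) 1 \<noteq> 0" "poly (jacobiP \<alpha> (-\<beta>) f) (-1) \<noteq> 0"
proof -
  show "poly (jacobiP \<alpha> (-\<beta>) f) 1 \<noteq> 0"
    unfolding jacobiP_at_1 using A1 unfolding A1_def negint_def by (intro gbinomial_nonzero) auto
  have "\<beta> \<noteq> real i" if "i \<le> f" for i
  proof
    assume e: "\<beta> = real i"
    have "f \<le> Max F2" using F assms by simp
    hence "\<beta> - real (Max F2) - 1 = - real (Max F2 - i + 1)" using e that by (simp add: of_nat_diff)
    thus False using A2 unfolding A2_def negint_def by (metis le_add2)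
  qed
  hence "(real f + -\<beta>) gchoose f \<noteq> 0" by (intro gbinomial_nonzero) auto
  thus "poly (jacobiP \<alpha> (-\<beta>) f) (-1) \<noteq> 0" by (simp add: jacobiP_at_minus1)
qed

lemma shift_prod_seed_sum:
  "shift_prod (conjLop \<alpha> \<beta>) ms y = (\<Sum>f\<in>F2. psm (c f * (\<Prod>m\<leftarrow>ms. lam f - m)) (jacobiP \<alpha> (-\<beta>) f))"
  unfolding y_def poly_linear_sum[OF shift_prod_linear[OF conjLop_linear]]
  by (intro sum.cong refl)
    (simp add: shift_prod_eigen[OF conjLop_linear conjLop_jacobiP] lam_def)

lemma shift_prod_all_seeds: "lam ` F2 \<subseteq> set ms \<Longrightarrow> shift_prod (conjLop \<alpha> \<beta>) ms y = 0"
  unfolding shift_prod_seed_sum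
  by (rule sum.neutral) (auto simp: prod_list_zero_iff image_subset_iff)

text \<open>The factors of the other seeds annihilate all terms but the one for \<open>f0\<close>.
  The remaining scalar is non-zero because the eigenvalues are distinct, by the condition on
  \<alpha> - \<beta> in (A2).\<close>

lemma shift_prod_all_but_one:
  assumes "f0 \<in> F2" "c f0 \<noteq> 0"
  shows "\<exists>s. s \<noteq> 0 \<and> shift_prod (conjLop \<alpha> \<beta>) (map lam (sorted_list_of_set (F2 - {f0}))) y = psm s (jacobiP \<alpha> (-\<beta>) f0)"
proof -
  let ?ms = "map lam (sorted_list_of_set (F2 - {f0}))"
  have "shift_prod (conjLop \<alpha> \<beta>) ?ms y =
     (\<Sum>f\<in>F2. if f = f0 then psm (c f0 * (\<Prod>m\<leftarrow>?ms. lam f0 - m)) (jacobiP \<alpha> (-\<beta>) f0) else 0)"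
    unfolding shift_prod_seed_sum
    by (rule sum.cong) (use F in \<open>auto simp: prod_list_zero_iff\<close>)
  also have "\<dots> = psm (c f0 * (\<Prod>m\<leftarrow>?ms. lam f0 - m)) (jacobiP \<alpha> (-\<beta>) f0)" using F assms by simp
  finally have e: "shift_prod (conjLop \<alpha> \<beta>) ?ms y = psm (c f0 * (\<Prod>m\<leftarrow>?ms. lam f0 - m)) (jacobiP \<alpha> (-\<beta>) f0)" .
  have "lam f0 - m \<noteq> 0" if "m \<in> set ?ms" for m using that lam_inj F by force
  hence "(\<Prod>m\<leftarrow>?ms. lam f0 - m) \<noteq> 0" unfolding prod_list_zero_iff by auto
  thus ?thesis using e assms by (metis mult_eq_0_iff)
qed

lemma seed_sum_nonzero:
  assumes "\<exists>f\<in>F2. c f \<noteq> 0"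
  shows "y \<noteq> 0"
proof
  assume y0: "y = 0"
  obtain f0 where f0: "f0 \<in> F2" "c f0 \<noteq> 0" using assms by blast
  obtain s where s: "s \<noteq> 0" "shift_prod (conjLop \<alpha> \<beta>) (map lam (sorted_list_of_set (F2 - {f0}))) y = psm s (jacobiP \<alpha> (-\<beta>) f0)"
    using shift_prod_all_but_one[OF f0] by blast
  have "shift_prod (conjLop \<alpha> \<beta>) ms 0 = 0" for ms
    using shift_prod_linear[OF conjLop_linear, of \<alpha> \<beta> ms] unfolding poly_linear_def by (metis smult_0_left)
  hence "jacobiP \<alpha> (-\<beta>) f0 = 0" using s y0 by simp
  thus False using jacobiP_ends[OF f0(1)] by simp
qed

text \<open>Isolating one seed takes k - 1 factors, each costing one order at an endpoint. From
  order k one zero would survive, but no seed vanishes at 1 or -1.\<close>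

lemma seed_sum_order_at_ends:
  assumes "\<exists>f\<in>F2. c f \<noteq> 0" "x0 = 1 \<or> x0 = -1"
  shows "\<not> [:-x0,1:] ^ card F2 dvd y"
proof
  assume dvd: "[:-x0,1:] ^ card F2 dvd y"
  obtain f0 where f0: "f0 \<in> F2" "c f0 \<noteq> 0" using assms by blast
  obtain s where s: "s \<noteq> 0" "shift_prod (conjLop \<alpha> \<beta>) (map lam (sorted_list_of_set (F2 - {f0}))) y = psm s (jacobiP \<alpha> (-\<beta>) f0)"
    using shift_prod_all_but_one[OF f0] by blast
  have "length (map lam (sorted_list_of_set (F2 - {f0}))) + 1 = card F2"
    using F card_Suc_Diff1[OF F f0(1)] by simp
  hence "[:-x0,1:] ^ 1 dvd psm s (jacobiP \<alpha> (-\<beta>) f0)"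
    using shift_prod_conjLop_order[OF assms(2), of _ 1 y \<alpha> \<beta>] dvd s(2) by metis
  hence "poly (jacobiP \<alpha> (-\<beta>) f0) x0 = 0" using s(1) by (simp add: dvd_smult_iff poly_eq_0_iff_dvd)
  thus False using jacobiP_ends[OF f0(1)] assms(2) by auto
qed

end

section \<open>The regularized integral\<close>

definition jweight :: "real \<Rightarrow> real \<Rightarrow> real \<Rightarrow> real" where
  "jweight a b x = (if -1 < x \<and> x < 1 then (1 - x) powr a * (1 + x) powr b else 0)"

lemma jweight_nonneg: "jweight a b x \<ge> 0"
  unfolding jweight_def by simp

lemma jweight_measurable [measurable]: "jweight a b \<in> borel_measurable borel"
  unfolding jweight_def by measurable

lemma integrable_jweight:
  assumes "a > -1" "b > -1"
  shows "integrable lborel (jweight a b)"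
proof -
  define g where "g = (\<lambda>t::real. indicator {0..1} t *\<^sub>R (t powr b * (1 - t) powr a))"
  have "(\<lambda>t. t powr (b + 1 - 1) * (1 - t) powr (a + 1 - 1)) integrable_on {0..1}"
    using has_integral_Beta_real[of "b + 1" "a + 1"] assms by (auto simp: integrable_on_def)
  hence "(\<lambda>t. t powr b * (1 - t) powr a) integrable_on {0..1}" by simp
  hence "(\<lambda>t. t powr b * (1 - t) powr a) absolutely_integrable_on {0..1}"
    by (intro nonnegative_absolutely_integrable_1) auto
  hence "integrable lebesgue g" unfolding set_integrable_def g_def .
  moreover have "g \<in> borel_measurable lborel" unfolding g_def by measurable
  ultimately have "integrable lborel g" by (simp add: integrable_completion)
  \<comment> \<open>The substitution t = (1 + x) / 2 turns the Beta integrand into the weight, up to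
    the factor 2^(a + b).\<close>
  hence "integrable lborel (\<lambda>x. g (1/2 + (1/2) * x))"
    by (rule lborel_integrable_real_affine) simp
  hence i: "integrable lborel (\<lambda>x. 2 powr (a + b) * g (1/2 + (1/2) * x))"
    by (rule integrable_mult_right)
  show ?thesis
  proof (rule Bochner_Integration.integrable_bound[OF i])
    show "AE x in lborel. norm (jweight a b x) \<le> norm (2 powr (a + b) * g (1/2 + (1/2) * x))"
    proof (rule AE_I2)
      fix x :: real
      show "norm (jweight a b x) \<le> norm (2 powr (a + b) * g (1/2 + (1/2) * x))"
      proof (cases "-1 < x \<and> x < 1")
        case True
        have e: "1/2 + 1/2 * x = (1 + x) / 2" "1 - (1/2 + 1/2 * x) = (1 - x) / 2" by (simp_all add: field_simps)
        have "2 powr (a + b) * g (1/2 + (1/2) * x) = 2 powr (a + b) * (((1 + x) / 2) powr b * ((1 - x) / 2) powr a)"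
          unfolding g_def e using True by (simp add: indicator_def field_simps)
        also have "\<dots> = (1 - x) powr a * (1 + x) powr b"
          using True by (simp add: powr_divide powr_add)
        finally show ?thesis unfolding jweight_def using True by simp
      qed (auto simp: jweight_def)
    qed
  qed simp
qed

definition jint :: "real \<Rightarrow> real \<Rightarrow> (real \<Rightarrow> real) \<Rightarrow> real" where
  "jint a b f = integral\<^sup>L lborel (\<lambda>x. jweight a b x * f x)"

lemma integrable_jweight_bounded:
  assumes "a > -1" "b > -1" and [measurable]: "f \<in> borel_measurable borel"
    and C: "\<And>x. -1 < x \<Longrightarrow> x < 1 \<Longrightarrow> \<bar>f x\<bar> \<le> C"
  shows "integrable lborel (\<lambda>x. jweight a b x * f x)"
proof (rule Bochner_Integration.integrable_bound)
  show "integrable lborel (\<lambda>x. jweight a b x * C)"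
    using integrable_jweight[OF assms(1,2)] by simp
  show "AE x in lborel. norm (jweight a b x * f x) \<le> norm (jweight a b x * C)"
  proof (rule AE_I2)
    fix x show "norm (jweight a b x * f x) \<le> norm (jweight a b x * C)"
      using C[of x] by (auto simp: jweight_def abs_mult intro!: mult_left_mono)
  qed
qed measurable

lemma poly_measurable [measurable]: "poly p \<in> borel_measurable (borel :: real measure)"
  by (intro borel_measurable_continuous_onI continuous_intros)

lemma poly_bounded: "\<exists>C. \<forall>x\<in>{-1..1::real}. \<bar>poly p x\<bar> \<le> C"
proof -
  have "compact (poly p ` {-1..1})" by (intro compact_continuous_image continuous_intros) simp
  hence "bounded (poly p ` {-1..1})" by (rule compact_imp_bounded)
  thus ?thesis unfolding bounded_iff by auto
qed

lemma integrable_jweight_poly: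
  assumes "a > -1" "b > -1"
  shows "integrable lborel (\<lambda>x. jweight a b x * poly p x)"
proof -
  obtain C where "\<forall>x\<in>{-1..1::real}. \<bar>poly p x\<bar> \<le> C" using poly_bounded by blast
  thus ?thesis by (intro integrable_jweight_bounded[OF assms, of _ C]) auto
qed

lemma jint_add: "a > -1 \<Longrightarrow> b > -1 \<Longrightarrow> jint a b (poly (p + q)) = jint a b (poly p) + jint a b (poly q)"
  unfolding jint_def by (simp add: integrable_jweight_poly distrib_left)

lemma jint_smult: "jint a b (poly (psm c p)) = c * jint a b (poly p)"
  unfolding jint_def by (simp add: mult.left_commute)

lemma jint_one_minus: "jint a b (poly ([:1,-1:] * p)) = jint (a + 1) b (poly p)"
  unfolding jint_def
  by (intro Bochner_Integration.integral_cong refl) (auto simp: jweight_def powr_add algebra_simps)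

lemma jint_one_plus: "jint a b (poly ([:1,1:] * p)) = jint a (b + 1) (poly p)"
  unfolding jint_def
  by (intro Bochner_Integration.integral_cong refl) (auto simp: jweight_def powr_add algebra_simps)

lemma jint_Nop:
  assumes "a > -1" "b > -1"
  shows "jint a b (poly (Nop a b h)) = 0"
proof -
  \<comment> \<open>A primitive of the integrand; its exponents are positive, so it vanishes at both
    ends.\<close>
  define F where "F = (\<lambda>x. (1 - x) powr (a + 1) * (1 + x) powr (b + 1) * poly h x)"
  have "((\<lambda>x. jweight a b x * poly (Nop a b h) x) has_integral (F 1 - F (-1))) {-1..1}"
  proof (rule fundamental_theorem_of_calculus_interior)
    show "continuous_on {-1..1} F" unfolding F_def using assms
      by (intro continuous_on_mult continuous_on_powr' continuous_intros) auto
    fix x :: real assume x: "x \<in> {-1<..<1}"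
    have "(F has_real_derivative
        (- ((a + 1) * (1 - x) powr a) * ((1 + x) powr (b + 1)) + (1 - x) powr (a + 1) * ((b + 1) * (1 + x) powr b)) * poly h x
        + (1 - x) powr (a + 1) * (1 + x) powr (b + 1) * poly (pderiv h) x) (at x)"
      unfolding F_def using x by (auto intro!: derivative_eq_intros poly_DERIV)
    also have "(- ((a + 1) * (1 - x) powr a) * ((1 + x) powr (b + 1)) + (1 - x) powr (a + 1) * ((b + 1) * (1 + x) powr b)) * poly h x
        + (1 - x) powr (a + 1) * (1 + x) powr (b + 1) * poly (pderiv h) x = jweight a b x * poly (Nop a b h) x"
      using x unfolding jweight_def Nop_def by (simp add: powr_add) (simp add: algebra_simps)
    finally show "(F has_vector_derivative jweight a b x * poly (Nop a b h) x) (at x)"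
      by (simp add: has_real_derivative_iff_has_vector_derivative)
  qed simp
  moreover have "F 1 - F (-1) = 0" unfolding F_def using assms by simp
  ultimately have "((\<lambda>x. jweight a b x * poly (Nop a b h) x) has_integral 0) {-1..1}" by simp
  hence "((\<lambda>x. if x \<in> {-1..1} then jweight a b x * poly (Nop a b h) x else 0) has_integral 0) UNIV"
    by (subst has_integral_restrict_UNIV)
  also have "(\<lambda>x. if x \<in> {-1..1} then jweight a b x * poly (Nop a b h) x else 0)
      = (\<lambda>x. jweight a b x * poly (Nop a b h) x)" by (auto simp: jweight_def)
  finally show ?thesis
    using has_integral_integral_lborel[OF integrable_jweight_poly[OF assms, of "Nop a b h"]]
    unfolding jint_def by (rule has_integral_unique[symmetric])
qed

text \<open>For a > -1 this makes a regularization step harmless: 1 - x is absorbed by the weight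
  and the total derivative integrates to zero. Thus \<open>Lam_step\<close> holds for every regular
  exponent.\<close>

lemma one_minus_Eop:
  assumes "a \<noteq> -1"
  shows "[:1,-1:] * Eop a b f = f + psm (1 / (2 * (a + 1))) (Nop a b f)" 
proof (rule poly_extI)
  fix x
  define c where "c = 1 / (2 * (a + 1))"
  have "2 * c * (a + 1) = 1" using assms by (simp add: c_def)
  moreover have "poly ([:1,-1:] * Eop a b f) x - poly (f + psm (1 / (2 * (a + 1))) (Nop a b f)) x
      = (2 * c * (a + 1) - 1) * poly f x"
    unfolding Eop_def Nop_def c_def[symmetric]
    by (simp add: pderiv_expand) (simp add: algebra_simps)
  ultimately show "poly ([:1,-1:] * Eop a b f) x = poly (f + psm (1 / (2 * (a + 1))) (Nop a b f)) x"
    by simp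
qed

text \<open>The analytic continuation in \<open>a\<close> of the integral of \<open>p\<close> against the weight: each step integrates by parts once.\<close>

fun Lam_aux :: "nat \<Rightarrow> real \<Rightarrow> real \<Rightarrow> real poly \<Rightarrow> real" where
  "Lam_aux 0 a b p = jint a b (poly p)"
| "Lam_aux (Suc m) a b p = Lam_aux m (a + 1) b (Eop a b p)"

text \<open>The floor of -a is the least number of steps that brings the exponent above -1;
  \<open>nat\<close> makes it 0 when a > -1 from the start.\<close>

definition Lam :: "real \<Rightarrow> real \<Rightarrow> real poly \<Rightarrow> real" where
  "Lam a b p = Lam_aux (nat \<lfloor>-a\<rfloor>) a b p"

lemma negint_shift: "\<not> negint a \<Longrightarrow> \<not> negint (a + 1)"
  unfolding negint_def by (metis add_diff_cancel_right' of_nat_Suc le_SucI minus_add_distrib uminus_add_conv_diff diff_minus_eq_add add.commute add_uminus_conv_diff)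

text \<open>Continuation as an induction: a claim known for convergent integrals descends one unit
  of \<open>a\<close> at a time, avoiding the negative integers, where \<open>Eop\<close> would meet
  a division by zero.\<close>

lemma negint_induct [consumes 1, case_names base step]:
  assumes "\<not> negint a" "\<And>a. a > -1 \<Longrightarrow> P a" "\<And>a. \<not> negint a \<Longrightarrow> P (a + 1) \<Longrightarrow> P a"
  shows "P a"
proof -
  have "\<forall>a. \<not> negint a \<longrightarrow> a + real m > -1 \<longrightarrow> P a" for m
  proof (induction m)
    case 0 thus ?case using assms(2) by simp
  next
    case (Suc m)
    show ?case
    proof (intro allI impI)
      fix a assume a: "\<not> negint a" "a + real (Suc m) > -1"
      hence "a + 1 + real m > -1" by simp
      thus "P a" using assms(3)[OF a(1)] Suc negint_shift[OF a(1)] by blast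
    qed
  qed
  moreover have "a + real (nat \<lceil>-a\<rceil>) > -1" by linarith
  ultimately show ?thesis using assms(1) by blast
qed

lemma Lam_base: "a > -1 \<Longrightarrow> Lam a b p = jint a b (poly p)"
proof -
  assume "a > -1"
  hence "nat \<lfloor>-a\<rfloor> = 0" by linarith
  thus ?thesis by (simp add: Lam_def)
qed

lemma Lam_step:
  assumes "\<not> negint a" "b > -1"
  shows "Lam a b p = Lam (a + 1) b (Eop a b p)"
proof (cases "a > -1")
  case True
  have "Lam (a + 1) b (Eop a b p) = jint a b (poly ([:1,-1:] * Eop a b p))"
    using True Lam_base[of "a + 1"] by (simp only: jint_one_minus)
  also have "\<dots> = jint a b (poly p)"
    using True assms by (simp add: one_minus_Eop jint_add jint_smult jint_Nop del: mult_pCons_left)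
  finally show ?thesis using True by (simp add: Lam_base)
next
  case False
  have "a \<noteq> -1" using assms(1) unfolding negint_def by (metis le_refl of_nat_1)
  hence "a < -1" using False by simp
  hence "nat \<lfloor>-a\<rfloor> = Suc (nat \<lfloor>-(a+1)\<rfloor>)" by linarith
  thus ?thesis by (simp add: Lam_def)
qed

lemma Lam_add: "\<not> negint a \<Longrightarrow> b > -1 \<Longrightarrow> Lam a b (p + q) = Lam a b p + Lam a b q"
proof (induction a arbitrary: p q rule: negint_induct)
  case (base a) thus ?case by (simp add: Lam_base jint_add)
next
  case (step a) thus ?case by (simp add: Lam_step[of a] Eop_add)
qed

lemma Lam_smult: "\<not> negint a \<Longrightarrow> b > -1 \<Longrightarrow> Lam a b (psm c p) = c * Lam a b p"
proof (induction a arbitrary: p rule: negint_induct)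
  case (base a) thus ?case by (simp add: Lam_base jint_smult)
next
  case (step a) thus ?case by (simp add: Lam_step[of a] Eop_smult)
qed

lemma Lam_minus: "\<not> negint a \<Longrightarrow> b > -1 \<Longrightarrow> Lam a b (- p) = - Lam a b p"
  using Lam_smult[of a b "-1" p] by simp

lemma Lam_diff: "\<not> negint a \<Longrightarrow> b > -1 \<Longrightarrow> Lam a b (p - q) = Lam a b p - Lam a b q"
  using Lam_add[of a b p "-q"] Lam_minus[of a b q] by simp

lemma Lam_Nop: "\<not> negint a \<Longrightarrow> b > -1 \<Longrightarrow> Lam a b (Nop a b h) = 0"
proof (induction a arbitrary: h rule: negint_induct)
  case (base a) thus ?case by (simp add: Lam_base jint_Nop)
next
  case (step a) thus ?case by (simp add: Lam_step[of a] Eop_Nop)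
qed

lemma negint_not_minus1: "\<not> negint a \<Longrightarrow> a \<noteq> -1"
  unfolding negint_def by (metis le_refl of_nat_1)

lemma Lam_one_minus: "\<not> negint a \<Longrightarrow> b > -1 \<Longrightarrow> Lam a b ([:1,-1:] * p) = Lam (a + 1) b p"
  unfolding Lam_step[of a b "[:1,-1:] * p"]
  by (simp only: Eop_one_minus negint_not_minus1 Lam_add Lam_smult Lam_Nop negint_shift not_False_eq_True mult_zero_right add_0_right)

lemma Lam_one_plus: "\<not> negint a \<Longrightarrow> b > -1 \<Longrightarrow> Lam a b ([:1,1:] * p) = Lam a (b + 1) p"
proof (induction a arbitrary: p rule: negint_induct)
  case (base a) thus ?case by (simp only: Lam_base jint_one_plus)
next
  case (step a) 
  have "Lam a b ([:1,1:] * p) = Lam (a + 1) b ([:1,1:] * Eop a (b + 1) p)"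
    by (simp only: Lam_step[OF step.hyps(1) step.prems, of "[:1,1:] * p"] Eop_one_plus)
  also have "\<dots> = Lam (a + 1) (b + 1) (Eop a (b + 1) p)" by (rule step.IH[OF step.prems])
  also have "\<dots> = Lam a (b + 1) p" using step by (simp add: Lam_step[of a "b+1"])
  finally show ?case .
qed

text \<open>The total derivative in \<open>Lop_mult\<close> contributes nothing, and (1 - x)(1 + x)
  goes into the exponents. The right-hand side is symmetric in f and g, whence the symmetry of the
  operator.\<close>

lemma Lam_Lop:
  assumes "\<not> negint a" "b > -1"
  shows "Lam a b (Lop a b f * g) = Lam (a + 1) (b + 1) (pderiv f * pderiv g)"
proof -
  have "Lam a b (Lop a b f * g) = Lam a b ([:1,-1:] * ([:1,1:] * (pderiv f * pderiv g)))"
    using assms by (simp only: Lop_mult Lam_diff Lam_Nop not_False_eq_True diff_zero)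
  also have "\<dots> = Lam (a + 1) b ([:1,1:] * (pderiv f * pderiv g))" using assms by (rule Lam_one_minus)
  also have "\<dots> = Lam (a + 1) (b + 1) (pderiv f * pderiv g)" using assms by (intro Lam_one_plus negint_shift)
  finally show ?thesis .
qed

lemma jint_one_pos: "a > -1 \<Longrightarrow> b > -1 \<Longrightarrow> jint a b (poly 1) > 0"
proof -
  assume ab: "a > -1" "b > -1"
  have "jint a b (poly 1) \<ge> 0" unfolding jint_def using jweight_nonneg by (intro integral_nonneg_AE AE_I2) simp
  moreover have "jint a b (poly 1) \<noteq> 0"
  proof
    assume "jint a b (poly 1) = 0"
    hence "AE x in lborel. jweight a b x = 0"
      using integral_nonneg_eq_0_iff_AE[OF integrable_jweight[OF ab]] jweight_nonneg unfolding jint_def by simp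
    moreover have "jweight a b x = 0 \<longleftrightarrow> x \<notin> {-1<..<1}" for x unfolding jweight_def by auto
    ultimately have "AE x in lborel. x \<notin> {-1<..<1::real}" by simp
    hence "emeasure lborel {-1<..<1::real} = 0"
      by (subst (asm) AE_iff_measurable[of "{-1<..<1}"]) auto
    thus False by simp
  qed
  ultimately show ?thesis by simp
qed

text \<open>\<open>Lam a b 1\<close> continues the Beta integral, a positive multiple of Gamma(a +
  1) Gamma(b + 1) / Gamma(a + b + 2), and Gamma(b + 1) > 0. Only the sign is needed, so a product
  replaces the quotient: one step of the recursion changes it by the positive factor 2(a +
  1)^2.\<close>

lemma Lam_one_sign:
  "\<not> negint a \<Longrightarrow> b > -1 \<Longrightarrow> (\<And>n::nat. a + b + 2 + real n \<noteq> 0) \<Longrightarrow>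
   Lam a b 1 * (Gamma (a + 1) * Gamma (a + b + 2)) > 0"
proof (induction a rule: negint_induct)
  case (base a) thus ?case using jint_one_pos[of a b] by (simp add: Lam_base)
next
  case (step a)
  have nz: "a + 1 \<noteq> 0" using negint_not_minus1[OF step(1)] by simp
  have nz2: "a + b + 2 \<noteq> 0" using step.prems(2)[of 0] by simp
  have E: "Eop a b 1 = psm ((a + b + 2) / (2 * (a + 1))) 1" by (simp add: Eop_def)
  have L: "Lam a b 1 = (a + b + 2) / (2 * (a + 1)) * Lam (a + 1) b 1"
    using step by (simp only: Lam_step[of a b] E Lam_smult negint_shift not_False_eq_True)
  have L': "2 * (a + 1) * Lam a b 1 = (a + b + 2) * Lam (a + 1) b 1" unfolding L using nz by simp
  have "(a + 1 + b + 2 + real n) \<noteq> 0" for n using step.prems(2)[of "Suc n"] by (simp add: algebra_simps)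
  hence IH: "Lam (a + 1) b 1 * (Gamma (a + 1 + 1) * Gamma (a + 1 + b + 2)) > 0" using step by simp
  have g1: "Gamma (a + 1 + 1) = (a + 1) * Gamma (a + 1)"
  proof (rule Gamma_plus1)
    show "a + 1 \<notin> \<int>\<^sub>\<le>\<^sub>0"
    proof
      assume "a + 1 \<in> \<int>\<^sub>\<le>\<^sub>0"
      then obtain n where "a + 1 = - real n" by (auto elim!: nonpos_Ints_cases')
      hence "a = - real (Suc n)" by simp
      thus False using step(1) unfolding negint_def by (metis le_add1 plus_1_eq_Suc)
    qed
  qed
  have g2: "Gamma (a + b + 2 + 1) = (a + b + 2) * Gamma (a + b + 2)"
  proof (rule Gamma_plus1)
    show "a + b + 2 \<notin> \<int>\<^sub>\<le>\<^sub>0"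
      using step.prems(2) by (auto elim!: nonpos_Ints_cases') (metis add.commute add.right_inverse)
  qed
  have e: "a + 1 + b + 2 = a + b + 2 + 1" by simp
  have "Lam (a + 1) b 1 * (Gamma (a + 1 + 1) * Gamma (a + 1 + b + 2)) = 2 * (a + 1)\<^sup>2 * (Lam a b 1 * (Gamma (a + 1) * Gamma (a + b + 2)))"
  proof -
    have "M * (c * G * (d * H)) = 2 * c\<^sup>2 * (l * (G * H))" if "2 * c * l = d * M" for M c G d H l :: real
    proof -
      have "M * (c * G * (d * H)) = c * G * H * (d * M)" by simp
      thus ?thesis unfolding that[symmetric] by (simp add: power2_eq_square)
    qed
    thus ?thesis unfolding e g1 g2 using L' by blast
  qed
  thus ?case using IH nz by (simp add: zero_less_mult_iff)
qed

section \<open>Norms of Jacobi polynomials and positivity of the form\<close>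

lemma conjLop_neg: "conjLop a (-b) p = Lop a b p + psm ((a + 1) * b) p"
  by (rule poly_extI) (simp add: conjLop_def Let_def Lop_def Nop_def pderiv_expand algebra_simps)

lemma Lop_linear: "poly_linear (Lop a b)"
  unfolding poly_linear_def Lop_def Nop_def
  by (safe; rule poly_extI) (simp_all add: pderiv_expand algebra_simps)

lemma Lop_jacobiP: "Lop a b (jacobiP a b n) = psm (real n * (real n + a + b + 1)) (jacobiP a b n)"
proof (rule poly_extI)
  fix x
  have "conjLop a (-b) (jacobiP a b n) = psm ((real n + b) * (real n + a + 1)) (jacobiP a b n)"
    using conjLop_jacobiP[of a "-b" n] by simp
  hence "poly (Lop a b (jacobiP a b n) + psm ((a + 1) * b) (jacobiP a b n)) x
      = poly (psm ((real n + b) * (real n + a + 1)) (jacobiP a b n)) x"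
    by (simp only: conjLop_neg)
  thus "poly (Lop a b (jacobiP a b n)) x = poly (psm (real n * (real n + a + b + 1)) (jacobiP a b n)) x"
    by (simp add: algebra_simps)
qed

lemma jacobiP_degree_le: "Polynomial.degree (jacobiP a b n) \<le> n"
  and jacobiP_coeff: "Polynomial.coeff (jacobiP a b n) n = ((2 * real n + a + b) gchoose n) / 2 ^ n"
proof -
  define t where "t = (\<lambda>j. [:-1, 1::real:] ^ (n - j) * [:1, 1:] ^ j)"
  have t: "Polynomial.degree (t j) = n" "Polynomial.coeff (t j) n = 1" if "j \<le> n" for j
  proof -
    have "Polynomial.degree (t j) = (n - j) * 1 + j * 1"
      unfolding t_def by (subst degree_mult_eq) (simp_all add: degree_power_eq)
    thus d: "Polynomial.degree (t j) = n" using that by simp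
    have "lead_coeff (t j) = 1" unfolding t_def by (simp add: lead_coeff_mult lead_coeff_power)
    thus "Polynomial.coeff (t j) n = 1" using d by simp
  qed
  have t_app: "[:-1, 1::real:] ^ (n - j) * [:1, 1:] ^ j = t j" for j by (simp add: t_def)
  show "Polynomial.degree (jacobiP a b n) \<le> n" unfolding jacobiP_def t_app
    by (rule order.trans[OF degree_smult_le], rule degree_sum_le)
      (auto intro!: order.trans[OF degree_smult_le] simp: t)
  have "Polynomial.coeff (jacobiP a b n) n = (\<Sum>j=0..n. ((real n + a) gchoose j) * ((real n + b) gchoose (n - j))) / 2 ^ n"
    unfolding jacobiP_def t_app by (simp add: coeff_sum t sum_divide_distrib)
  also have "\<dots> = ((2 * real n + a + b) gchoose n) / 2 ^ n"
    by (simp add: gbinomial_Vandermonde algebra_simps)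
  finally show "Polynomial.coeff (jacobiP a b n) n = ((2 * real n + a + b) gchoose n) / 2 ^ n" .
qed

text \<open>Each use of \<open>Lam_Lop\<close> trades an eigenvalue for one derivative on both
  factors. By \<open>pderiv_Lop\<close> the j-th derivative is again an eigenfunction, with
  eigenvalue l - j(j + a + b + 1); after n derivatives only a constant and the mass of the shifted
  weight remain.\<close>

lemma Lam_Lop_norm:
  assumes "\<not> negint a" "b > -1" "Lop a b p = psm l p" "(pderiv ^^ n) p = [:c:]"
  shows "(\<Prod>j<n. l - real j * (real j + a + b + 1)) * Lam a b (p * p) = c\<^sup>2 * Lam (a + real n) (b + real n) 1"
  using assms
proof (induction n arbitrary: a b p l)
  case 0
  hence "p * p = psm (c\<^sup>2) 1" by (simp add: power2_eq_square)
  hence "Lam a b (p * p) = c\<^sup>2 * Lam a b 1" by (simp only: Lam_smult[OF 0(1,2)])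
  thus ?case by simp
next
  case (Suc n)
  have "psm l (pderiv p) = Lop (a + 1) (b + 1) (pderiv p) + psm (a + b + 2) (pderiv p)"
    using pderiv_Lop[of a b p] Suc.prems(3) by (simp add: pderiv_smult)
  hence e: "Lop (a + 1) (b + 1) (pderiv p) = psm (l - (a + b + 2)) (pderiv p)"
    by (simp add: smult_diff_left algebra_simps)
  have "(pderiv ^^ n) (pderiv p) = [:c:]" using Suc.prems(4) by (simp add: funpow_swap1)
  hence IH: "(\<Prod>j<n. l - (a + b + 2) - real j * (real j + (a + 1) + (b + 1) + 1)) * Lam (a + 1) (b + 1) (pderiv p * pderiv p)
      = c\<^sup>2 * Lam (a + 1 + real n) (b + 1 + real n) 1"
    using Suc.IH[OF negint_shift[OF Suc.prems(1)] _ e] Suc.prems(2) by simp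
  have "Lam (a + 1) (b + 1) (pderiv p * pderiv p) = l * Lam a b (p * p)"
    using Lam_Lop[OF Suc.prems(1,2), of p p] Suc.prems by (simp add: Lam_smult)
  moreover have "(\<Prod>j<n. l - (a + b + 2) - real j * (real j + (a + 1) + (b + 1) + 1))
      = (\<Prod>j<n. l - real (Suc j) * (real (Suc j) + a + b + 1))"
    by (rule prod.cong) (simp_all add: algebra_simps)
  moreover have "(\<Prod>j<Suc n. l - real j * (real j + a + b + 1)) = l * (\<Prod>j<n. l - real (Suc j) * (real (Suc j) + a + b + 1))"
    by (simp add: prod.lessThan_Suc_shift del: prod.lessThan_Suc)
  ultimately show ?case using IH by (simp add: algebra_simps)
qed

lemma quadratic_form_sym:
  assumes reg: "\<not> negint a" and b: "b > -1"
  shows "Lam a b (q * shift_prod (Lop a b) ns r) = Lam a b (r * shift_prod (Lop a b) ns q)"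
proof -
  have L: "Lam a b (Lop a b u * v) = Lam a b (u * Lop a b v)" for u v
    using Lam_Lop[OF reg b, of u v] Lam_Lop[OF reg b, of v u] by (simp add: mult.commute)
  have com: "Lop a b (shift_prod (Lop a b) ns u) = shift_prod (Lop a b) ns (Lop a b u)" for ns u
    using Lop_linear[of a b] unfolding poly_linear_def
    by (induction ns) (auto, metis diff_minus_eq_add add_diff_cancel_right' diff_add_cancel)
  have com2: "shift_prod (Lop a b) (m # ns) u = shift_prod (Lop a b) ns (Lop a b u - psm m u)" for m ns u
    using shift_prod_linear[OF Lop_linear, of a b ns] unfolding poly_linear_def
    by (simp add: com) (metis diff_add_cancel add_diff_cancel_right')
  show ?thesis
  proof (induction ns arbitrary: q r)
    case (Cons m ns)
    have "Lam a b (q * shift_prod (Lop a b) (m # ns) r) = Lam a b (q * Lop a b (shift_prod (Lop a b) ns r))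
        - m * Lam a b (q * shift_prod (Lop a b) ns r)"
      by (simp add: right_diff_distrib Lam_diff[OF reg b] Lam_smult[OF reg b])
    also have "\<dots> = Lam a b ((Lop a b q - psm m q) * shift_prod (Lop a b) ns r)"
      by (simp add: left_diff_distrib Lam_diff[OF reg b] Lam_smult[OF reg b] L)
    also have "\<dots> = Lam a b (r * shift_prod (Lop a b) (m # ns) q)" unfolding Cons com2 ..
    finally show ?case .
  qed (simp add: mult.commute)
qed

context
  fixes \<alpha> \<beta> :: real and F2 :: "nat set"
  assumes F: "finite F2"
    and A1: "A1 \<alpha> \<beta>" and b: "\<beta> > -1"
begin

text \<open>The eigenvalue on the n-th Jacobi polynomial is precisely the product over
  \<open>F2\<close> in \<open>Hfun\<close>, since the differences of eigenvalues factor.\<close>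

lemma shift_prod_Lop_jacobiP:
  "shift_prod (Lop \<alpha> \<beta>) (map (\<lambda>f. (real f - \<beta>) * (real f + \<alpha> + 1)) (sorted_list_of_set F2)) (jacobiP \<alpha> \<beta> n)
    = psm (\<Prod>f\<in>F2. (real n + \<beta> - real f) * (real n + real f + \<alpha> + 1)) (jacobiP \<alpha> \<beta> n)"
proof -
  have "real n * (real n + \<alpha> + \<beta> + 1) - (real f - \<beta>) * (real f + \<alpha> + 1)
      = (real n + \<beta> - real f) * (real n + real f + \<alpha> + 1)" for f by (simp add: algebra_simps)
  thus ?thesis unfolding shift_prod_eigen[OF Lop_linear Lop_jacobiP]
    using prod.distinct_set_conv_list[of "sorted_list_of_set F2" "\<lambda>f. (real n + \<beta> - real f) * (real n + real f + \<alpha> + 1)"] F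
    by (simp add: o_def)
qed

lemma reg_alpha: "\<not> negint \<alpha>" using A1 unfolding A1_def by simp

lemma ab_nonneg: "\<alpha> + \<beta> + real (Suc n) \<noteq> 0"
  using A1 unfolding A1_def negint_def by (metis add_eq_0_iff2 le_add1 plus_1_eq_Suc)

lemma jacobiP_orthogonal:
  assumes "m \<noteq> n"
  shows "Lam \<alpha> \<beta> (jacobiP \<alpha> \<beta> m * jacobiP \<alpha> \<beta> n) = 0"
proof -
  let ?P = "jacobiP \<alpha> \<beta>" and ?l = "\<lambda>n. real n * (real n + \<alpha> + \<beta> + 1)"
  have "?l m * Lam \<alpha> \<beta> (?P m * ?P n) = Lam (\<alpha> + 1) (\<beta> + 1) (pderiv (?P m) * pderiv (?P n))"
    using Lam_Lop[OF reg_alpha b, of "?P m" "?P n"] reg_alpha b by (simp add: Lop_jacobiP Lam_smult)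
  moreover have "?l n * Lam \<alpha> \<beta> (?P m * ?P n) = Lam (\<alpha> + 1) (\<beta> + 1) (pderiv (?P m) * pderiv (?P n))"
    using Lam_Lop[OF reg_alpha b, of "?P n" "?P m"] reg_alpha b by (simp add: Lop_jacobiP Lam_smult mult.commute)
  ultimately have "(?l m - ?l n) * Lam \<alpha> \<beta> (?P m * ?P n) = 0" by (simp add: algebra_simps)
  moreover have "?l m - ?l n = (real m - real n) * (\<alpha> + \<beta> + real (Suc (m + n)))" by (simp add: algebra_simps)
  ultimately show ?thesis using assms ab_nonneg[of "m + n"] by simp
qed

text \<open>The leading coefficients are non-zero because \<alpha> + \<beta> is not a negative
  integer, so the degree can be lowered step by step.\<close>

lemma poly_jacobiP_span:
  "\<exists>c. (q :: real poly) = (\<Sum>n\<le>N. psm (c n) (jacobiP \<alpha> \<beta> n))" if "Polynomial.degree q \<le> N"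
  using that
proof (induction N arbitrary: q)
  case 0
  have "jacobiP \<alpha> \<beta> 0 = 1" by (simp add: jacobiP_def)
  moreover obtain c where "q = [:c:]" using 0 by (auto elim: degree_eq_zeroE)
  ultimately show ?case by (intro exI[of _ "\<lambda>_. c"]) simp
next
  case (Suc N)
  let ?P = "jacobiP \<alpha> \<beta>"
  have "(real (Suc N) + (real (Suc N) + \<alpha> + \<beta>)) gchoose (Suc N) \<noteq> 0"
  proof (rule gbinomial_nonzero)
    fix i :: nat assume "1 \<le> i"
    thus "real (Suc N) + \<alpha> + \<beta> \<noteq> - real i" using ab_nonneg[of "N + i"] by (auto simp: algebra_simps)
  qed
  hence nz: "Polynomial.coeff (?P (Suc N)) (Suc N) \<noteq> 0" by (simp add: jacobiP_coeff algebra_simps)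
  define d where "d = Polynomial.coeff q (Suc N) / Polynomial.coeff (?P (Suc N)) (Suc N)"
  have "Polynomial.degree (q - psm d (?P (Suc N))) \<le> N"
  proof (rule degree_le, safe)
    fix i assume i: "N < i"
    show "Polynomial.coeff (q - psm d (?P (Suc N))) i = 0"
    proof (cases "i = Suc N")
      case True thus ?thesis using nz by (simp add: d_def)
    next
      case False
      hence "i > Suc N" using i by simp
      thus ?thesis using Suc.prems jacobiP_degree_le[of \<alpha> \<beta> "Suc N"] by (simp add: coeff_eq_0)
    qed
  qed
  then obtain c where c: "q - psm d (?P (Suc N)) = (\<Sum>n\<le>N. psm (c n) (?P n))" using Suc.IH by blast
  have "q = (\<Sum>n\<le>Suc N. psm ((c(Suc N := d)) n) (?P n))"
    using c by (simp add: algebra_simps)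
  thus ?case by blast
qed

context
  fixes ms :: "real list"
  defines "ms \<equiv> map (\<lambda>f. (real f - \<beta>) * (real f + \<alpha> + 1)) (sorted_list_of_set F2)"
begin

text \<open>Only signs are compared. The norm formula and the sign of the shifted mass show that the
  norm has the sign of \<open>T\<close>: the factor \<open>D\<close> enters squared and
  \<open>C\<close> is positive. Dividing by \<open>V\<close> or multiplying by it gives the same
  sign, and Gamma(n + \<beta> + 1) > 0, so \<open>Hfun\<close> has the sign of
  \<open>Rn * T\<close>.\<close>

lemma admissible_norm_nonneg:
  assumes adm: "jacobi_admissible \<alpha> \<beta> F2"
  shows "(\<Prod>f\<in>F2. (real n + \<beta> - real f) * (real n + real f + \<alpha> + 1)) * Lam \<alpha> \<beta> (jacobiP \<alpha> \<beta> n * jacobiP \<alpha> \<beta> n) \<ge> 0"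
proof -
  let ?p = "jacobiP \<alpha> \<beta> n"
  define Rn where "Rn = (\<Prod>f\<in>F2. (real n + \<beta> - real f) * (real n + real f + \<alpha> + 1))"
  define s where "s = \<alpha> + \<beta>"
  define G where "G = Gamma (real n + \<alpha> + 1)"
  define T where "T = G * ((2 * real n + s + 1) * Gamma (real n + s + 1))"
  define D where "D = (\<Prod>j<n. real n * (real n + \<alpha> + \<beta> + 1) - real j * (real j + \<alpha> + \<beta> + 1))"
  have np: "\<alpha> + \<beta> + real m + 1 \<notin> \<int>\<^sub>\<le>\<^sub>0" for m
  proof
    assume "\<alpha> + \<beta> + real m + 1 \<in> \<int>\<^sub>\<le>\<^sub>0"
    then obtain j where "\<alpha> + \<beta> + real m + 1 = - real j" by (auto elim!: nonpos_Ints_cases')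
    thus False using ab_nonneg[of "m + j"] by simp
  qed
  have c: "(pderiv ^^ n) ?p = [:fact n * Polynomial.coeff ?p n:]"
  proof (rule poly_eqI)
    fix i show "Polynomial.coeff ((pderiv ^^ n) ?p) i = Polynomial.coeff [:fact n * Polynomial.coeff ?p n:] i"
      using jacobiP_degree_le[of \<alpha> \<beta> n]
      by (cases i) (auto simp: coeff_higher_pderiv pochhammer_fact[symmetric] coeff_eq_0)
  qed
  have nz: "Polynomial.coeff ?p n \<noteq> 0"
  proof -
    have "(real n + (real n + \<alpha> + \<beta>)) gchoose n \<noteq> 0"
    proof (rule gbinomial_nonzero)
      fix i :: nat assume "1 \<le> i" 
      thus "real n + \<alpha> + \<beta> \<noteq> - real i" using ab_nonneg[of "n + i - 1"] by (auto simp: algebra_simps of_nat_diff)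
    qed
    thus ?thesis by (simp add: jacobiP_coeff algebra_simps)
  qed
  define C where "C = (fact n * Polynomial.coeff ?p n)\<^sup>2"
  have C: "C > 0" using nz by (simp add: C_def)
  have N: "D * Lam \<alpha> \<beta> (?p * ?p) = C * Lam (\<alpha> + real n) (\<beta> + real n) 1"
    using Lam_Lop_norm[OF reg_alpha b Lop_jacobiP c] unfolding D_def C_def .
  have regn: "\<not> negint (\<alpha> + real n)"
    using reg_alpha unfolding negint_def
    by (metis add_diff_cancel_right' diff_minus_eq_add le_add1 minus_add_distrib of_nat_add order.trans uminus_add_conv_diff add.commute diff_conv_add_uminus)
  have "\<alpha> + real n + (\<beta> + real n) + 2 + real m \<noteq> 0" for m using ab_nonneg[of "2 * n + m + 1"] by (simp add: algebra_simps)
  hence L1: "Lam (\<alpha> + real n) (\<beta> + real n) 1 * (Gamma (\<alpha> + real n + 1) * Gamma (\<alpha> + real n + (\<beta> + real n) + 2)) > 0"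
    using Lam_one_sign[OF regn, of "\<beta> + real n"] b by simp
  have Dp: "D = fact n * pochhammer (real n + s + 1) n"
  proof -
    have "D = (\<Prod>j<n. (real n - real j) * (real n + s + 1 + real j))"
      unfolding D_def s_def by (rule prod.cong) (simp_all add: algebra_simps)
    also have "\<dots> = (\<Prod>j<n. real n - real j) * pochhammer (real n + s + 1) n"
      by (simp add: prod.distrib pochhammer_prod lessThan_atLeast0)
    also have "(\<Prod>j<n. real n - real j) = fact n"
    proof -
      have "(\<Prod>j<n. real n - real j) = (\<Prod>j<n. real (Suc j))"
        by (rule prod.reindex_bij_witness[of _ "\<lambda>j. n - Suc j" "\<lambda>j. n - Suc j"]) (auto simp: of_nat_diff)
      thus ?thesis by (simp add: fact_prod_Suc atLeast0LessThan)
    qed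
    finally show ?thesis .
  qed
  have g1: "Gamma (real n + s + 1 + real n) = pochhammer (real n + s + 1) n * Gamma (real n + s + 1)"
    using pochhammer_Gamma[of "real n + s + 1" n] np[of n] Gamma_eq_zero_iff[of "real n + s + 1"] unfolding s_def
    by (simp add: add_ac)
  have g2: "Gamma (\<alpha> + real n + (\<beta> + real n) + 2) = (2 * real n + s + 1) * Gamma (real n + s + 1 + real n)"
    using Gamma_plus1[of "2 * real n + s + 1"] np[of "2 * n"] unfolding s_def by (simp add: algebra_simps)
  have "fact n * (Lam (\<alpha> + real n) (\<beta> + real n) 1 * (Gamma (\<alpha> + real n + 1) * Gamma (\<alpha> + real n + (\<beta> + real n) + 2)))
     = Lam (\<alpha> + real n) (\<beta> + real n) 1 * T * D"
    unfolding g2 g1 Dp T_def G_def by (simp add: add.commute mult_ac)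
  hence "Lam (\<alpha> + real n) (\<beta> + real n) 1 * T * D > 0" using L1 by (metis fact_gt_zero mult_pos_pos)
  hence "C * (Lam (\<alpha> + real n) (\<beta> + real n) 1 * T * D) > 0" using C by simp
  hence "(C * Lam (\<alpha> + real n) (\<beta> + real n) 1) * T * D > 0" by (simp only: mult.assoc)
  hence "(D * D) * (Lam \<alpha> \<beta> (?p * ?p) * T) > 0" unfolding N[symmetric] by (simp only: mult_ac)
  hence LT: "Lam \<alpha> \<beta> (?p * ?p) * T > 0" by (meson mult_nonneg_nonpos linorder_not_le zero_le_square)
  have "Hfun \<alpha> \<beta> F2 (real n) \<ge> 0" using adm unfolding jacobi_admissible_def by simp
  moreover have "Hfun \<alpha> \<beta> F2 (real n) = Gamma (real n + \<beta> + 1) * (Rn * (G / ((2 * real n + s + 1) * Gamma (real n + s + 1))))"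
    unfolding Hfun_def Rn_def G_def s_def by (simp add: add.assoc)
  moreover have "Gamma (real n + \<beta> + 1) > 0" using b by (intro Gamma_real_pos) simp
  ultimately have H: "Rn * (G / ((2 * real n + s + 1) * Gamma (real n + s + 1))) \<ge> 0"
    by (simp only: zero_le_mult_iff) auto
  define V where "V = (2 * real n + s + 1) * Gamma (real n + s + 1)"
  have V: "V \<noteq> 0" using LT unfolding T_def V_def by auto
  have "Rn * T = Rn * (G / V) * (V * V)" unfolding T_def V_def[symmetric] using V by simp
  moreover have "Rn * (G / V) * (V * V) \<ge> 0"
    using H unfolding V_def[symmetric] by (rule mult_nonneg_nonneg) simp
  ultimately have RT: "Rn * T \<ge> 0" by (simp only:)
  show ?thesis unfolding Rn_def[symmetric] using LT RT by (auto simp: zero_less_mult_iff zero_le_mult_iff)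
qed

lemma Lam_sum:
  "Lam \<alpha> \<beta> (\<Sum>x\<in>A. psm (c x) (g x)) = (\<Sum>x\<in>A. c x * Lam \<alpha> \<beta> (g x))"
proof -
  have "Lam \<alpha> \<beta> 0 = 0" using Lam_smult[OF reg_alpha b, of 0 0] by simp
  thus ?thesis
    by (induction A rule: infinite_finite_induct) (auto simp: Lam_add[OF reg_alpha b] Lam_smult[OF reg_alpha b])
qed

lemma quadratic_form_nonneg:
  assumes "jacobi_admissible \<alpha> \<beta> F2"
  shows "Lam \<alpha> \<beta> (q * shift_prod (Lop \<alpha> \<beta>) ms q) \<ge> 0"
proof -
  let ?P = "jacobiP \<alpha> \<beta>"
  obtain c where c: "q = (\<Sum>n\<le>Polynomial.degree q. psm (c n) (?P n))" using poly_jacobiP_span by blast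
  define N where "N = Polynomial.degree q"
  define R where "R = (\<lambda>n. \<Prod>f\<in>F2. (real n + \<beta> - real f) * (real n + real f + \<alpha> + 1))"
  have q: "q = (\<Sum>n\<le>N. psm (c n) (?P n))" using c unfolding N_def .
  have Rq: "shift_prod (Lop \<alpha> \<beta>) ms q = (\<Sum>n\<le>N. psm (c n * R n) (?P n))"
    unfolding q poly_linear_sum[OF shift_prod_linear[OF Lop_linear]] R_def ms_def
    by (simp add: shift_prod_Lop_jacobiP)
  have "q * shift_prod (Lop \<alpha> \<beta>) ms q = (\<Sum>m\<le>N. \<Sum>n\<le>N. psm (c m) (?P m) * psm (c n * R n) (?P n))"
    unfolding Rq by (subst q) (simp only: sum_product)
  also have "\<dots> = (\<Sum>m\<le>N. psm (c m) (\<Sum>n\<le>N. psm (c n * R n) (?P m * ?P n)))"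
    unfolding psm_sum by (intro sum.cong refl) (simp add: mult_ac)
  finally have "q * shift_prod (Lop \<alpha> \<beta>) ms q = \<dots>" .
  hence "Lam \<alpha> \<beta> (q * shift_prod (Lop \<alpha> \<beta>) ms q)
     = (\<Sum>m\<le>N. c m * (\<Sum>n\<le>N. c n * R n * Lam \<alpha> \<beta> (?P m * ?P n)))" by (simp add: Lam_sum)
  also have "\<dots> = (\<Sum>m\<le>N. c m * (\<Sum>n\<le>N. if n = m then c m * R m * Lam \<alpha> \<beta> (?P m * ?P m) else 0))"
    by (intro sum.cong arg_cong2[where f="(*)"] refl) (auto simp: jacobiP_orthogonal)
  also have "\<dots> = (\<Sum>m\<le>N. (c m)\<^sup>2 * (R m * Lam \<alpha> \<beta> (?P m * ?P m)))"
    by (simp add: power2_eq_square mult_ac)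
  also have "\<dots> \<ge> 0" unfolding R_def by (intro sum_nonneg mult_nonneg_nonneg admissible_norm_nonneg assms) simp
  finally show ?thesis .
qed

lemma shift_prod_surj:
  assumes "\<And>n. (\<Prod>f\<in>F2. (real n + \<beta> - real f) * (real n + real f + \<alpha> + 1)) \<noteq> 0"
  shows "\<exists>r. shift_prod (Lop \<alpha> \<beta>) ms r = q"
proof -
  let ?P = "jacobiP \<alpha> \<beta>"
  define R where "R = (\<lambda>n. \<Prod>f\<in>F2. (real n + \<beta> - real f) * (real n + real f + \<alpha> + 1))"
  obtain c where c: "q = (\<Sum>n\<le>Polynomial.degree q. psm (c n) (?P n))" using poly_jacobiP_span by blast
  have "shift_prod (Lop \<alpha> \<beta>) ms (\<Sum>n\<le>Polynomial.degree q. psm (c n / R n) (?P n)) = (\<Sum>n\<le>Polynomial.degree q. psm (c n) (?P n))"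
    unfolding poly_linear_sum[OF shift_prod_linear[OF Lop_linear]] ms_def
    using assms by (simp add: shift_prod_Lop_jacobiP R_def)
  thus ?thesis using c by metis
qed

end
end

section \<open>Bounded convergence and finite parts\<close>

text \<open>Just what dominated convergence needs for the derivatives up to order m. The limits
  \<open>F l\<close> are arbitrary functions, so the top one may jump.\<close>

definition bconv :: "nat \<Rightarrow> (nat \<Rightarrow> real \<Rightarrow> real) \<Rightarrow> (nat \<Rightarrow> real poly) \<Rightarrow> bool" where
  "bconv m F f \<longleftrightarrow> (\<forall>l\<le>m. (\<exists>C. \<forall>i x. -1 < x \<and> x < 1 \<longrightarrow> \<bar>poly ((pderiv ^^ l) (f i)) x\<bar> \<le> C) \<and>
     (\<forall>x. -1 < x \<and> x < 1 \<longrightarrow> (\<lambda>i. poly ((pderiv ^^ l) (f i)) x) \<longlonglongrightarrow> F l x))"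

abbreviation bnull :: "nat \<Rightarrow> (nat \<Rightarrow> real poly) \<Rightarrow> bool" where
  "bnull m f \<equiv> bconv m (\<lambda>_ _. 0) f"

lemma bconv_mono: "bconv m F f \<Longrightarrow> n \<le> m \<Longrightarrow> bconv n F f"
  unfolding bconv_def by auto

lemma bconv_Suc_iff:
  "bconv (Suc m) F f \<longleftrightarrow> bconv 0 F f \<and> bconv m (\<lambda>l. F (Suc l)) (\<lambda>i. pderiv (f i))"
proof -
  have e: "(pderiv ^^ l) (pderiv p) = (pderiv ^^ Suc l) p" for l and p :: "real poly"
    by (simp add: funpow_swap1)
  have "(\<forall>l\<le>Suc m. Q l) \<longleftrightarrow> Q 0 \<and> (\<forall>l\<le>m. Q (Suc l))" for Q
    by (metis Suc_le_mono le0 not0_implies_Suc)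
  thus ?thesis unfolding bconv_def e by simp
qed

lemma bnull_add: "bnull m f \<Longrightarrow> bnull m g \<Longrightarrow> bnull m (\<lambda>i. f i + g i)"
  unfolding bconv_def
proof (intro allI impI)
  fix l
  assume f: "\<forall>l\<le>m. (\<exists>C. \<forall>i x. -1 < x \<and> x < 1 \<longrightarrow> \<bar>poly ((pderiv ^^ l) (f i)) x\<bar> \<le> C) \<and>
     (\<forall>x. -1 < x \<and> x < 1 \<longrightarrow> (\<lambda>i. poly ((pderiv ^^ l) (f i)) x) \<longlonglongrightarrow> 0)"
    and g: "\<forall>l\<le>m. (\<exists>C. \<forall>i x. -1 < x \<and> x < 1 \<longrightarrow> \<bar>poly ((pderiv ^^ l) (g i)) x\<bar> \<le> C) \<and>
     (\<forall>x. -1 < x \<and> x < 1 \<longrightarrow> (\<lambda>i. poly ((pderiv ^^ l) (g i)) x) \<longlonglongrightarrow> 0)"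
    and l: "l \<le> m"
  obtain C D where C: "\<And>i x. -1 < x \<and> x < 1 \<Longrightarrow> \<bar>poly ((pderiv ^^ l) (f i)) x\<bar> \<le> C"
    and D: "\<And>i x. -1 < x \<and> x < 1 \<Longrightarrow> \<bar>poly ((pderiv ^^ l) (g i)) x\<bar> \<le> D"
    using f g l by metis
  have "\<bar>poly ((pderiv ^^ l) (f i + g i)) x\<bar> \<le> C + D" if "-1 < x \<and> x < 1" for i x
    using C[OF that, of i] D[OF that, of i] by (simp add: higher_pderiv_add)
  moreover have "(\<lambda>i. poly ((pderiv ^^ l) (f i + g i)) x) \<longlonglongrightarrow> 0" if "-1 < x \<and> x < 1" for x
    using f g l that by (auto simp: higher_pderiv_add intro!: tendsto_add_zero)
  ultimately show "(\<exists>C. \<forall>i x. -1 < x \<and> x < 1 \<longrightarrow> \<bar>poly ((pderiv ^^ l) (f i + g i)) x\<bar> \<le> C) \<and>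
     (\<forall>x. -1 < x \<and> x < 1 \<longrightarrow> (\<lambda>i. poly ((pderiv ^^ l) (f i + g i)) x) \<longlonglongrightarrow> 0)" by blast
qed

lemma bnull_mult: "bnull m f \<Longrightarrow> bnull m (\<lambda>i. p * f i)"
proof (induction m arbitrary: f p)
  case 0
  obtain B where B: "\<forall>x\<in>{-1..1}. \<bar>poly p x\<bar> \<le> B" using poly_bounded by blast
  have B0: "B \<ge> 0" using bspec[OF B, of 0] by auto
  obtain C where C: "\<And>i x. -1 < x \<Longrightarrow> x < 1 \<Longrightarrow> \<bar>poly (f i) x\<bar> \<le> C"
    using 0 unfolding bconv_def by auto
  have "\<bar>poly p x\<bar> * \<bar>poly (f i) x\<bar> \<le> B * C" if "-1 < x" "x < 1" for i x
    using B C[OF that, of i] that B0 by (intro mult_mono) auto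
  thus ?case using 0 unfolding bconv_def by (auto simp: abs_mult intro!: exI[of _ "B * C"] tendsto_mult_right_zero)
next
  case (Suc m)
  have f: "bnull 0 f" "bnull m (\<lambda>i. pderiv (f i))" using Suc.prems unfolding bconv_Suc_iff by simp_all
  have "bnull 0 (\<lambda>i. p * f i)"
  proof -
    obtain B where B: "\<forall>x\<in>{-1..1}. \<bar>poly p x\<bar> \<le> B" using poly_bounded by blast
    have B0: "B \<ge> 0" using bspec[OF B, of 0] by auto
    obtain C where C: "\<And>i x. -1 < x \<Longrightarrow> x < 1 \<Longrightarrow> \<bar>poly (f i) x\<bar> \<le> C"
      using f(1) unfolding bconv_def by auto
    have "\<bar>poly p x\<bar> * \<bar>poly (f i) x\<bar> \<le> B * C" if "-1 < x" "x < 1" for i x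
      using B C[OF that, of i] that B0 by (intro mult_mono) auto
    thus ?thesis using f(1) unfolding bconv_def by (auto simp: abs_mult intro!: exI[of _ "B * C"] tendsto_mult_right_zero)
  qed
  moreover have "bnull m (\<lambda>i. pderiv (p * f i))"
    unfolding pderiv_mult
    using bnull_add[OF Suc.IH[OF f(2), of p] Suc.IH[OF bconv_mono[OF Suc.prems], of "pderiv p"]]
    by (simp add: mult.commute add.commute)
  ultimately show ?case using bconv_Suc_iff by blast
qed

lemma jint_limit:
  assumes ab: "a > -1" "b > -1"
    and [measurable]: "\<And>i. f i \<in> borel_measurable borel" "g \<in> borel_measurable borel"
    and C: "\<And>i x. -1 < x \<Longrightarrow> x < 1 \<Longrightarrow> \<bar>f i x\<bar> \<le> C"
    and lim: "\<And>x. -1 < x \<Longrightarrow> x < 1 \<Longrightarrow> (\<lambda>i. f i x) \<longlonglongrightarrow> g x"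
  shows "(\<lambda>i. jint a b (f i)) \<longlonglongrightarrow> jint a b g"
  unfolding jint_def
proof (rule integral_dominated_convergence[where w = "\<lambda>x. jweight a b x * C"])
  show "integrable lborel (\<lambda>x. jweight a b x * C)" using integrable_jweight[OF ab] by simp
  show "AE x in lborel. (\<lambda>i. jweight a b x * f i x) \<longlonglongrightarrow> jweight a b x * g x"
    using lim by (intro AE_I2) (auto simp: jweight_def intro!: tendsto_mult_left)
  show "AE x in lborel. norm (jweight a b x * f i x) \<le> jweight a b x * C" for i
    using C[of _ i] by (intro AE_I2) (auto simp: jweight_def abs_mult intro!: mult_left_mono)
qed measurable

text \<open>Each regularization step differentiates the product once, and the product rule puts that
  derivative on one of the two factors. After m steps the exponent exceeds -1 and dominated
  convergence applies.\<close>

lemma Lam_bnull: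
  "\<not> negint a \<Longrightarrow> a + real m > -1 \<Longrightarrow> b > -1 \<Longrightarrow> bnull m f \<Longrightarrow> bnull m g \<Longrightarrow>
    (\<lambda>i. Lam a b (f i * g i)) \<longlonglongrightarrow> 0"
proof (induction m arbitrary: a f g)
  case 0
  hence a: "a > -1" by simp
  obtain C where C: "\<And>i x. -1 < x \<Longrightarrow> x < 1 \<Longrightarrow> \<bar>poly (f i) x\<bar> \<le> C"
    using 0(4) unfolding bconv_def by auto
  obtain D where D: "\<And>i x. -1 < x \<Longrightarrow> x < 1 \<Longrightarrow> \<bar>poly (g i) x\<bar> \<le> D"
    using 0(5) unfolding bconv_def by auto
  have "(\<lambda>i. jint a b (poly (f i * g i))) \<longlonglongrightarrow> jint a b (\<lambda>_. 0)"
  proof (rule jint_limit[OF a 0(3), of _ _ "C * D"])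
    fix i x assume x: "-1 < (x::real)" "x < 1"
    have "\<bar>poly (f i) x\<bar> * \<bar>poly (g i) x\<bar> \<le> C * D"
      using C[OF x, of i] D[OF x, of i] by (intro mult_mono) (auto intro: order.trans[OF abs_ge_zero])
    thus "\<bar>poly (f i * g i) x\<bar> \<le> C * D" by (simp add: abs_mult)
  next
    fix x assume "-1 < (x::real)" "x < 1"
    thus "(\<lambda>i. poly (f i * g i) x) \<longlonglongrightarrow> 0"
      using 0(4,5) unfolding bconv_def by (auto intro!: tendsto_mult_zero)
  qed measurable
  thus ?case using a by (simp add: Lam_base jint_def)
next
  case (Suc m)
  define c where "c = 1 / (2 * (a + 1))"
  have E: "Eop a b (p * q) = psm (c * (a + b + 2)) (p * q) + (psm c (([:1,1:] * pderiv p) * q) + psm c (p * ([:1,1:] * pderiv q)))" for p q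
    unfolding Eop_def c_def[symmetric] by (rule poly_extI) (simp add: pderiv_expand algebra_simps)
  have a': "\<not> negint (a + 1)" "a + 1 + real m > -1" using Suc.prems negint_shift by auto
  have f: "bnull m f" "bnull m g" using Suc.prems by (auto intro: bconv_mono)
  have f': "bnull m (\<lambda>i. [:1,1:] * pderiv (f i))" "bnull m (\<lambda>i. [:1,1:] * pderiv (g i))"
    using Suc.prems(4,5) by (auto simp only: bconv_Suc_iff intro!: bnull_mult)
  have "(\<lambda>i. c * (a + b + 2) * Lam (a + 1) b (f i * g i) + (c * Lam (a + 1) b (([:1,1:] * pderiv (f i)) * g i)
      + c * Lam (a + 1) b (f i * ([:1,1:] * pderiv (g i))))) \<longlonglongrightarrow> c * (a + b + 2) * 0 + (c * 0 + c * 0)"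
    by (intro tendsto_add tendsto_mult_left Suc.IH a' Suc.prems(3) f f')
  moreover have "Lam a b (f i * g i) = c * (a + b + 2) * Lam (a + 1) b (f i * g i) + (c * Lam (a + 1) b (([:1,1:] * pderiv (f i)) * g i)
      + c * Lam (a + 1) b (f i * ([:1,1:] * pderiv (g i))))" for i
    unfolding Lam_step[OF Suc.prems(1,3), of "f i * g i"] E
    by (simp only: Lam_add[OF a'(1) Suc.prems(3)] Lam_smult[OF a'(1) Suc.prems(3)])
  ultimately show ?case by simp
qed

lemma pderiv_shift_prod_Lop:
  "pderiv (shift_prod (Lop a b) ms p) = shift_prod (Lop (a + 1) (b + 1)) (map (\<lambda>m. m - (a + b + 2)) ms) (pderiv p)"
  by (induction ms) (auto simp: pderiv_diff pderiv_Lop pderiv_smult smult_diff_left)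

text \<open>By \<open>Lam_Lop\<close> each operator factor costs one derivative of f and one of g
  and raises the exponent by one, so a + m stays constant. Hence m derivatives on each side serve
  both an operator of order up to 2m and the regularization.\<close>

lemma quadratic_form_bnull:
  "\<not> negint a \<Longrightarrow> a + real m > -1 \<Longrightarrow> b > -1 \<Longrightarrow> bnull m f \<Longrightarrow> bnull m g \<Longrightarrow> length ms \<le> m \<Longrightarrow>
    (\<lambda>i. Lam a b (shift_prod (Lop a b) ms (f i) * g i)) \<longlonglongrightarrow> 0"
proof (induction "length ms" arbitrary: ms a b m f g)
  case 0 thus ?case by (simp add: Lam_bnull)
next
  case (Suc k)
  obtain \<mu> ns where ms: "ms = \<mu> # ns" and k: "k = length ns" using Suc.hyps(2) by (cases ms) auto
  obtain n where m: "m = Suc n" using Suc.prems(6) ms by (cases m) auto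
  let ?F = "\<lambda>i. shift_prod (Lop a b) ns (f i)"
  have f: "bnull n (\<lambda>i. pderiv (f i))" "bnull n (\<lambda>i. pderiv (g i))"
    using Suc.prems(4,5) unfolding m bconv_Suc_iff by simp_all
  have "(\<lambda>i. Lam (a + 1) (b + 1) (pderiv (?F i) * pderiv (g i))) \<longlonglongrightarrow> 0"
    unfolding pderiv_shift_prod_Lop
    by (rule Suc.hyps(1)[OF _ negint_shift[OF Suc.prems(1)] _ _ f]) (use Suc.prems m ms k in auto)
  moreover have "(\<lambda>i. Lam a b (?F i * g i)) \<longlonglongrightarrow> 0"
    by (rule Suc.hyps(1)[OF k Suc.prems(1-5)]) (use Suc.prems ms in auto)
  ultimately have "(\<lambda>i. Lam (a + 1) (b + 1) (pderiv (?F i) * pderiv (g i)) - \<mu> * Lam a b (?F i * g i)) \<longlonglongrightarrow> 0 - \<mu> * 0"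
    by (intro tendsto_diff tendsto_mult_left)
  moreover have "Lam a b (shift_prod (Lop a b) ms (f i) * g i) = Lam (a + 1) (b + 1) (pderiv (?F i) * pderiv (g i)) - \<mu> * Lam a b (?F i * g i)" for i
    using Suc.prems(1,3) by (simp add: ms left_diff_distrib Lam_diff Lam_smult Lam_Lop)
  ultimately show ?case by simp
qed

section \<open>Hadamard finite parts to the right of the cut\<close>

text \<open>\<open>(1 - x) powr a * Dop a G\<close> is the derivative of \<open>- (1 - x) powr (a + 1) * G\<close>, so \<open>fpart x0 a z\<close> below is the Hadamard
  finite part of the integral of \<open>(1 - x) powr a * z\<close> over \<open>[x0, 1]\<close>.\<close>

definition Dop :: "real \<Rightarrow> real poly \<Rightarrow> real poly" where
  "Dop a G = psm (a + 1) G - [:1,-1:] * pderiv G"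

lemma coeff_Dop: "Polynomial.coeff (Dop a G) n = (a + 1 + real n) * Polynomial.coeff G n - real (Suc n) * Polynomial.coeff G (Suc n)"
  unfolding Dop_def by (cases n) (auto simp: coeff_pderiv algebra_simps)

text \<open>On monomials \<open>Dop\<close> is triangular with diagonal a + 1 + n, non-zero for
  regular a. So it is a bijection, and the primitive chosen in \<open>fpart\<close> is
  unique.\<close>

lemma Dop_inj:
  assumes "\<not> negint a" "Dop a G = Dop a H"
  shows "G = H"
proof (rule ccontr)
  assume "G \<noteq> H"
  define K where "K = G - H"
  have "Dop a K = Dop a G - Dop a H"
    by (rule poly_extI) (simp add: Dop_def K_def pderiv_expand algebra_simps)
  hence K: "K \<noteq> 0" "Dop a K = 0" using \<open>G \<noteq> H\<close> assms(2) unfolding K_def by simp_all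
  have "a + 1 + real (Polynomial.degree K) \<noteq> 0" 
  proof
    assume "a + 1 + real (Polynomial.degree K) = 0"
    hence "a = - real (Suc (Polynomial.degree K))" by simp
    thus False using assms(1) unfolding negint_def by (metis le_add1 plus_1_eq_Suc)
  qed
  moreover have "Polynomial.coeff (Dop a K) (Polynomial.degree K) = 0" using K by simp
  ultimately show False using K(1) unfolding coeff_Dop by (simp add: coeff_eq_0)
qed

lemma Dop_surj:
  assumes "\<not> negint a"
  shows "\<exists>G. Dop a G = z"
proof -
  have "\<exists>G. Dop a G = z" if "Polynomial.degree z < n" for n
    using that
  proof (induction n arbitrary: z)
    case (Suc n)
    have nz: "a + 1 + real n \<noteq> 0"
    proof
      assume "a + 1 + real n = 0"
      hence "a = - real (Suc n)" by simp
      thus False using assms(1) unfolding negint_def by (metis le_add1 plus_1_eq_Suc)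
    qed
    define M where "M = Polynomial.monom (Polynomial.coeff z n / (a + 1 + real n)) n"
    have c: "Polynomial.coeff (z - Dop a M) i = 0" if "i \<ge> n" for i
      using that Suc.prems nz unfolding coeff_diff coeff_Dop M_def by (auto simp: coeff_eq_0)
    show ?case
    proof (cases "z - Dop a M = 0")
      case True thus ?thesis by (metis right_minus_eq)
    next
      case False
      hence "Polynomial.degree (z - Dop a M) < n" using c[of "Polynomial.degree (z - Dop a M)"]
        by (metis leading_coeff_0_iff not_le)
      then obtain G where "Dop a G = z - Dop a M" using Suc.IH by blast
      moreover have "Dop a (G + M) = Dop a G + Dop a M"
        by (rule poly_extI) (simp add: Dop_def pderiv_expand algebra_simps)
      ultimately have "Dop a (G + M) = z" by simp
      thus ?thesis by blast
    qed
  qed simp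
  thus ?thesis by blast
qed

definition fpart :: "real \<Rightarrow> real \<Rightarrow> real poly \<Rightarrow> real" where
  "fpart x0 a z = (1 - x0) powr (a + 1) * poly (THE G. Dop a G = z) x0"

lemma fpart_Dop: "\<not> negint a \<Longrightarrow> fpart x0 a (Dop a G) = (1 - x0) powr (a + 1) * poly G x0"
  unfolding fpart_def using Dop_inj the_equality[of "\<lambda>H. Dop a H = Dop a G" G] by auto

lemma fpart_add: "\<not> negint a \<Longrightarrow> fpart x0 a (y + z) = fpart x0 a y + fpart x0 a z"
proof -
  assume a: "\<not> negint a"
  obtain G H where GH: "y = Dop a G" "z = Dop a H" using Dop_surj[OF a] by metis
  have "Dop a G + Dop a H = Dop a (G + H)"
    by (rule poly_extI) (simp add: Dop_def pderiv_expand algebra_simps)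
  thus ?thesis unfolding GH by (simp add: fpart_Dop[OF a] distrib_left)
qed

lemma fpart_smult: "\<not> negint a \<Longrightarrow> fpart x0 a (psm c z) = c * fpart x0 a z"
proof -
  assume a: "\<not> negint a"
  obtain G where G: "z = Dop a G" using Dop_surj[OF a] by metis
  have "psm c (Dop a G) = Dop a (psm c G)"
    by (rule poly_extI) (simp add: Dop_def pderiv_expand algebra_simps)
  thus ?thesis unfolding G by (simp add: fpart_Dop[OF a])
qed

lemma fpart_diff: "\<not> negint a \<Longrightarrow> fpart x0 a (y - z) = fpart x0 a y - fpart x0 a z"
  using fpart_add[of a x0 y "psm (-1) z"] fpart_smult[of a x0 "-1" z] by simp

lemma fpart_one_minus:
  assumes "\<not> negint a" "x0 < 1"
  shows "fpart x0 a ([:1,-1:] * z) = fpart x0 (a + 1) z"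
proof -
  obtain G where G: "z = Dop (a + 1) G" using Dop_surj[OF negint_shift[OF assms(1)]] by metis
  have "[:1,-1:] * z = Dop a ([:1,-1:] * G)" unfolding G
    by (rule poly_extI) (simp add: Dop_def pderiv_expand algebra_simps)
  hence "fpart x0 a ([:1,-1:] * z) = (1 - x0) powr (a + 1) * poly ([:1,-1:] * G) x0"
    using fpart_Dop[OF assms(1)] by metis
  also have "\<dots> = (1 - x0) powr (a + 1 + 1) * poly G x0" 
    using assms(2) powr_add[of "1 - x0" "a + 1" 1] by (simp add: left_diff_distrib)
  finally show ?thesis unfolding G fpart_Dop[OF negint_shift[OF assms(1)]] .
qed

text \<open>The second exponent is 0 because the factor (1 + x)^b of the weight cancels against the
  (1 + x)^(-b) carried by the cut function.\<close>

lemma fpart_integral: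
  assumes "a > -1" "-1 < x0" "x0 < 1"
  shows "jint a 0 (\<lambda>x. if x \<le> x0 then 0 else poly z x) = fpart x0 a z"
proof -
  have a: "\<not> negint a" using assms(1) unfolding negint_def by auto
  obtain G where G: "z = Dop a G" using Dop_surj[OF a] by metis
  define F where "F = (\<lambda>x. - ((1 - x) powr (a + 1) * poly G x))"
  have "((\<lambda>x. (1 - x) powr a * poly z x) has_integral (F 1 - F x0)) {x0..1}"
  proof (rule fundamental_theorem_of_calculus_interior)
    show "continuous_on {x0..1} F" unfolding F_def using assms
      by (intro continuous_on_minus continuous_on_mult continuous_on_powr' continuous_intros) auto
    fix x :: real assume x: "x \<in> {x0<..<1}"
    have "(F has_real_derivative
        (- (- ((a + 1) * (1 - x) powr a) * poly G x + (1 - x) powr (a + 1) * poly (pderiv G) x))) (at x)"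
      unfolding F_def using x by (auto intro!: derivative_eq_intros poly_DERIV)
    also have "(- (- ((a + 1) * (1 - x) powr a) * poly G x + (1 - x) powr (a + 1) * poly (pderiv G) x)) = (1 - x) powr a * poly z x"
      using x unfolding G Dop_def by (simp add: powr_add) (simp add: algebra_simps)
    finally show "(F has_vector_derivative (1 - x) powr a * poly z x) (at x)"
      by (simp add: has_real_derivative_iff_has_vector_derivative)
  qed (use assms in simp)
  moreover have "F 1 - F x0 = fpart x0 a z" unfolding F_def G fpart_Dop[OF a] using assms by simp
  ultimately have J: "((\<lambda>x. if x \<in> {x0..1} then (1 - x) powr a * poly z x else 0) has_integral fpart x0 a z) UNIV"
    by (subst has_integral_restrict_UNIV) simp
  have I: "((\<lambda>x. jweight a 0 x * (if x \<le> x0 then 0 else poly z x)) has_integral fpart x0 a z) UNIV"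
    by (rule has_integral_spike[OF _ _ J, of "{x0, 1}"]) (use assms in \<open>auto simp: jweight_def\<close>)
  obtain C where C: "\<forall>x\<in>{-1..1}. \<bar>poly z x\<bar> \<le> C" using poly_bounded by blast
  have "integrable lborel (\<lambda>x. jweight a 0 x * (if x \<le> x0 then 0 else poly z x))"
  proof (rule integrable_jweight_bounded[OF assms(1), of 0 _ C])
    have "C \<ge> 0" using bspec[OF C, of 0] by auto
    fix x :: real assume "-1 < x" "x < 1"
    thus "\<bar>if x \<le> x0 then 0 else poly z x\<bar> \<le> C" using C \<open>C \<ge> 0\<close> by auto
  qed simp_all
  from has_integral_integral_lborel[OF this] I show ?thesis unfolding jint_def by (rule has_integral_unique)
qed

text \<open>The \<open>l\<close>-th derivative of the function that is \<open>0\<close> up to \<open>x0\<close> and \<open>(1 + x) powr (- b) * y\<close> beyond.\<close>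

definition cut_deriv :: "real \<Rightarrow> real \<Rightarrow> real poly \<Rightarrow> nat \<Rightarrow> real \<Rightarrow> real" where
  "cut_deriv x0 b y l x = (if x \<le> x0 then 0 else (1 + x) powr (- b - real l) * poly (twist_deriv b l y) x)"

lemma twist_deriv_shift: "twist_deriv (b + 1) l (twist_deriv b 1 y) = twist_deriv b (Suc l) y"
  by (induction l) (simp_all add: add_ac)

lemma cut_deriv_shift: "cut_deriv x0 (b + 1) (twist_deriv b 1 y) l = cut_deriv x0 b y (Suc l)"
proof -
  have "- (b + 1) - real l = - b - real (Suc l)" by simp
  thus ?thesis unfolding cut_deriv_def twist_deriv_shift by (simp only:)
qed

lemma power_dvd_root: "[:-x0,1:] ^ Suc n dvd (p :: real poly) \<Longrightarrow> poly p x0 = 0"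
  unfolding poly_eq_0_iff_dvd power_Suc by (rule dvd_mult_left)

lemma twist_deriv_order:
  "[:-x0,1:] ^ (n + j) dvd y \<Longrightarrow> [:-x0,1:] ^ n dvd twist_deriv b j y"
proof (induction j arbitrary: n)
  case (Suc j)
  have *: "[:-x0,1:] ^ Suc n dvd twist_deriv b j y" using Suc.IH[of "Suc n"] Suc.prems by (simp del: power_Suc)
  hence "[:-x0,1:] ^ n dvd twist_deriv b j y" by (metis dvd_mult_right power_Suc)
  moreover have "[:-x0,1:] ^ n dvd pderiv (twist_deriv b j y)" using * by (rule power_dvd_pderiv)
  ultimately show ?case unfolding twist_deriv.simps by (intro dvd_diff dvd_smult dvd_mult)
qed simp

lemma Nop_mult: "p * Nop a b h = Nop a b (p * h) - [:1,-1:] * ([:1,1:] * (pderiv p * h))"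
  by (rule poly_extI) (simp add: Nop_def pderiv_expand algebra_simps)

text \<open>For a <= -1 the integrand has no integrable bound, so the fixed factor s is split into a
  total derivative and a multiple of 1 - x. Both parts raise the exponent, the first at the price of
  one derivative of \<open>q i\<close>. On the limit side the same integration by parts has a
  boundary term at x0, which the zero of y removes.\<close>

lemma Lam_limit_fpart:
  assumes "-1 < x0" "x0 < 1"
  shows "\<not> negint a \<Longrightarrow> a + real m > -1 \<Longrightarrow> b > -1 \<Longrightarrow> [:-x0,1:] ^ m dvd y \<Longrightarrow> bconv m (cut_deriv x0 b y) q \<Longrightarrow>
    (\<lambda>i. Lam a b (q i * s)) \<longlonglongrightarrow> fpart x0 a (y * s)"
proof (induction m arbitrary: a b y q s)
  case 0
  hence a: "a > -1" by simp
  obtain C where C: "\<And>i x. -1 < x \<Longrightarrow> x < 1 \<Longrightarrow> \<bar>poly (q i) x\<bar> \<le> C"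
    using 0 unfolding bconv_def by auto
  obtain D where D: "\<forall>x\<in>{-1..1}. \<bar>poly s x\<bar> \<le> D" using poly_bounded by blast
  have D0: "D \<ge> 0" using bspec[OF D, of 0] by auto
  have "(\<lambda>i. jint a b (poly (q i * s))) \<longlonglongrightarrow> jint a b (\<lambda>x. cut_deriv x0 b y 0 x * poly s x)"
  proof (rule jint_limit[OF a 0(3), of _ _ "C * D"])
    show "(\<lambda>x. cut_deriv x0 b y 0 x * poly s x) \<in> borel_measurable borel"
      unfolding cut_deriv_def by measurable
    fix i x assume x: "-1 < (x::real)" "x < 1"
    have "\<bar>poly (q i) x\<bar> * \<bar>poly s x\<bar> \<le> C * D"
      using C[OF x, of i] D x D0 by (intro mult_mono) (auto intro: order.trans[OF abs_ge_zero])
    thus "\<bar>poly (q i * s) x\<bar> \<le> C * D" by (simp add: abs_mult)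
  next
    fix x assume "-1 < (x::real)" "x < 1"
    thus "(\<lambda>i. poly (q i * s) x) \<longlonglongrightarrow> cut_deriv x0 b y 0 x * poly s x"
      using 0(5) unfolding bconv_def by (auto intro!: tendsto_mult_right)
  qed measurable
  also have "jint a b (\<lambda>x. cut_deriv x0 b y 0 x * poly s x) = jint a 0 (\<lambda>x. if x \<le> x0 then 0 else poly (y * s) x)"
    unfolding jint_def
    by (intro Bochner_Integration.integral_cong refl) (auto simp: jweight_def cut_deriv_def powr_minus)
  also have "\<dots> = fpart x0 a (y * s)" by (rule fpart_integral[OF a assms])
  finally show ?case unfolding Lam_base[OF a] .
next
  case (Suc m)
  have a': "\<not> negint (a + 1)" "a + 1 + real m > -1" "b + 1 > -1" "a \<noteq> -1"
    using Suc.prems negint_shift negint_not_minus1 by auto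
  \<comment> \<open>At 1 the value of \<open>Nop a b [:c:]\<close> is -2(a + 1)c, so this choice
    makes it agree with s there.\<close>
  define c where "c = - poly s 1 / (2 * (a + 1))"
  have "2 * (a + 1) * c = - poly s 1" using a'(4) unfolding c_def by simp
  hence "poly (s - Nop a b [:c:]) 1 = 0" unfolding Nop_def by (simp add: algebra_simps)
  then obtain t where t: "s - Nop a b [:c:] = [:-1,1:] * t" unfolding poly_eq_0_iff_dvd by (elim dvdE)
  define s1 where "s1 = - t"
  have "s = Nop a b [:c:] + [:-1,1:] * t" unfolding t[symmetric] by simp
  also have "[:-1,1:] * t = [:1,-1:] * s1" unfolding s1_def by (rule poly_extI) (simp add: algebra_simps)
  finally have s: "s = Nop a b [:c:] + [:1,-1:] * s1" .
  define y1 where "y1 = twist_deriv b 1 y"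
  have q': "bconv m (cut_deriv x0 (b + 1) y1) (\<lambda>i. pderiv (q i))"
    using Suc.prems(5) unfolding bconv_Suc_iff y1_def cut_deriv_shift by simp
  have ord: "[:-x0,1:] ^ m dvd y1" unfolding y1_def using Suc.prems(4) by (intro twist_deriv_order) simp
  have q0: "bconv m (cut_deriv x0 b y) q" using Suc.prems(5) by (rule bconv_mono) simp
  have ord0: "[:-x0,1:] ^ m dvd y" using Suc.prems(4) by (metis dvd_mult_right power_Suc)
  have "(\<lambda>i. - Lam (a + 1) (b + 1) (pderiv (q i) * [:c:]) + Lam (a + 1) b (q i * s1)) \<longlonglongrightarrow>
      - fpart x0 (a + 1) (y1 * [:c:]) + fpart x0 (a + 1) (y * s1)"
    by (intro tendsto_add tendsto_minus Suc.IH a' Suc.prems(3) ord ord0 q' q0)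
  moreover have "Lam a b (q i * s) = - Lam (a + 1) (b + 1) (pderiv (q i) * [:c:]) + Lam (a + 1) b (q i * s1)" for i
  proof -
    have "q i * s = Nop a b (q i * [:c:]) - [:1,-1:] * ([:1,1:] * (pderiv (q i) * [:c:])) + [:1,-1:] * (q i * s1)"
      unfolding s distrib_left Nop_mult by (simp only: mult.left_commute)
    thus ?thesis
      by (simp only: Lam_add[OF Suc.prems(1,3)] Lam_diff[OF Suc.prems(1,3)] Lam_Nop[OF Suc.prems(1,3)]
        Lam_one_minus[OF Suc.prems(1,3)] Lam_one_plus[OF a'(1) Suc.prems(3)])
  qed
  moreover have "- fpart x0 (a + 1) (y1 * [:c:]) + fpart x0 (a + 1) (y * s1) = fpart x0 a (y * s)"
  proof -
    have y0: "poly y x0 = 0" using Suc.prems(4) by (rule power_dvd_root)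
    have "y * s = [:1,-1:] * (y * s1 - y1 * [:c:]) - psm c (Dop a ([:1,1:] * y))"
      unfolding s y1_def by (rule poly_extI) (simp add: Dop_def Nop_def pderiv_expand algebra_simps)
    hence "fpart x0 a (y * s) = fpart x0 (a + 1) (y * s1 - y1 * [:c:])"
      using fpart_Dop[OF Suc.prems(1), of x0 "[:1,1:] * y"] y0
      by (simp only: fpart_diff[OF Suc.prems(1)] fpart_smult[OF Suc.prems(1)] fpart_one_minus[OF Suc.prems(1) assms(2)]) simp
    thus ?thesis by (simp only: fpart_diff[OF a'(1)])
  qed
  ultimately show ?case by simp
qed

section \<open>Green's formula with boundary terms at the cut\<close>

definition jets_null :: "real \<Rightarrow> nat \<Rightarrow> (nat \<Rightarrow> real poly) \<Rightarrow> bool" where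
  "jets_null x0 n q \<longleftrightarrow> (\<forall>l<n. (\<lambda>i. poly ((pderiv ^^ l) (q i)) x0) \<longlonglongrightarrow> 0)"

lemma jets_null_Suc: "jets_null x0 (Suc n) q \<longleftrightarrow> (\<lambda>i. poly (q i) x0) \<longlonglongrightarrow> 0 \<and> jets_null x0 n (\<lambda>i. pderiv (q i))"
proof -
  have e: "(pderiv ^^ l) (pderiv p) = (pderiv ^^ Suc l) p" for l and p :: "real poly"
    by (simp add: funpow_swap1)
  have "(\<forall>l<Suc n. Q l) \<longleftrightarrow> Q 0 \<and> (\<forall>l<n. Q (Suc l))" for Q
    by (metis Suc_less_eq zero_less_Suc not0_implies_Suc)
  thus ?thesis unfolding jets_null_def e by simp
qed

lemma jets_null_mono: "jets_null x0 n q \<Longrightarrow> m \<le> n \<Longrightarrow> jets_null x0 m q"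
  unfolding jets_null_def by auto

lemma jets_null_add: "jets_null x0 n f \<Longrightarrow> jets_null x0 n g \<Longrightarrow> jets_null x0 n (\<lambda>i. f i + g i)"
  unfolding jets_null_def by (auto simp: higher_pderiv_add intro!: tendsto_add_zero)

lemma jets_null_mult: "jets_null x0 n f \<Longrightarrow> jets_null x0 n (\<lambda>i. p * f i)"
proof (induction n arbitrary: f p)
  case 0 thus ?case by (simp add: jets_null_def)
next
  case (Suc n)
  have f: "jets_null x0 n f" "jets_null x0 n (\<lambda>i. pderiv (f i))" "(\<lambda>i. poly (f i) x0) \<longlonglongrightarrow> 0"
    using Suc.prems jets_null_mono[OF Suc.prems, of n] unfolding jets_null_Suc by auto
  have "jets_null x0 n (\<lambda>i. pderiv (p * f i))"
    unfolding pderiv_mult using jets_null_add[OF Suc.IH[OF f(2), of p] Suc.IH[OF f(1), of "pderiv p"]]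
    by (simp add: mult.commute add.commute)
  thus ?case unfolding jets_null_Suc using f(3) by (simp add: tendsto_mult_right_zero)
qed

lemma jets_null_Lop: "jets_null x0 (Suc (Suc n)) q \<Longrightarrow> jets_null x0 n (\<lambda>i. Lop a b (q i))"
proof -
  assume q: "jets_null x0 (Suc (Suc n)) q"
  have q2: "jets_null x0 n (\<lambda>i. pderiv (pderiv (q i)))" and q1: "jets_null x0 (Suc n) (\<lambda>i. pderiv (q i))"
    using q by (simp_all add: jets_null_Suc)
  have "jets_null x0 n (\<lambda>i. - ([:1,-1:] * [:1,1:]) * pderiv (pderiv (q i)) + [:a - b, a + b + 2:] * pderiv (q i))"
    by (intro jets_null_add jets_null_mult q2) (rule jets_null_mono[OF q1], simp)
  moreover have "- ([:1,-1:] * [:1,1:]) * pderiv (pderiv p) + [:a - b, a + b + 2:] * pderiv p = Lop a b p" for p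
    by (rule poly_extI) (simp add: Lop_def Nop_def algebra_simps)
  ultimately show ?thesis by (simp only:)
qed

lemma jets_null_shift_prod:
  "jets_null x0 (n + 2 * length ms) q \<Longrightarrow> jets_null x0 n (\<lambda>i. shift_prod (Lop a b) ms (q i))"
proof (induction ms arbitrary: n)
  case (Cons m ms)
  have *: "jets_null x0 (Suc (Suc n)) (\<lambda>i. shift_prod (Lop a b) ms (q i))" using Cons by simp
  hence "jets_null x0 n (\<lambda>i. [:-m:] * shift_prod (Lop a b) ms (q i))"
    by (intro jets_null_mult) (rule jets_null_mono[of _ "Suc (Suc n)"], simp_all)
  hence "jets_null x0 n (\<lambda>i. Lop a b (shift_prod (Lop a b) ms (q i)) + [:-m:] * shift_prod (Lop a b) ms (q i))"
    by (intro jets_null_add jets_null_Lop *)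
  moreover have "Lop a b p + [:-m:] * p = Lop a b p - psm m p" for p
    by simp
  ultimately show ?case by (simp only: shift_prod.simps)
qed simp

text \<open>At a general point both first-order factors cost an order, unlike in
  \<open>conjLop_order\<close>.\<close>

lemma conjLop_order2:
  assumes "[:-x0,1:] ^ (n + 2) dvd p"
  shows "[:-x0,1:] ^ n dvd conjLop a b p"
proof -
  define y where "y = [:1,1:] * pderiv p - psm b p"
  have "[:-x0,1:] ^ Suc n dvd pderiv p" using assms by (intro power_dvd_pderiv) simp
  moreover have "[:-x0,1:] ^ Suc n dvd p" using assms by (rule power_le_dvd) simp
  ultimately have *: "[:-x0,1:] ^ Suc n dvd y" unfolding y_def by (intro dvd_diff dvd_smult dvd_mult)
  hence "[:-x0,1:] ^ n dvd y" by (metis dvd_mult_right power_Suc)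
  thus ?thesis using power_dvd_pderiv[OF *] unfolding conjLop_def Let_def y_def[symmetric]
    by (intro dvd_diff dvd_smult dvd_mult)
qed

text \<open>Here p stands for (1 + x)^(-b) p tested against the full weight, so the adjoint is
  \<open>conjLop\<close>. A finite part has no boundary contribution at 1, only at x0.\<close>

lemma fpart_green:
  assumes "\<not> negint a"
  shows "fpart x0 a (p * Lop a b r) = fpart x0 a (conjLop a b p * r) +
    (1 - x0) powr (a + 1) * ((1 + x0) * poly p x0 * poly (pderiv r) x0
      - ((1 + x0) * poly (pderiv p) x0 - b * poly p x0) * poly r x0)"
proof -
  have "p * Lop a b r = conjLop a b p * r + Dop a (p * ([:1,1:] * pderiv r) - ([:1,1:] * pderiv p - psm b p) * r)"
    by (rule poly_extI) (simp add: conjLop_def Let_def Lop_def Nop_def Dop_def pderiv_expand algebra_simps)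
  thus ?thesis unfolding fpart_add[OF assms] fpart_Dop[OF assms] by (simp add: fpart_add[OF assms] fpart_Dop[OF assms] algebra_simps)
qed

text \<open>Operators move from q to p one at a time, outermost first, hence \<open>rev\<close>.
  Each move costs p two orders at x0 and leaves q with two derivatives fewer; the budget 2
  \<open>length ms\<close> <= k + e ensures that every boundary term has a factor that is zero or
  tends to zero.\<close>

lemma fpart_shift_prod_limit:
  assumes a: "\<not> negint a" and q: "jets_null x0 k q"
  shows "[:-x0,1:] ^ e dvd p \<Longrightarrow> 2 * length ms \<le> k + e \<Longrightarrow>
    (\<lambda>i. fpart x0 a (p * shift_prod (Lop a b) ms (q i)) - fpart x0 a (shift_prod (conjLop a b) (rev ms) p * q i)) \<longlonglongrightarrow> 0"
proof (induction ms arbitrary: p e)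
  case (Cons m ms)
  define B where "B = (\<lambda>i. shift_prod (Lop a b) ms (q i))"
  define p' where "p' = conjLop a b p - psm m p"
  define bd where "bd = (\<lambda>i. (1 - x0) powr (a + 1) * ((1 + x0) * poly p x0 * poly (pderiv (B i)) x0
      - ((1 + x0) * poly (pderiv p) x0 - b * poly p x0) * poly (B i) x0))"
  have step: "fpart x0 a (p * shift_prod (Lop a b) (m # ms) (q i)) = fpart x0 a (p' * B i) + bd i" for i
  proof -
    have "p * shift_prod (Lop a b) (m # ms) (q i) = p * Lop a b (B i) - psm m (p * B i)"
      by (simp add: B_def algebra_simps)
    moreover have "p' * B i = conjLop a b p * B i - psm m (p * B i)"
      by (simp add: p'_def algebra_simps)
    ultimately show ?thesis
      by (simp only: fpart_diff[OF a] fpart_smult[OF a] fpart_green[OF a] bd_def)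
  qed
  have p'_ord: "[:-x0,1:] ^ (e - 2) dvd p'"
  proof (cases "e \<ge> 2")
    case True
    then obtain n where e: "e = n + 2" by (metis le_add_diff_inverse2)
    have "[:-x0,1:] ^ n dvd p" using Cons.prems(1) by (rule power_le_dvd) (simp add: e)
    moreover have "[:-x0,1:] ^ n dvd conjLop a b p" using Cons.prems(1) unfolding e by (rule conjLop_order2)
    ultimately show ?thesis unfolding p'_def e by (simp del: power_Suc add: dvd_diff dvd_smult)
  next
    case False
    hence "e - 2 = 0" by simp
    thus ?thesis by simp
  qed
  have lims: "jets_null x0 n B" if "n + 2 * length ms \<le> k" for n
    unfolding B_def by (rule jets_null_shift_prod) (rule jets_null_mono[OF q that])
  have bd: "bd \<longlonglongrightarrow> 0"
  proof -
    \<comment> \<open>With e >= 2 both coefficients of the boundary term vanish; with e = 1 only the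
      value of \<open>B i\<close> survives and must tend to zero; with e = 0 its derivative must as
      well.\<close>
    consider "e \<ge> 2" | "e = 1" | "e = 0" by linarith
    thus ?thesis
    proof cases
      case 1
      then obtain n where e: "e = Suc (Suc n)" by (metis Suc_le_D numeral_2_eq_2 Suc_le_mono)
      have "[:-x0,1:] ^ Suc n dvd pderiv p" using Cons.prems(1) unfolding e by (rule power_dvd_pderiv)
      hence "poly (pderiv p) x0 = 0" by (rule power_dvd_root)
      moreover have "poly p x0 = 0" using Cons.prems(1) unfolding e by (rule power_dvd_root)
      ultimately show ?thesis unfolding bd_def by simp
    next
      case 2
      have "poly p x0 = 0" using Cons.prems(1) unfolding 2 by (intro power_dvd_root[of _ 0]) simp
      moreover have "jets_null x0 (Suc 0) B" using Cons.prems(2) 2 by (intro lims) simp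
      hence "(\<lambda>i. poly (B i) x0) \<longlonglongrightarrow> 0" by (simp add: jets_null_Suc)
      moreover have "(\<lambda>i. - ((1 - x0) powr (a + 1) * ((1 + x0) * poly (pderiv p) x0)) * poly (B i) x0) \<longlonglongrightarrow> 0"
        if "(\<lambda>i. poly (B i) x0) \<longlonglongrightarrow> 0" using that by (rule tendsto_mult_right_zero)
      ultimately show ?thesis unfolding bd_def by (simp add: mult.assoc)
    next
      case 3
      have "jets_null x0 (Suc (Suc 0)) B" using Cons.prems(2) 3 by (intro lims) simp
      hence "(\<lambda>i. poly (B i) x0) \<longlonglongrightarrow> 0" "(\<lambda>i. poly (pderiv (B i)) x0) \<longlonglongrightarrow> 0" by (simp_all add: jets_null_Suc)
      hence "bd \<longlonglongrightarrow> (1 - x0) powr (a + 1) * ((1 + x0) * poly p x0 * 0 - ((1 + x0) * poly (pderiv p) x0 - b * poly p x0) * 0)"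
        unfolding bd_def by (intro tendsto_intros)
      thus ?thesis by simp
    qed
  qed
  have r: "shift_prod (conjLop a b) (rev (m # ms)) p = shift_prod (conjLop a b) (rev ms) p'"
    by (simp add: shift_prod_append p'_def)
  have "(\<lambda>i. fpart x0 a (p' * B i) - fpart x0 a (shift_prod (conjLop a b) (rev ms) p' * q i)) \<longlonglongrightarrow> 0"
    unfolding B_def using Cons.prems by (intro Cons.IH[OF p'_ord]) auto
  from tendsto_add[OF this bd] show ?case unfolding step r by (simp add: algebra_simps)
qed simp

section \<open>Approximation of the cut function\<close>

lemma weierstrass_poly:
  fixes g :: "real \<Rightarrow> real"
  assumes "continuous_on {-1..1} g" "e > 0"
  shows "\<exists>p. \<forall>x\<in>{-1..1}. \<bar>g x - poly p x\<bar> < e"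
proof -
  obtain f where f: "real_polynomial_function f" "\<And>x. x \<in> {-1..1} \<Longrightarrow> \<bar>g x - f x\<bar> < e"
    using Stone_Weierstrass_real_polynomial_function[OF _ assms] by auto
  then obtain a n where "f = (\<lambda>x. \<Sum>i\<le>n. a i * x ^ i)" unfolding real_polynomial_function_iff_sum by blast
  hence "f = poly (\<Sum>i\<le>n. Polynomial.monom (a i) i)" by (simp add: fun_eq_iff poly_sum poly_monom)
  thus ?thesis using f(2) by blast
qed

lemma poly_antiderivative: "\<exists>P. pderiv P = (p :: real poly) \<and> poly P x0 = 0"
proof -
  define P where "P = (\<Sum>i\<le>Polynomial.degree p. Polynomial.monom (Polynomial.coeff p i / real (Suc i)) (Suc i))"
  have "pderiv P = (\<Sum>i\<le>Polynomial.degree p. Polynomial.monom (Polynomial.coeff p i) i)"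
    unfolding P_def pderiv_sum by (rule sum.cong) (simp_all add: pderiv_monom del: of_nat_Suc)
  hence "pderiv P = p" by (simp add: poly_as_sum_of_monoms)
  hence "pderiv (P - [:poly P x0:]) = p \<and> poly (P - [:poly P x0:]) x0 = 0" by (simp add: pderiv_diff pderiv_pCons)
  thus ?thesis by blast
qed

text \<open>Lets the approximants be prescribed through their k-th derivative while keeping exact
  zeros of order k at the cut.\<close>

lemma poly_iterated_antiderivative:
  "\<exists>Q. (pderiv ^^ k) Q = (p :: real poly) \<and> (\<forall>l<k. poly ((pderiv ^^ l) Q) x0 = 0)"
proof (induction k)
  case (Suc k)
  then obtain Q where Q: "(pderiv ^^ k) Q = p" "\<forall>l<k. poly ((pderiv ^^ l) Q) x0 = 0" by blast
  obtain P where P: "pderiv P = Q" "poly P x0 = 0" using poly_antiderivative by blast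
  have e: "(pderiv ^^ Suc l) P = (pderiv ^^ l) Q" for l by (simp add: funpow_swap1 P)
  have "poly ((pderiv ^^ l) P) x0 = 0" if "l < Suc k" for l
    using that P(2) Q(2) e by (cases l) (auto simp del: funpow.simps(2))
  thus ?case using e[of k] Q(1) by metis
qed simp

lemma cut_deriv_has_derivative:
  assumes "-1 < x"
  shows "((\<lambda>x. (1 + x) powr (- b - real l) * poly (twist_deriv b l y) x) has_real_derivative
     (1 + x) powr (- b - real (Suc l)) * poly (twist_deriv b (Suc l) y) x) (at x)"
proof -
  have e: "- b - real l = (- b - real (Suc l)) + 1" by simp
  have p: "(1 + x) powr (- b - real l) = (1 + x) powr (- b - real (Suc l)) * (1 + x)"
    unfolding e powr_add using assms by simp
  have "((\<lambda>x. (1 + x) powr (- b - real l) * poly (twist_deriv b l y) x) has_real_derivative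
     ((- b - real l) * (1 + x) powr (- b - real l - 1)) * poly (twist_deriv b l y) x
     + (1 + x) powr (- b - real l) * poly (pderiv (twist_deriv b l y)) x) (at x)"
    using assms by (auto intro!: derivative_eq_intros poly_DERIV)
  also have "((- b - real l) * (1 + x) powr (- b - real l - 1)) * poly (twist_deriv b l y) x
     + (1 + x) powr (- b - real l) * poly (pderiv (twist_deriv b l y)) x
     = (1 + x) powr (- b - real (Suc l)) * poly (twist_deriv b (Suc l) y) x"
  proof -
    have "- b - real l - 1 = - b - real (Suc l)" by simp
    thus ?thesis unfolding p twist_deriv.simps by (simp only:) (simp add: algebra_simps)
  qed
  finally show ?thesis .
qed

text \<open>The ramp factor makes the approximants vanish at the cut, so that they converge at every point.\<close>

lemma cut_deriv_top_approx:
  assumes x0: "-1 < x0" "x0 < 1"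
  shows "\<exists>g C. (\<forall>i::nat. \<forall>x\<in>{-1..1}. \<bar>poly (g i) x\<bar> \<le> C) \<and>
    (\<forall>x\<in>{-1..1}. (\<lambda>i. poly (g i) x) \<longlonglongrightarrow> cut_deriv x0 b y k x)"
proof -
  \<comment> \<open>\<open>max\<close> keeps the base of the power away from 0, which makes
    \<open>u\<close> continuous at -1; left of x0 its values are multiplied by 0.\<close>
  define u where "u = (\<lambda>x. (1 + max x x0) powr (- b - real k) * poly (twist_deriv b k y) x)"
  define r where "r = (\<lambda>(i::nat) x. min 1 (max 0 (real i * (x - x0))))"
  have cu: "continuous_on {-1..1} u" unfolding u_def using x0
    by (intro continuous_intros) auto
  have cr: "continuous_on {-1..1} (\<lambda>x. u x * r i x)" for i unfolding r_def
    by (intro continuous_intros cu)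
  have "\<exists>p. \<forall>x\<in>{-1..1}. \<bar>u x * r i x - poly p x\<bar> < 1 / real (Suc i)" for i
    by (rule weierstrass_poly[OF cr]) simp
  then obtain g where g: "\<And>i x. x \<in> {-1..1} \<Longrightarrow> \<bar>u x * r i x - poly (g i) x\<bar> < 1 / real (Suc i)"
    by metis
  have "compact (u ` {-1..1})" by (intro compact_continuous_image cu) simp
  hence "bounded (u ` {-1..1})" by (rule compact_imp_bounded)
  then obtain D where "\<forall>x\<in>{-1..1}. \<bar>u x\<bar> \<le> D" unfolding bounded_iff by auto
  hence D: "\<And>x. x \<in> {-1..1} \<Longrightarrow> \<bar>u x\<bar> \<le> D" by blast
  have r01: "0 \<le> r i x" "r i x \<le> 1" for i x unfolding r_def by auto
  have "\<bar>poly (g i) x\<bar> \<le> D + 1" if x: "x \<in> {-1..1}" for i x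
  proof -
    have "\<bar>u x * r i x\<bar> \<le> D * 1" unfolding abs_mult using D[OF x] r01[of i x]
      by (intro mult_mono) (auto intro: order.trans[OF abs_ge_zero])
    moreover have "1 / real (Suc i) \<le> 1" by simp
    ultimately show ?thesis using g[OF x, of i] by linarith
  qed
  moreover have "(\<lambda>i. poly (g i) x) \<longlonglongrightarrow> cut_deriv x0 b y k x" if x: "x \<in> {-1..1}" for x
  proof -
    have "(\<lambda>i. u x * r i x) \<longlonglongrightarrow> cut_deriv x0 b y k x"
    proof (cases "x \<le> x0")
      case True
      have "real i * (x - x0) \<le> 0" for i using True by (simp add: mult_nonneg_nonpos)
      hence "r i x = 0" for i unfolding r_def by simp
      thus ?thesis using True by (simp add: cut_deriv_def)
    next
      case False
      obtain N :: nat where N: "1 < real N * (x - x0)" using False ex_less_of_nat_mult[of "x - x0" 1] by auto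
      have "r i x = 1" if "i \<ge> N" for i
      proof -
        have "real N * (x - x0) \<le> real i * (x - x0)" using that False by (intro mult_right_mono) auto
        thus ?thesis unfolding r_def using N by simp
      qed
      hence "eventually (\<lambda>i. u x * r i x = u x) sequentially"
        unfolding eventually_sequentially by (intro exI[of _ N]) simp
      moreover have "u x = cut_deriv x0 b y k x" using False by (simp add: u_def cut_deriv_def max_def)
      ultimately show ?thesis by (simp add: tendsto_eventually)
    qed
    moreover have "(\<lambda>i. poly (g i) x - u x * r i x) \<longlonglongrightarrow> 0"
    proof (rule tendsto_0_le[where K = 1])
      show "(\<lambda>i. 1 / real (Suc i)) \<longlonglongrightarrow> 0" using LIMSEQ_inverse_real_of_nat by (simp add: inverse_eq_divide)
      show "eventually (\<lambda>i. norm (poly (g i) x - u x * r i x) \<le> norm (1 / real (Suc i)) * 1) sequentially"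
      proof (rule always_eventually, rule allI)
        fix i show "norm (poly (g i) x - u x * r i x) \<le> norm (1 / real (Suc i)) * 1"
          using g[OF x, of i] by (simp add: abs_minus_commute)
      qed
    qed
    ultimately have "(\<lambda>i. (poly (g i) x - u x * r i x) + u x * r i x) \<longlonglongrightarrow> 0 + cut_deriv x0 b y k x"
      by (rule tendsto_add[rotated])
    thus ?thesis by simp
  qed
  ultimately show ?thesis by blast
qed

lemma poly_pderiv_integral:
  assumes "s \<le> (t :: real)"
  shows "(poly (pderiv P) has_integral (poly P t - poly P s)) {s..t}"
  using assms
  by (intro fundamental_theorem_of_calculus)
    (auto simp: has_real_derivative_iff_has_vector_derivative[symmetric] intro: poly_DERIV DERIV_subset)

text \<open>Dominated convergence between x0 and x. As \<open>twist_deriv b l y\<close> vanishes at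
  x0, the l-th derivative of the cut function is the integral of the next one from x0, even if that
  one jumps there.\<close>

lemma antiderivative_limit:
  assumes x0: "-1 < x0" "x0 < 1" and x: "x \<in> {-1..1}"
    and P: "\<And>i. poly (P i) x0 = 0" and y0: "poly (twist_deriv b l y) x0 = 0"
    and C: "\<And>i t. t \<in> {-1..1} \<Longrightarrow> \<bar>poly (pderiv (P i)) t\<bar> \<le> C"
    and lim: "\<And>t. t \<in> {-1..1} \<Longrightarrow> (\<lambda>i. poly (pderiv (P i)) t) \<longlonglongrightarrow> cut_deriv x0 b y (Suc l) t"
  shows "(\<lambda>i. poly (P i) x) \<longlonglongrightarrow> cut_deriv x0 b y l x"
proof -
  have dom: "(\<lambda>i. integral {s..t} (poly (pderiv (P i)))) \<longlonglongrightarrow> integral {s..t} (cut_deriv x0 b y (Suc l))"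
    if "-1 \<le> s" "t \<le> 1" "s \<le> t" for s t
  proof (rule dominated_convergence(2)[where h = "\<lambda>_. C"])
    show "poly (pderiv (P i)) integrable_on {s..t}" for i
      using poly_pderiv_integral[OF that(3)] by blast
    show "(\<lambda>_. C) integrable_on {s..t}" by (rule integrable_continuous_real) simp
    show "norm (poly (pderiv (P i)) z) \<le> C" if "z \<in> {s..t}" for i z
      using C[of z i] that \<open>-1 \<le> s\<close> \<open>t \<le> 1\<close> by simp
    show "(\<lambda>i. poly (pderiv (P i)) z) \<longlonglongrightarrow> cut_deriv x0 b y (Suc l) z" if "z \<in> {s..t}" for z
      using lim[of z] that \<open>-1 \<le> s\<close> \<open>t \<le> 1\<close> by simp
  qed
  have int: "integral {s..t} (poly (pderiv (P i))) = poly (P i) t - poly (P i) s" if "s \<le> t" for s t i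
    using poly_pderiv_integral[OF that] by (rule integral_unique)
  show ?thesis
  proof (cases "x \<le> x0")
    case True
    have "integral {x..x0} (cut_deriv x0 b y (Suc l)) = integral {x..x0} (\<lambda>_. 0)"
      by (rule integral_cong) (simp add: cut_deriv_def)
    hence "(\<lambda>i. - poly (P i) x) \<longlonglongrightarrow> 0"
      using dom[of x x0] True x x0 by (simp add: int P)
    from tendsto_minus[OF this] show ?thesis using True by (simp add: cut_deriv_def)
  next
    case False
    let ?F = "\<lambda>l x. (1 + x) powr (- b - real l) * poly (twist_deriv b l y) x"
    have "(?F (Suc l) has_integral (?F l x - ?F l x0)) {x0..x}"
    proof (rule fundamental_theorem_of_calculus)
      show "x0 \<le> x" using False by simp
      fix t assume "t \<in> {x0..x}"
      hence "(?F l has_real_derivative ?F (Suc l) t) (at t)" using x0 by (intro cut_deriv_has_derivative) auto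
      thus "(?F l has_vector_derivative ?F (Suc l) t) (at t within {x0..x})"
        by (simp add: has_real_derivative_iff_has_vector_derivative has_vector_derivative_at_within)
    qed
    hence J: "(?F (Suc l) has_integral ?F l x) {x0..x}" using y0 by simp
    have "(cut_deriv x0 b y (Suc l) has_integral ?F l x) {x0..x}"
      by (rule has_integral_spike[OF _ _ J, of "{x0}"]) (auto simp: cut_deriv_def)
    hence e: "integral {x0..x} (cut_deriv x0 b y (Suc l)) = ?F l x" by (rule integral_unique)
    have "-1 \<le> x0" "x \<le> 1" "x0 \<le> x" using False x x0 by auto
    from dom[OF this] have "(\<lambda>i. poly (P i) x) \<longlonglongrightarrow> ?F l x"
      unfolding e int[OF \<open>x0 \<le> x\<close>] P by (simp only: diff_zero)
    moreover have "cut_deriv x0 b y l x = ?F l x" using False by (simp add: cut_deriv_def)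
    ultimately show ?thesis by (simp only:)
  qed
qed

lemma cut_approximation:
  assumes x0: "-1 < x0" "x0 < 1" and y: "[:-x0,1:] ^ k dvd y"
  shows "\<exists>q. bconv k (cut_deriv x0 b y) q \<and> (\<forall>i. \<forall>l<k. poly ((pderiv ^^ l) (q i)) x0 = 0)"
proof -
  obtain g :: "nat \<Rightarrow> real poly" and C where
    g: "\<forall>i. \<forall>x\<in>{-1..1}. \<bar>poly (g i) x\<bar> \<le> C"
       "\<forall>x\<in>{-1..1}. (\<lambda>i. poly (g i) x) \<longlonglongrightarrow> cut_deriv x0 b y k x"
    using cut_deriv_top_approx[OF x0, of b y k] by blast
  have "\<forall>i. \<exists>Q. (pderiv ^^ k) Q = g i \<and> (\<forall>l<k. poly ((pderiv ^^ l) Q) x0 = 0)"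
    using poly_iterated_antiderivative by blast
  from choice[OF this] obtain q where
    q: "\<And>i. (pderiv ^^ k) (q i) = g i" "\<And>i l. l < k \<Longrightarrow> poly ((pderiv ^^ l) (q i)) x0 = 0"
    by blast
  \<comment> \<open>Induction downwards from order k: bound and limit of one derivative come from
    those of the next by integrating from x0.\<close>
  have "(\<exists>C. \<forall>i. \<forall>x\<in>{-1..1}. \<bar>poly ((pderiv ^^ (k - j)) (q i)) x\<bar> \<le> C) \<and>
     (\<forall>x\<in>{-1..1}. (\<lambda>i. poly ((pderiv ^^ (k - j)) (q i)) x) \<longlonglongrightarrow> cut_deriv x0 b y (k - j) x)" if "j \<le> k" for j
    using that
  proof (induction j)
    case 0 thus ?case using g q by auto
  next
    case (Suc j)
    define l where "l = k - Suc j"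
    have l: "k - j = Suc l" "l < k" using Suc.prems unfolding l_def by auto
    define P where "P = (\<lambda>i. (pderiv ^^ l) (q i))"
    have dP: "pderiv (P i) = (pderiv ^^ (k - j)) (q i)" for i unfolding P_def l(1) by simp
    have IH: "(\<exists>C. \<forall>i. \<forall>x\<in>{-1..1}. \<bar>poly (pderiv (P i)) x\<bar> \<le> C) \<and>
       (\<forall>x\<in>{-1..1}. (\<lambda>i. poly (pderiv (P i)) x) \<longlonglongrightarrow> cut_deriv x0 b y (Suc l) x)"
      using Suc unfolding dP l(1)[symmetric] by simp
    then obtain B where "\<forall>i. \<forall>x\<in>{-1..1}. \<bar>poly (pderiv (P i)) x\<bar> \<le> B" by blast
    hence B: "\<And>i x. x \<in> {-1..1} \<Longrightarrow> \<bar>poly (pderiv (P i)) x\<bar> \<le> B" by blast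
    have lim: "\<And>x. x \<in> {-1..1} \<Longrightarrow> (\<lambda>i. poly (pderiv (P i)) x) \<longlonglongrightarrow> cut_deriv x0 b y (Suc l) x"
      using IH by blast
    have P0: "poly (P i) x0 = 0" for i unfolding P_def using q(2) l(2) by simp
    have B0: "B \<ge> 0" using B[of 0 0] by auto
    have "\<bar>poly (P i) x\<bar> \<le> B * 2" if x: "x \<in> {-1..1}" for i x
    proof -
      have "norm (poly (P i) x - poly (P i) x0) \<le> B * norm (x - x0)"
      proof (rule field_differentiable_bound[of "{-1..1}"])
        show "(poly (P i) has_field_derivative poly (pderiv (P i)) z) (at z within {-1..1})" for z
          by (rule DERIV_subset[OF poly_DERIV]) simp
        show "norm (poly (pderiv (P i)) z) \<le> B" if "z \<in> {-1..1}" for z using B[OF that] by simp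
      qed (use x x0 in auto)
      also have "\<dots> \<le> B * 2" using x x0 B0 by (intro mult_left_mono) auto
      finally show ?thesis using P0 by simp
    qed
    moreover have "(\<lambda>i. poly (P i) x) \<longlonglongrightarrow> cut_deriv x0 b y l x" if x: "x \<in> {-1..1}" for x
    proof (rule antiderivative_limit[OF x0 x P0 _ B lim])
      have "k = Suc (k - Suc l) + l" using l(2) by simp
      hence "[:-x0,1:] ^ Suc (k - Suc l) dvd twist_deriv b l y" using y by (intro twist_deriv_order) metis
      thus "poly (twist_deriv b l y) x0 = 0" by (rule power_dvd_root)
    qed
    ultimately show ?case unfolding l_def[symmetric] P_def by blast
  qed
  hence all: "(\<exists>C. \<forall>i. \<forall>x\<in>{-1..1}. \<bar>poly ((pderiv ^^ l) (q i)) x\<bar> \<le> C) \<and>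
     (\<forall>x\<in>{-1..1}. (\<lambda>i. poly ((pderiv ^^ l) (q i)) x) \<longlonglongrightarrow> cut_deriv x0 b y l x)" if "l \<le> k" for l
    using that by (metis diff_diff_cancel diff_le_self)
  have "bconv k (cut_deriv x0 b y) q"
    unfolding bconv_def
  proof (intro allI impI conjI)
    fix l assume l: "l \<le> k"
    then obtain B where "\<forall>i. \<forall>x\<in>{-1..1}. \<bar>poly ((pderiv ^^ l) (q i)) x\<bar> \<le> B" using all by blast
    thus "\<exists>C. \<forall>i x. -1 < x \<and> x < 1 \<longrightarrow> \<bar>poly ((pderiv ^^ l) (q i)) x\<bar> \<le> C" by (intro exI[of _ B]) auto
    fix x :: real assume "-1 < x \<and> x < 1"
    thus "(\<lambda>i. poly ((pderiv ^^ l) (q i)) x) \<longlonglongrightarrow> cut_deriv x0 b y l x" using all[OF l] by auto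
  qed
  thus ?thesis using q(2) by blast
qed

lemma fpart_square_nonzero:
  assumes "a > -1" "-1 < x0" "x0 < 1" "y \<noteq> 0"
  shows "fpart x0 a (y * y) \<noteq> 0"
proof
  assume z: "fpart x0 a (y * y) = 0"
  define g where "g = (\<lambda>x. jweight a 0 x * (if x \<le> x0 then 0 else poly (y * y) x))"
  obtain C where C: "\<forall>x\<in>{-1..1}. \<bar>poly (y * y) x\<bar> \<le> C" using poly_bounded by blast
  have "C \<ge> 0" using order.trans[OF abs_ge_zero bspec[OF C, of 0]] by simp
  have int: "integrable lborel g" unfolding g_def
    by (rule integrable_jweight_bounded[OF assms(1), of 0 _ C]) (use C \<open>C \<ge> 0\<close> in auto)
  have nn: "g x \<ge> 0" for x unfolding g_def using jweight_nonneg by simp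
  have "integral\<^sup>L lborel g = 0"
    using z fpart_integral[OF assms(1-3), of "y * y"] unfolding jint_def g_def by simp
  hence "AE x in lborel. g x = 0" using integral_nonneg_eq_0_iff_AE[OF int] nn by simp
  hence "AE x in lborel. x \<notin> {x0<..<1} - {x. poly y x = 0}"
  proof (rule AE_mp, intro AE_I2 impI notI)
    fix x assume "g x = 0" "x \<in> {x0<..<1} - {x. poly y x = 0}"
    thus False unfolding g_def jweight_def using assms(2,3) by auto
  qed
  moreover have "finite {x. poly y x = 0}" using assms(4) by (rule poly_roots_finite)
  hence "AE x in lborel. x \<notin> {x. poly y x = 0}"
    by (intro AE_not_in null_setsI) (auto simp: finite_imp_null_set_lborel[THEN null_setsD1] intro: finite_imp_closed borel_closed)
  ultimately have "AE x in lborel. x \<notin> {x0<..<1}" by eventually_elim auto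
  hence "emeasure lborel {x0<..<1} = 0"
    by (subst (asm) AE_iff_measurable[of "{x0<..<1}"]) auto
  thus False using assms(3) by simp
qed

section \<open>The quadratic form argument at an interior zero\<close>

context
  fixes \<alpha> \<beta> :: real and F2 :: "nat set"
  assumes F: "finite F2" "F2 \<noteq> {}" "\<forall>f\<in>F2. f > 0"
    and A1: "A1 \<alpha> \<beta>" and A2: "A2 \<alpha> \<beta> F2"
    and adm: "jacobi_admissible \<alpha> \<beta> F2"
begin

lemma seed_sum_order_interior:
  assumes c: "\<exists>f\<in>F2. c f \<noteq> 0" and x0: "-1 < x0" "x0 < 1"
  shows "\<not> [:-x0,1:] ^ card F2 dvd (\<Sum>f\<in>F2. psm (c f) (jacobiP \<alpha> (-\<beta>) f))"
proof
  define y where "y = (\<Sum>f\<in>F2. psm (c f) (jacobiP \<alpha> (-\<beta>) f))"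
  define k where "k = card F2"
  define ms where "ms = map (\<lambda>f. (real f - \<beta>) * (real f + \<alpha> + 1)) (sorted_list_of_set F2)"
  define R where "R = shift_prod (Lop \<alpha> \<beta>) ms"
  define Q where "Q = (\<lambda>p r. Lam \<alpha> \<beta> (p * R r))"
  define ell where "ell = (\<lambda>r. fpart x0 \<alpha> (y * R r))"
  assume dvd: "[:-x0,1:] ^ card F2 dvd (\<Sum>f\<in>F2. psm (c f) (jacobiP \<alpha> (-\<beta>) f))"
  hence y: "[:-x0,1:] ^ k dvd y" unfolding y_def k_def .
  have ynz: "y \<noteq> 0" unfolding y_def by (rule seed_sum_nonzero[OF F(1) A1 A2 c])
  have k: "k > 0" unfolding k_def using F by (simp add: card_gt_0_iff)
  have ak: "\<alpha> + real k > -1" and b: "\<beta> > -1"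
    using admissible_bounds[OF F A1 A2 adm] k unfolding k_def by linarith+
  have reg: "\<not> negint \<alpha>" using A1 unfolding A1_def by simp
  have lenms: "length ms = k" unfolding ms_def k_def using F by simp
  have Rlin: "poly_linear R" unfolding R_def by (rule shift_prod_linear[OF Lop_linear])
  have Radd: "R (p + r) = R p + R r" and Rsmult: "R (psm t p) = psm t (R p)" for p r t
    using Rlin unfolding poly_linear_def by auto
  have Qsym: "Q p r = Q r p" for p r
    unfolding Q_def R_def by (rule quadratic_form_sym[OF reg b])
  have Qadd: "Q (p + p') r = Q p r + Q p' r" for p p' r
    unfolding Q_def by (simp add: distrib_right Lam_add[OF reg b])
  have Qsm: "Q (psm t p) r = t * Q p r" for t p r
    unfolding Q_def by (simp add: Lam_smult[OF reg b])
  have Qadd2: "Q r (p + p') = Q r p + Q r p'" and Qsm2: "Q r (psm t p) = t * Q r p" for p p' r t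
    using Qadd Qsm Qsym by metis+
  have Qpos: "Q p p \<ge> 0" for p
    unfolding Q_def R_def ms_def by (rule quadratic_form_nonneg[OF F(1) A1 b adm])
  obtain q where q: "bconv k (cut_deriv x0 \<beta> y) q" "\<forall>i. \<forall>l<k. poly ((pderiv ^^ l) (q i)) x0 = 0"
    using cut_approximation[OF x0 y] by blast
  have lim: "(\<lambda>j. Q (q j) r) \<longlonglongrightarrow> ell r" for r
    unfolding Q_def ell_def by (rule Lam_limit_fpart[OF x0 reg ak b y q(1)])
  \<comment> \<open>Green's formula moves the whole operator onto y, which its factors annihilate; y
    and the \<open>q i\<close> have k zeros each at x0, enough to remove the boundary terms.\<close>
  have ell0: "(\<lambda>i. ell (q i)) \<longlonglongrightarrow> 0"
  proof -
    have "jets_null x0 k q" unfolding jets_null_def using q(2) by simp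
    hence "(\<lambda>i. fpart x0 \<alpha> (y * shift_prod (Lop \<alpha> \<beta>) ms (q i)) - fpart x0 \<alpha> (shift_prod (conjLop \<alpha> \<beta>) (rev ms) y * q i)) \<longlonglongrightarrow> 0"
      by (rule fpart_shift_prod_limit[OF reg _ y]) (simp add: lenms)
    moreover have "shift_prod (conjLop \<alpha> \<beta>) (rev ms) y = 0"
      unfolding y_def by (rule shift_prod_all_seeds[OF F(1) A1 A2]) (use F(1) in \<open>auto simp: ms_def\<close>)
    moreover have "fpart x0 \<alpha> 0 = 0" using fpart_smult[OF reg, of x0 0 0] by simp
    ultimately show ?thesis unfolding ell_def R_def by simp
  qed
  \<comment> \<open>A later approximant \<open>q (j i)\<close> stands in for the limit function when
    paired with \<open>q i\<close>; \<open>j i >= i\<close> makes the differences \<open>d i\<close>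
    null.\<close>
  have "\<exists>j\<ge>i. \<bar>Q (q j) (q i) - ell (q i)\<bar> < 1 / real (Suc i)" for i
  proof -
    have "eventually (\<lambda>j. dist (Q (q j) (q i)) (ell (q i)) < 1 / real (Suc i)) sequentially"
      by (rule tendstoD[OF lim]) simp
    then obtain N where "\<forall>j\<ge>N. dist (Q (q j) (q i)) (ell (q i)) < 1 / real (Suc i)"
      unfolding eventually_sequentially by blast
    thus ?thesis by (intro exI[of _ "max N i"]) (simp add: dist_real_def)
  qed
  then obtain j where j: "\<And>i. j i \<ge> i" "\<And>i. \<bar>Q (q (j i)) (q i) - ell (q i)\<bar> < 1 / real (Suc i)"
    by metis
  define d where "d = (\<lambda>i. q i - q (j i))"
  have jtop: "filterlim j at_top sequentially"
    using j(1) by (intro filterlim_at_top_mono[OF filterlim_ident]) auto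
  have d: "bnull k d"
    unfolding bconv_def
  proof (intro allI impI conjI)
    fix l assume l: "l \<le> k"
    obtain C where C: "\<And>i x. -1 < x \<and> x < 1 \<Longrightarrow> \<bar>poly ((pderiv ^^ l) (q i)) x\<bar> \<le> C"
      using q(1) l unfolding bconv_def by metis
    have dl: "poly ((pderiv ^^ l) (d i)) x = poly ((pderiv ^^ l) (q i)) x - poly ((pderiv ^^ l) (q (j i))) x" for i x
    proof -
      have "(pderiv ^^ l) (p - r) = (pderiv ^^ l) p - (pderiv ^^ l) r" for p r :: "real poly"
        by (induction l) (simp_all add: pderiv_diff)
      thus ?thesis unfolding d_def by simp
    qed
    have "\<bar>poly ((pderiv ^^ l) (d i)) x\<bar> \<le> 2 * C" if "-1 < x \<and> x < 1" for i x
      unfolding dl using C[OF that, of i] C[OF that, of "j i"] by linarith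
    thus "\<exists>C. \<forall>i x. -1 < x \<and> x < 1 \<longrightarrow> \<bar>poly ((pderiv ^^ l) (d i)) x\<bar> \<le> C" by blast
    fix x :: real assume x: "-1 < x \<and> x < 1"
    have lq: "(\<lambda>i. poly ((pderiv ^^ l) (q i)) x) \<longlonglongrightarrow> cut_deriv x0 \<beta> y l x"
      using q(1) l x unfolding bconv_def by blast
    have "(\<lambda>i. poly ((pderiv ^^ l) (q i)) x - poly ((pderiv ^^ l) (q (j i))) x) \<longlonglongrightarrow> cut_deriv x0 \<beta> y l x - cut_deriv x0 \<beta> y l x"
      by (intro tendsto_diff lq filterlim_compose[OF lq jtop])
    thus "(\<lambda>i. poly ((pderiv ^^ l) (d i)) x) \<longlonglongrightarrow> 0" unfolding dl by simp
  qed
  have Qd: "(\<lambda>i. Q (d i) (d i)) \<longlonglongrightarrow> 0"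
    using quadratic_form_bnull[OF reg ak b d d, of ms] lenms unfolding Q_def R_def by (simp add: mult.commute)
  have Qj: "(\<lambda>i. Q (q (j i)) (q i)) \<longlonglongrightarrow> 0"
  proof -
    have "(\<lambda>i. Q (q (j i)) (q i) - ell (q i)) \<longlonglongrightarrow> 0"
    proof (rule tendsto_0_le[where K = 1])
      show "(\<lambda>i. 1 / real (Suc i)) \<longlonglongrightarrow> 0" using LIMSEQ_inverse_real_of_nat by (simp add: inverse_eq_divide)
      show "eventually (\<lambda>i. norm (Q (q (j i)) (q i) - ell (q i)) \<le> norm (1 / real (Suc i)) * 1) sequentially"
        using j(2) by (intro always_eventually allI) (simp add: less_imp_le)
    qed
    from tendsto_add[OF this ell0] show ?thesis by simp
  qed
  \<comment> \<open>\<open>lim\<close> does not apply, since both arguments move. Expanding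
    \<open>Q (d i) (d i)\<close> and dropping \<open>Q (q (j i)) (q (j i)) \<ge> 0\<close> bounds
    the values by null sequences.\<close>
  have Qq: "(\<lambda>i. Q (q i) (q i)) \<longlonglongrightarrow> 0"
  proof (rule tendsto_sandwich[where f = "\<lambda>_. 0" and h = "\<lambda>i. Q (d i) (d i) + 2 * Q (q (j i)) (q i)"])
    have "Q (q i) (q i) \<le> Q (d i) (d i) + 2 * Q (q (j i)) (q i)" for i
    proof -
      have "d i = q i + psm (-1) (q (j i))" unfolding d_def by simp
      hence "Q (d i) (d i) = Q (q i) (q i) - 2 * Q (q (j i)) (q i) + Q (q (j i)) (q (j i))"
        using Qsym[of "q i" "q (j i)"] by (simp only: Qadd Qadd2 Qsm Qsm2) simp
      thus ?thesis using Qpos[of "q (j i)"] by linarith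
    qed
    thus "eventually (\<lambda>i. Q (q i) (q i) \<le> Q (d i) (d i) + 2 * Q (q (j i)) (q i)) sequentially" by simp
    show "(\<lambda>i. Q (d i) (d i) + 2 * Q (q (j i)) (q i)) \<longlonglongrightarrow> 0"
      using tendsto_add[OF Qd tendsto_mult_left[OF Qj, of 2]] by simp
  qed (use Qpos in auto)
  have "ell r = 0" for r
  proof -
    \<comment> \<open>The Cauchy-Schwarz argument in the limit: positivity at
      \<open>q i + psm t r\<close>, whose pure \<open>q i\<close> term disappears.\<close>
    have ineq: "0 \<le> 2 * t * ell r + t\<^sup>2 * Q r r" for t
    proof (rule LIMSEQ_le_const)
      show "(\<lambda>i. Q (q i) (q i) + (2 * t * Q (q i) r + t\<^sup>2 * Q r r)) \<longlonglongrightarrow> 2 * t * ell r + t\<^sup>2 * Q r r"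
        using tendsto_add[OF Qq tendsto_add[OF tendsto_mult_left[OF lim[of r], of "2 * t"] tendsto_const[of "t\<^sup>2 * Q r r"]]] by simp
      have "Q (q i + psm t r) (q i + psm t r) = Q (q i) (q i) + (2 * t * Q (q i) r + t\<^sup>2 * Q r r)" for i
        using Qsym[of r "q i"] by (simp only: Qadd Qadd2 Qsm Qsm2) (simp add: power2_eq_square algebra_simps)
      thus "\<exists>N. \<forall>i\<ge>N. 0 \<le> Q (q i) (q i) + (2 * t * Q (q i) r + t\<^sup>2 * Q r r)" using Qpos by metis
    qed
    show ?thesis
    proof (rule ccontr)
      assume nz: "ell r \<noteq> 0"
      \<comment> \<open>The summand 1 covers the case \<open>Q r r = 0\<close>; with this t the
        expression becomes -t^2 (\<open>Q r r\<close> + 2).\<close>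
      define t where "t = - ell r / (Q r r + 1)"
      have Q1: "Q r r + 1 > 0" using Qpos[of r] by simp
      have l: "ell r = - (t * (Q r r + 1))" unfolding t_def using Q1 by simp
      have "2 * t * ell r + t\<^sup>2 * Q r r = - (t\<^sup>2 * (Q r r + 2))"
        unfolding l by (simp add: power2_eq_square algebra_simps)
      moreover have "t \<noteq> 0" using nz Q1 unfolding t_def by simp
      hence "t\<^sup>2 * (Q r r + 2) > 0" using Q1 by (intro mult_pos_pos) auto
      ultimately show False using ineq[of t] by linarith
    qed
  qed
  \<comment> \<open>The factor (1 - x)^k lifts the exponent to \<alpha> + k > -1, where the finite
    part is a convergent integral of y^2. It is attained because no eigenvalue of \<open>R\<close>
    on the Jacobi basis is zero.\<close>
  moreover have "\<exists>r. R r = [:1,-1:] ^ k * y"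
    unfolding R_def ms_def
  proof (rule shift_prod_surj[OF F(1) A1 b])
    fix n
    have "real n + real f + \<alpha> + 1 \<noteq> 0" for f
    proof
      assume "real n + real f + \<alpha> + 1 = 0"
      hence "\<alpha> = - real (n + f + 1)" by simp
      thus False using reg unfolding negint_def by (metis le_add2)
    qed
    thus "(\<Prod>f\<in>F2. (real n + \<beta> - real f) * (real n + real f + \<alpha> + 1)) \<noteq> 0"
      using F(1) A2_nonzero[OF F(1) A2] by simp
  qed
  ultimately have "fpart x0 \<alpha> (y * ([:1,-1:] ^ k * y)) = 0" unfolding ell_def by metis
  moreover have "fpart x0 a ([:1,-1:] ^ n * z) = fpart x0 (a + real n) z" if "\<not> negint a" for a n z
    using that
  proof (induction n arbitrary: a)
    case (Suc n)
    have "fpart x0 a ([:1,-1:] ^ Suc n * z) = fpart x0 a ([:1,-1:] * ([:1,-1:] ^ n * z))"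
      by (simp only: power_Suc mult.assoc)
    also have "\<dots> = fpart x0 (a + 1) ([:1,-1:] ^ n * z)" by (rule fpart_one_minus[OF Suc.prems x0(2)])
    also have "\<dots> = fpart x0 (a + 1 + real n) z" by (rule Suc.IH[OF negint_shift[OF Suc.prems]])
    finally show ?case by (simp add: add_ac)
  qed simp
  ultimately have "fpart x0 (\<alpha> + real k) (y * y) = 0" using reg by (metis mult.left_commute)
  thus False using fpart_square_nonzero[OF ak x0 ynz] by simp
qed

end

theorem theorem6p6:
  fixes \<alpha> \<beta> :: real and F2 :: "nat set"
  assumes "finite F2" and "F2 \<noteq> {}" and "\<forall>f\<in>F2. f > 0"
    and "A1 \<alpha> \<beta>" and "A2 \<alpha> \<beta> F2"
    and "jacobi_admissible \<alpha> \<beta> F2"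
  shows "\<alpha> + real (card F2) + 1 > 0 \<and> \<beta> - real (card F2) + 1 > 0 \<and>
         (\<forall>x\<in>{-1..1}. Omega \<alpha> \<beta> F2 x \<noteq> 0)"
proof (intro conjI ballI)
  show "\<alpha> + real (card F2) + 1 > 0" "\<beta> - real (card F2) + 1 > 0"
    using admissible_bounds[OF assms] by auto
  fix x :: real assume x: "x \<in> {-1..1}"
  show "Omega \<alpha> \<beta> F2 x \<noteq> 0"
  proof
    assume "Omega \<alpha> \<beta> F2 x = 0"
    from Omega_zero_imp_high_order[OF assms(1) this] obtain c where c: "\<exists>f\<in>F2. c f \<noteq> 0"
      "[:-x,1:] ^ card F2 dvd (\<Sum>f\<in>F2. psm (c f) (jacobiP \<alpha> (-\<beta>) f))" .
    show False
    proof (cases "x = 1 \<or> x = -1")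
      case True
      thus False using seed_sum_order_at_ends[OF assms(1,4,5) c(1)] c(2) by blast
    next
      case False
      hence "-1 < x" "x < 1" using x by auto
      thus False using seed_sum_order_interior[OF assms c(1)] c(2) by blast
    qed
  qed
qed

end
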